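(* For any encoding $\{|\mathbf0\rangle,|\mathbf1\rangle\}$, the family of encoded 2D cluster states $\{|\mathbf C_{d\times d}\rangle\}_{d\ge1}$ is an encoded universal resource under LOCC up to logical single-system Pauli operations. Moreover, any family of encoded 2D cluster states is CC-universal under LOCC.
   Context: The 2D cluster state $|C_{d\times d}\rangle$ is the graph state of the $d\times d$ square grid graph, i.e. the joint $+1$ eigenstate of $\sigma_x^{(a)}\prod_{b\sim a}\sigma_z^{(b)}$ over all vertices $a$ (one qubit per vertex, $b\sim a$ meaning adjacent). An encoding is a fixed pair of orthogonal $m$-qubit states $|\mathbf0\rangle,|\mathbf1\rangle$; the encoded version of an $N$-qubit state $\sum c_{i_1\dots i_N}|i_1\dots i_N\rangle$ is $\sum c_{i_1\dots i_N}|\mathbf i_1\rangle_{A_1}\cdots|\mathbf i_N\rangle_{A_N}$ on $mN$ physical qubits split into disjoint blocks $A_k$ of $m$ qubits; $|\mathbf C_{d\times d}\rangle$ is the encoded version of $|C_{d\times d}\rangle$. Logical Pauli operators on a block are $\boldsymbol\sigma_z=|\mathbf0\rangle\langle\mathbf0|-|\mathbf1\rangle\langle\mathbf1|$, $\boldsymbol\sigma_x=|\mathbf0\rangle\langle\mathbf1|+|\mathbf1\rangle\langle\mathbf0|$, $\boldsymbol\sigma_y=-i|\mathbf0\rangle\langle\mathbf1|+i|\mathbf1\rangle\langle\mathbf0|$. "Encoded universal resource under LOCC up to logical single-system Pauli operations" means: for every $n$ and every $n$-qubit $|\phi\rangle$ there is $d$ and an LOCC protocol on the physical qubits of $|\mathbf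 C_{d\times d}\rangle$ (each physical qubit a separate party) which, exactly and with probability one, leaves a fixed set of $n$ blocks in the state $(\mathbf P_1\otimes\cdots\otimes\mathbf P_n)|\boldsymbol\phi\rangle$, where $|\boldsymbol\phi\rangle$ is the encoded version of $|\phi\rangle$ and each $\mathbf P_k\in\{\mathbf 1,\boldsymbol\sigma_x,\boldsymbol\sigma_y,\boldsymbol\sigma_z\}$ may depend on the branch. CC-universal means: for every $n$, every $n$-qubit unitary $U$ and every choice of single-qubit measurements on the $n$ qubits, some member of the family and some LOCC protocol on it produce classical output distributed as the outcomes of those measurements performed on $U|0\rangle^{\otimes n}$. *)

theory Defs
  imports Complex_Main
begin

text \<open>A (possibly unnormalised) state vector of M qubits is a function from
computational basis strings (bool lists of length M; False = 0, True = 1) to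
complex amplitudes; values on strings of other lengths are irrelevant.
A single-qubit operator is a 2x2 complex matrix  A row col  indexed by bool.\<close>

type_synonym qstate = "bool list \<Rightarrow> complex"
type_synonym qop1 = "bool \<Rightarrow> bool \<Rightarrow> complex"

definition bl :: "nat \<Rightarrow> bool list set" where
  "bl M = {x. length x = M}"

definition nsq :: "nat \<Rightarrow> qstate \<Rightarrow> real" where
  "nsq M v = (\<Sum>x\<in>bl M. (cmod (v x))^2)"

definition inner_st :: "nat \<Rightarrow> qstate \<Rightarrow> qstate \<Rightarrow> complex" where
  "inner_st M u v = (\<Sum>x\<in>bl M. cnj (u x) * v x)"

definition apply1 :: "nat \<Rightarrow> qop1 \<Rightarrow> qstate \<Rightarrow> qstate" where
  "apply1 k A \<psi> x = (\<Sum>b\<in>UNIV. A (x ! k) b * \<psi> (x[k := b]))"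

definition sig_x :: qop1 where "sig_x a b = (if a \<noteq> b then 1 else 0)"
definition sig_y :: qop1 where
  "sig_y a b = (if \<not> a \<and> b then - \<i> else if a \<and> \<not> b then \<i> else 0)"
definition sig_z :: qop1 where "sig_z a b = (if a = b then (if a then -1 else 1) else 0)"
definition sig_id :: qop1 where "sig_id a b = (if a = b then 1 else 0)"

definition pauli :: "nat \<Rightarrow> qop1" where
  "pauli p = (if p = 1 then sig_x else if p = 2 then sig_y else if p = 3 then sig_z else sig_id)"

definition unitary1 :: "qop1 \<Rightarrow> bool" where
  "unitary1 W \<longleftrightarrow> (\<forall>a b. (\<Sum>c\<in>UNIV. cnj (W c a) * W c b) = (if a = b then 1 else 0))"

text \<open>Vertex v < d*d of the d x d grid is (v div d, v mod d).\<close>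
definition grid_adj :: "nat \<Rightarrow> nat \<Rightarrow> nat \<Rightarrow> bool" where
  "grid_adj d a b \<longleftrightarrow> a < d * d \<and> b < d * d \<and>
     ((a div d = b div d \<and> (a mod d = b mod d + 1 \<or> b mod d = a mod d + 1)) \<or>
      (a mod d = b mod d \<and> (a div d = b div d + 1 \<or> b div d = a div d + 1)))"

text \<open>psi is (a normalised representative of) the cluster state on the d x d grid:
joint +1 eigenvector of  X_a prod_{b ~ a} Z_b  for all vertices a.\<close>
definition is_cluster :: "nat \<Rightarrow> qstate \<Rightarrow> bool" where
  "is_cluster d \<psi> \<longleftrightarrow> nsq (d * d) \<psi> = 1 \<and>
     (\<forall>a < d * d. \<forall>x \<in> bl (d * d).
        apply1 a sig_x (foldr (\<lambda>b. apply1 b sig_z) (filter (grid_adj d a) [0..<d * d]) \<psi>) x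
          = \<psi> x)"

definition encoding :: "nat \<Rightarrow> qstate \<Rightarrow> qstate \<Rightarrow> bool" where
  "encoding m e0 e1 \<longleftrightarrow> nsq m e0 = 1 \<and> nsq m e1 = 1 \<and> inner_st m e0 e1 = 0"

definition ebit :: "qstate \<Rightarrow> qstate \<Rightarrow> bool \<Rightarrow> qstate" where
  "ebit e0 e1 a = (if a then e1 else e0)"

definition blk :: "nat \<Rightarrow> nat \<Rightarrow> bool list \<Rightarrow> bool list" where
  "blk m k x = take m (drop (k * m) x)"

definition set_blk :: "nat \<Rightarrow> nat \<Rightarrow> bool list \<Rightarrow> bool list \<Rightarrow> bool list" where
  "set_blk m k x z = take (k * m) x @ z @ drop (k * m + m) x"

definition enc :: "nat \<Rightarrow> qstate \<Rightarrow> qstate \<Rightarrow> nat \<Rightarrow> qstate \<Rightarrow> qstate" where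
  "enc m e0 e1 N \<psi> x = (\<Sum>i\<in>bl N. \<psi> i * (\<Prod>k<N. ebit e0 e1 (i ! k) (blk m k x)))"

definition lop :: "qstate \<Rightarrow> qstate \<Rightarrow> qop1 \<Rightarrow> bool list \<Rightarrow> bool list \<Rightarrow> complex" where
  "lop e0 e1 P y z = (\<Sum>a\<in>UNIV. \<Sum>b\<in>UNIV. P a b * ebit e0 e1 a y * cnj (ebit e0 e1 b z))"

definition apply_block :: "nat \<Rightarrow> nat \<Rightarrow> (bool list \<Rightarrow> bool list \<Rightarrow> complex) \<Rightarrow> qstate \<Rightarrow> qstate" where
  "apply_block m k L \<psi> x = (\<Sum>z\<in>bl m. L (blk m k x) z * \<psi> (set_blk m k x z))"

definition pauli_enc :: "nat \<Rightarrow> qstate \<Rightarrow> qstate \<Rightarrow> nat \<Rightarrow> nat list \<Rightarrow> qstate \<Rightarrow> qstate" where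
  "pauli_enc m e0 e1 n ps \<phi> =
     foldr (\<lambda>j. apply_block m j (lop e0 e1 (pauli (ps ! j)))) [0..<n] (enc m e0 e1 n \<phi>)"

text \<open>Finite-round LOCC protocol on qubits each held by a separate party:
at each step one party (qubit k) applies a local instrument given by Kraus
operators Ks; the continuation may depend on the outcome (classical
communication). Leaves carry a classical output string.\<close>

datatype proto = Done "bool list" | Meas nat "qop1 list" "nat \<Rightarrow> proto"

definition kraus :: "qop1 list \<Rightarrow> bool" where
  "kraus Ks \<longleftrightarrow> (\<forall>a b. (\<Sum>i<length Ks. \<Sum>c\<in>UNIV. cnj ((Ks ! i) c a) * (Ks ! i) c b)
                     = (if a = b then 1 else 0))"

primrec wf_proto :: "nat \<Rightarrow> proto \<Rightarrow> bool" where
  "wf_proto M (Done l) = True"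
| "wf_proto M (Meas k Ks f) = (k < M \<and> kraus Ks \<and> (\<forall>i < length Ks. wf_proto M (f i)))"

text \<open>All branches: (unnormalised post-measurement state, classical output);
the probability of a branch is the squared norm of its vector.\<close>
primrec run :: "proto \<Rightarrow> qstate \<Rightarrow> (qstate \<times> bool list) list" where
  "run (Done l) \<psi> = [(\<psi>, l)]"
| "run (Meas k Ks f) \<psi> = concat (map (\<lambda>i. run (f i) (apply1 k (Ks ! i) \<psi>)) [0..<length Ks])"

definition rest_bits :: "nat \<Rightarrow> nat \<Rightarrow> nat list \<Rightarrow> bool list \<Rightarrow> bool list" where
  "rest_bits m M ks x = map (\<lambda>p. x ! p) (filter (\<lambda>p. p div m \<notin> set ks) [0..<M])"

definition leaves_blocks :: "nat \<Rightarrow> nat \<Rightarrow> nat list \<Rightarrow> qstate \<Rightarrow> qstate \<Rightarrow> bool" where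
  "leaves_blocks m M ks T v \<longleftrightarrow>
     (\<exists>\<chi>. \<forall>x\<in>bl M. v x = T (concat (map (\<lambda>k. blk m k x) ks)) * \<chi> (rest_bits m M ks x))"

definition encoded_universal :: "nat \<Rightarrow> qstate \<Rightarrow> qstate \<Rightarrow> bool" where
  "encoded_universal m e0 e1 \<longleftrightarrow>
    (\<forall>n. \<forall>\<phi>. nsq n \<phi> = 1 \<longrightarrow>
      (\<exists>d \<ge> 1. \<exists>ks. length ks = n \<and> distinct ks \<and> set ks \<subseteq> {..<d * d} \<and>
        (\<forall>\<psi>. is_cluster d \<psi> \<longrightarrow>
          (\<exists>p. wf_proto (m * (d * d)) p \<and>
             (\<forall>(v, l) \<in> set (run p (enc m e0 e1 (d * d) \<psi>)).
                \<exists>ps. length ps = n \<and> set ps \<subseteq> {0, 1, 2, 3} \<and>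
                  leaves_blocks m (m * (d * d)) ks (pauli_enc m e0 e1 n ps \<phi>) v)))))"

text \<open>Probability of outcome string b when measuring qubit k of U|0...0> in the
orthonormal basis given by the columns of the unitary Ws ! k.\<close>
definition target_prob :: "nat \<Rightarrow> (bool list \<Rightarrow> bool list \<Rightarrow> complex) \<Rightarrow> qop1 list \<Rightarrow> bool list \<Rightarrow> real" where
  "target_prob n U Ws b =
     (cmod (\<Sum>x\<in>bl n. (\<Prod>k<n. cnj ((Ws ! k) (x ! k) (b ! k))) * U x (replicate n False)))^2"

definition unitary_n :: "nat \<Rightarrow> (bool list \<Rightarrow> bool list \<Rightarrow> complex) \<Rightarrow> bool" where
  "unitary_n n U \<longleftrightarrow> (\<forall>a\<in>bl n. \<forall>b\<in>bl n.
      (\<Sum>c\<in>bl n. cnj (U c a) * U c b) = (if a = b then 1 else 0))"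

definition output_prob :: "proto \<Rightarrow> qstate \<Rightarrow> nat \<Rightarrow> bool list \<Rightarrow> real" where
  "output_prob p \<psi> M b = sum_list (map (\<lambda>(v, l). if l = b then nsq M v else 0) (run p \<psi>))"

definition cc_universal :: "nat \<Rightarrow> qstate \<Rightarrow> qstate \<Rightarrow> bool" where
  "cc_universal m e0 e1 \<longleftrightarrow>
    (\<forall>n U Ws. unitary_n n U \<and> length Ws = n \<and> (\<forall>W\<in>set Ws. unitary1 W) \<longrightarrow>
      (\<exists>d \<ge> 1. \<forall>\<psi>. is_cluster d \<psi> \<longrightarrow>
         (\<exists>p. wf_proto (m * (d * d)) p \<and>
            (\<forall>b\<in>bl n. output_prob p (enc m e0 e1 (d * d) \<psi>) (m * (d * d)) b
                        = target_prob n U Ws b))))"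

end

theory Submission
  imports Defs
begin

text \<open>A logical single-qubit measurement in an arbitrary basis can be carried out by measuring the
physical qubits of the block one after the other, because two orthogonal multi-qubit states can be
kept orthogonal throughout (Walgate et al.). It therefore suffices to find adaptive single-qubit
measurements on the bare cluster state.

On the grid, \<open>n\<close> columns serve as wires and all further columns are removed by \<open>Z\<close> measurements.
Measuring one row in the equatorial plane applies \<open>G(\<alpha>) = H D(\<alpha>) V\<close> to the wires, where \<open>V\<close> is
the product of the controlled phases of neighbouring wires, \<open>D(\<alpha>)\<close> rotates each wire about the
\<open>Z\<close> axis and \<open>H\<close> is a Hadamard gate on every wire; the Pauli byproducts are absorbed by adapting
the signs of the angles of the next row. The Clifford map \<open>C = G(0)\<close> permutes the finite Pauli group up to
conjugation, so a power of it is scalar and \<open>C\<close> can be undone. Hence the orbit of \<open>1\<close> is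
invariant under the rotations generated by \<open>Z\<^sub>k\<close>, by its conjugates \<open>X\<^sub>k\<close> and
\<open>X\<^bsub>k-1\<^esub>Z\<^sub>kX\<^bsub>k+1\<^esub>\<close>, and by all products of anticommuting generators, which are all Pauli
operators. Diagonal phases and rotations of one wire controlled by the others then take any state
to a basis state.

For classical output the remaining blocks are measured in bases that undo the Pauli byproducts;
every branch reproduces the target distribution up to a factor, and normalisation fixes the factor.\<close>


section \<open>Adaptive measurements\<close>

text \<open>Exactness rules out approximating gate sets: it comes from freely chosen angles together
  with the finite order of \<open>C\<close>, which turns inversion into repetition.

  Physical qubits are measured strictly in their numerical order. This is why the wires are the last
  \<open>n\<close> columns, why the output sits at the end of the last row, and why the angles of a
  row depend only on the outcomes of earlier rows. As the grid is square, surplus rows must be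
  consumed without effect; measuring a whole row in the \<open>Z\<close> basis restarts the wires.

  The controlled phases inside the output row are never followed by a measurement of the wires. They
  are therefore built into the target: the rows prepare the state that these phases turn into
  \<open>\<phi>\<close>.

  Vectors stay unnormalised and scalars, zero included, are carried along, so impossible branches
  need no separate treatment. One predicate, \<open>strat\<close>, serves both claims: state
  preparation uses leaves of weight zero, classical output uses leaves whose weight is the branch
  probability.\<close>

lemma finite_bl [simp]: "finite (bl n)"
proof -
  have "bl n = {xs. set xs \<subseteq> UNIV \<and> length xs = n}" by (auto simp: bl_def)
  then show ?thesis using finite_lists_length_eq[of "UNIV :: bool set" n] by simp
qed

lemma bl_0 [simp]: "bl 0 = {[]}"
  by (auto simp: bl_def)

lemma length_bl: "x \<in> bl n \<Longrightarrow> length x = n"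
  by (simp add: bl_def)

lemma Cons_in_bl [simp]: "b # x \<in> bl (Suc n) \<longleftrightarrow> x \<in> bl n"
  by (simp add: bl_def)

lemma list_update_in_bl [simp]: "x[k := b] \<in> bl n \<longleftrightarrow> x \<in> bl n"
  by (simp add: bl_def)

lemma sum_bl_add:
  "(\<Sum>x\<in>bl (m + n). f x) = (\<Sum>x\<in>bl m. \<Sum>y\<in>bl n. f (x @ y))"
proof -
  have "bij_betw (\<lambda>(x, y). x @ y) (bl m \<times> bl n) (bl (m + n))"
    by (rule bij_betw_byWitness[where f' = "\<lambda>z. (take m z, drop m z)"]) (auto simp: bl_def)
  then have "(\<Sum>x\<in>bl (m + n). f x) = (\<Sum>(x, y)\<in>bl m \<times> bl n. f (x @ y))"
    by (subst sum.reindex_bij_betw[symmetric]) (auto simp: case_prod_unfold)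
  then show ?thesis by (simp add: sum.cartesian_product)
qed

lemma sum_bl_1: "(\<Sum>x\<in>bl (Suc 0). f x) = (\<Sum>b\<in>UNIV. f [b])"
proof -
  have "bl (Suc 0) = {[False], [True]}"
    by (auto simp: bl_def length_Suc_conv)
  then show ?thesis by (simp add: UNIV_bool)
qed

lemma sum_bl_Suc:
  "(\<Sum>x\<in>bl (Suc n). f x) = (\<Sum>b\<in>UNIV. \<Sum>y\<in>bl n. f (b # y))"
  using sum_bl_add[of f 1 n] by (simp add: sum_bl_1)

lemma inner_st_Suc:
  "inner_st (Suc n) u v = (\<Sum>b\<in>UNIV. inner_st n (\<lambda>r. u (b # r)) (\<lambda>r. v (b # r)))"
  by (simp add: inner_st_def sum_bl_Suc)

lemma of_real_nsq: "complex_of_real (nsq n u) = inner_st n u u"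
  by (simp add: nsq_def inner_st_def mult.commute[of "cnj _"] flip: complex_norm_square)

lemma inner_st_sum_left:
  "inner_st n (\<lambda>x. \<Sum>i\<in>I. c i * u i x) v = (\<Sum>i\<in>I. cnj (c i) * inner_st n (u i) v)"
  unfolding inner_st_def
  by (simp add: sum_distrib_left sum_distrib_right mult_ac sum.swap[of _ I])

lemma inner_st_sum_right:
  "inner_st n u (\<lambda>x. \<Sum>i\<in>I. c i * v i x) = (\<Sum>i\<in>I. c i * inner_st n u (v i))"
  unfolding inner_st_def
  by (simp add: sum_distrib_left sum_distrib_right mult_ac sum.swap[of _ I])

section \<open>Measurement bases of one qubit and conditional states\<close>

definition onb :: "qop1 \<Rightarrow> bool" where
  "onb W \<longleftrightarrow> (\<forall>a b. (\<Sum>s\<in>UNIV. W a s * cnj (W b s)) = (if a = b then 1 else 0))"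

lemma orthonormal_columns_imp_rows:
  fixes a b c d :: complex
  assumes 1: "cnj a * a + cnj c * c = 1" and 2: "cnj b * b + cnj d * d = 1"
    and 3: "cnj a * b + cnj c * d = 0"
  shows "a * cnj a + b * cnj b = 1" "c * cnj c + d * cnj d = 1" "a * cnj c + b * cnj d = 0"
proof -
  \<comment> \<open>\<open>l\<close> is the determinant: the second column is the complement
    \<open>(- cnj c, cnj a)\<close> of the first one times \<open>l\<close>, and normalisation makes
    \<open>l\<close> a phase.\<close>
  define l where "l = a * d - c * b"
  have x3: "cnj b * a + cnj d * c = 0"
    using arg_cong[OF 3, of cnj] by (simp add: mult.commute)
  have b: "b = - l * cnj c" and d: "d = l * cnj a"
    unfolding l_def using 1 3 by algebra+
  have "cnj l * l = 1" using 1 2 by (simp add: b d) algebra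
  then show "a * cnj a + b * cnj b = 1" "c * cnj c + d * cnj d = 1" "a * cnj c + b * cnj d = 0"
    using 1 by (simp_all add: b d) algebra+
qed

lemma onb_iff_unitary1: "onb W \<longleftrightarrow> unitary1 W"
proof
  assume *: "unitary1 W"
  have c: "cnj (W False s) * W False t + cnj (W True s) * W True t = (if s = t then 1 else 0)" for s t
    using * unfolding unitary1_def UNIV_bool by (simp add: add.commute)
  have "W False False * cnj (W False False) + W False True * cnj (W False True) = 1"
    "W True False * cnj (W True False) + W True True * cnj (W True True) = 1"
    "W False False * cnj (W True False) + W False True * cnj (W True True) = 0"
    using orthonormal_columns_imp_rows[of "W False False" "W True False" "W False True" "W True True"]
      c[of False False] c[of True True] c[of False True] by simp_all
  moreover from this(3) have "W True False * cnj (W False False) + W True True * cnj (W False True) = 0"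
    by (metis (no_types, lifting) complex_cnj_add complex_cnj_cnj complex_cnj_mult complex_cnj_zero mult.commute)
  ultimately show "onb W"
    unfolding onb_def all_bool_eq UNIV_bool by (simp add: add.commute)
next
  assume *: "onb W"
  have c: "W s False * cnj (W t False) + W s True * cnj (W t True) = (if s = t then 1 else 0)" for s t
    using * unfolding onb_def UNIV_bool by (simp add: add.commute)
  have "cnj (W False False) * W False False + cnj (W True False) * W True False = 1"
    "cnj (W False True) * W False True + cnj (W True True) * W True True = 1"
    "cnj (W False False) * W False True + cnj (W True False) * W True True = 0"
    using orthonormal_columns_imp_rows[of "cnj (W False False)" "cnj (W False True)" "cnj (W True False)" "cnj (W True True)"]
      c[of False False] c[of True True] c[of False True] by simp_all
  moreover from this(3) have "cnj (W False True) * W False False + cnj (W True True) * W True False = 0"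
    by (metis (no_types, lifting) complex_cnj_add complex_cnj_cnj complex_cnj_mult complex_cnj_zero mult.commute)
  ultimately show "unitary1 W"
    unfolding unitary1_def all_bool_eq UNIV_bool by (simp add: add.commute)
qed

text \<open>Outcome \<open>s\<close> projects the first qubit onto column \<open>s\<close> of
  \<open>W\<close>. There is no renormalisation, so the squared norm carries the probability of the
  branch.\<close>

definition bra :: "qop1 \<Rightarrow> bool \<Rightarrow> qstate \<Rightarrow> qstate" where
  "bra W s u r = (\<Sum>b\<in>UNIV. cnj (W b s) * u (b # r))"

lemma bra_resolution:
  assumes "onb W"
  shows "(\<Sum>s\<in>UNIV. W a s * bra W s u r) = u (a # r)"
proof -
  have "(\<Sum>s\<in>UNIV. W a s * bra W s u r) = (\<Sum>b\<in>UNIV. (\<Sum>s\<in>UNIV. W a s * cnj (W b s)) * u (b # r))"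
    by (simp add: bra_def UNIV_bool algebra_simps)
  also have "\<dots> = (\<Sum>b\<in>UNIV. (if a = b then u (b # r) else 0))"
    using assms by (intro sum.cong) (auto simp: onb_def)
  finally show ?thesis by simp
qed

lemma inner_st_bra:
  "inner_st n (bra W s u) (bra W s v) =
    (\<Sum>b\<in>UNIV. \<Sum>c\<in>UNIV. W b s * cnj (W c s) * inner_st n (\<lambda>r. u (b # r)) (\<lambda>r. v (c # r)))"
  unfolding bra_def[abs_def] inner_st_sum_left inner_st_sum_right
  by (simp add: sum_distrib_left mult_ac)

lemma sum_inner_st_bra:
  assumes "onb W"
  shows "(\<Sum>s\<in>UNIV. inner_st n (bra W s u) (bra W s v)) = inner_st (Suc n) u v"
proof -
  have "(\<Sum>s\<in>UNIV. inner_st n (bra W s u) (bra W s v)) =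
    (\<Sum>b\<in>UNIV. \<Sum>c\<in>UNIV. (\<Sum>s\<in>UNIV. W b s * cnj (W c s)) * inner_st n (\<lambda>r. u (b # r)) (\<lambda>r. v (c # r)))"
    unfolding inner_st_bra UNIV_bool by (simp add: algebra_simps)
  also have "\<dots> = inner_st (Suc n) u v"
    using assms unfolding onb_def inner_st_Suc by (simp add: if_distrib[of "\<lambda>t. t * _"] cong: if_cong)
  finally show ?thesis .
qed

lemma sum_nsq_bra:
  assumes "onb W"
  shows "nsq n (bra W False u) + nsq n (bra W True u) = nsq (Suc n) u"
proof -
  have "complex_of_real (nsq n (bra W False u) + nsq n (bra W True u)) = of_real (nsq (Suc n) u)"
    using sum_inner_st_bra[OF assms, of n u u] by (simp add: of_real_nsq UNIV_bool add.commute)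
  then show ?thesis by (simp only: of_real_eq_iff)
qed

lemma ex_cos_sin_zero: "\<exists>t. a * cos t + b * sin t = (0::real)"
proof (cases "b = 0")
  case True
  then show ?thesis by (intro exI[of _ "pi/2"]) simp
next
  case False
  have "cos (arctan (- a / b)) \<noteq> 0" by simp
  then have "sin (arctan (- a / b)) = (- a / b) * cos (arctan (- a / b))"
    using tan_arctan[of "- a / b"] by (simp add: tan_def field_simps)
  then show ?thesis using False by (intro exI[of _ "arctan (- a / b)"]) simp
qed

text \<open>The numerical range of a traceless matrix contains zero. The first basis vector is
  sought as \<open>(cos th, cis t * sin th)\<close>; the sum is then \<open>p * cos (2 * th)\<close>
  plus \<open>cos th * sin th * z\<close>.\<close>

lemma ex_onb_zero_diagonal:
  fixes M :: "bool \<Rightarrow> bool \<Rightarrow> complex"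
  assumes tr: "M False False + M True True = 0"
  shows "\<exists>W. onb W \<and> (\<Sum>b\<in>UNIV. \<Sum>c\<in>UNIV. W b False * cnj (W c False) * M b c) = 0"
proof -
  define p q r where "p = M False False" and "q = M False True" and "r = M True False"
  have M11: "M True True = - p" using tr by (simp add: p_def add_eq_0_iff)
  \<comment> \<open>This \<open>t\<close> makes \<open>cnj p * z\<close> real, so that the complex
    condition becomes a single real equation for \<open>t2 = 2 * th\<close>.\<close>
  obtain t where t: "Im (cnj p * (q + r)) * cos t + Re (cnj p * (r - q)) * sin t = 0"
    using ex_cos_sin_zero by blast
  define z where "z = q * cis (- t) + r * cis t"
  have "Im (cnj p * z) = 0"
    using t by (simp add: z_def algebra_simps)
  then obtain h where h: "cnj p * z = complex_of_real h"
    by (metis complex_is_Real_iff Reals_cases)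
  obtain t2 where t2: "(cmod p)\<^sup>2 * cos t2 + (h / 2) * sin t2 = 0" 
    using ex_cos_sin_zero by blast
  define th where "th = t2 / 2"
  show ?thesis
  proof (cases "p = 0")
    case True
    have "onb sig_id" by (auto simp: onb_def sig_id_def UNIV_bool)
    moreover have "(\<Sum>b\<in>UNIV. \<Sum>c\<in>UNIV. sig_id b False * cnj (sig_id c False) * M b c) = 0"
      using True by (simp add: UNIV_bool sig_id_def p_def)
    ultimately show ?thesis by blast
  next
    case False
    define W :: qop1 where "W = (\<lambda>b s. if s then (if b then cis t * cos th else - sin th)
        else (if b then cis t * sin th else cos th))"
    have cc: "cos th * cos th + sin th * sin th = 1"
      using sin_cos_squared_add[of th] by (simp add: power2_eq_square add.commute)
    have ccC: "complex_of_real (cos th) * complex_of_real (cos th) + complex_of_real (sin th) * complex_of_real (sin th) = 1"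
      using cc by (metis of_real_1 of_real_add of_real_mult)
    have cs: "cis t * cis (- t) = 1" by (simp add: cis_mult)
    have "onb W"
      unfolding onb_def all_bool_eq UNIV_bool W_def
      using ccC cs by (simp add: cis_cnj add_ac mult_ac) algebra
    have dd: "cos th * cos th - sin th * sin th = cos t2" "2 * (cos th * sin th) = sin t2"
      using cos_double[of th] sin_double[of th] by (simp_all add: th_def power2_eq_square)
    have "cnj p * (\<Sum>b\<in>UNIV. \<Sum>c\<in>UNIV. W b False * cnj (W c False) * M b c)
        = cnj p * p * of_real (cos th * cos th - sin th * sin th) + of_real (cos th * sin th) * (cnj p * z)"
      unfolding UNIV_bool W_def z_def
      using cs by (simp add: M11 cis_cnj p_def[symmetric] q_def[symmetric] r_def[symmetric]) algebra
    also have "\<dots> = of_real ((cmod p)\<^sup>2 * cos t2 + (h / 2) * sin t2)"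
      unfolding h dd(1)
      using complex_norm_square[of p] by (simp add: mult_ac flip: dd(2))
    also have "\<dots> = 0" using t2 by simp
    finally have "(\<Sum>b\<in>UNIV. \<Sum>c\<in>UNIV. W b False * cnj (W c False) * M b c) = 0"
      using False by simp
    with \<open>onb W\<close> show ?thesis by blast
  qed
qed

text \<open>The first \<open>j\<close> qubits are measured one after the other, each in a basis that may depend on the
earlier outcomes, and \<open>f\<close> adds up over all branches the weights of the classical outputs.\<close>

primrec strat :: "(qstate \<Rightarrow> (bool list \<Rightarrow> real) \<Rightarrow> bool) \<Rightarrow> nat \<Rightarrow> qstate \<Rightarrow> (bool list \<Rightarrow> real) \<Rightarrow> bool" where
  "strat P 0 u f = P u f"
| "strat P (Suc j) u f = (\<exists>W f0 f1. onb W \<and> strat P j (bra W False u) f0 \<and>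
     strat P j (bra W True u) f1 \<and> f = (\<lambda>b. f0 b + f1 b))"

text \<open>Leaves must tolerate rescaling, because a measured block leaves behind a multiple of a
  conditional state. The factor zero covers branches that never occur.\<close>

definition homog :: "nat \<Rightarrow> (qstate \<Rightarrow> (bool list \<Rightarrow> real) \<Rightarrow> bool) \<Rightarrow> bool" where
  "homog n P \<longleftrightarrow> (\<forall>u u' c f. P u f \<longrightarrow> (\<forall>x\<in>bl n. u' x = c * u x) \<longrightarrow> P u' (\<lambda>b. (cmod c)\<^sup>2 * f b))"

lemma homogD: "homog n P \<Longrightarrow> P u f \<Longrightarrow> (\<And>x. x \<in> bl n \<Longrightarrow> u' x = c * u x) \<Longrightarrow> P u' (\<lambda>b. (cmod c)\<^sup>2 * f b)"
  unfolding homog_def by blast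

lemma homog_strat:
  assumes "homog n P" shows "homog (j + n) (strat P j)"
  unfolding homog_def
proof (intro allI impI)
  fix u u' c f
  assume "strat P j u f" "\<forall>x\<in>bl (j + n). u' x = c * u x"
  then show "strat P j u' (\<lambda>b. (cmod c)\<^sup>2 * f b)"
  proof (induction j arbitrary: u u' f)
    case 0
    then show ?case using homogD[OF assms] by simp
  next
    case (Suc j)
    then obtain W f0 f1 where W: "onb W" "strat P j (bra W False u) f0" "strat P j (bra W True u) f1"
      and f: "f = (\<lambda>b. f0 b + f1 b)" by auto
    have "\<forall>x\<in>bl (j + n). bra W s u' x = c * bra W s u x" for s
      using Suc.prems(2) by (simp add: bra_def sum_distrib_left mult_ac)
    then have "strat P j (bra W False u') (\<lambda>b. (cmod c)\<^sup>2 * f0 b)"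
      "strat P j (bra W True u') (\<lambda>b. (cmod c)\<^sup>2 * f1 b)"
      using W by (blast intro: Suc.IH)+
    moreover have "(\<lambda>b. (cmod c)\<^sup>2 * f b) = (\<lambda>b. (cmod c)\<^sup>2 * f0 b + (cmod c)\<^sup>2 * f1 b)"
      by (simp add: f algebra_simps)
    ultimately show ?case using W(1) unfolding strat.simps by blast
  qed
qed

lemma strat_add: "strat P (i + j) u f \<longleftrightarrow> strat (strat P j) i u f"
  by (induction i arbitrary: u f) auto

lemma strat_mono:
  assumes "strat P j u f" "\<And>u f. P u f \<Longrightarrow> Q u f" shows "strat Q j u f"
  using assms(1) by (induction j arbitrary: u f) (auto intro: assms(2), blast)

text \<open>Walgate's argument: two orthogonal multi-qubit states can be told apart by measuring the
qubits one after the other, because each qubit has a basis that keeps the two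
conditional states orthogonal for both outcomes.\<close>

lemma strat_orthogonal:
  assumes hom: "homog n P" and A: "P A f" and B: "P B g"
    and orth: "inner_st m a b = 0"
    and u: "\<And>z y. z \<in> bl m \<Longrightarrow> y \<in> bl n \<Longrightarrow> u (z @ y) = a z * A y + b z * B y"
  shows "strat P m u (\<lambda>l. nsq m a * f l + nsq m b * g l)"
  using orth u
proof (induction m arbitrary: a b u)
  case 0
  \<comment> \<open>With no qubit left, orthogonality means that one coefficient vanishes: the rest
    is a multiple of \<open>A\<close> or of \<open>B\<close>, and homogeneity finishes.\<close>
  then have ab: "a [] = 0 \<or> b [] = 0" by (simp add: inner_st_def)
  have u: "\<And>y. y \<in> bl n \<Longrightarrow> u y = a [] * A y + b [] * B y" using 0(2)[of "[]"] by simp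
  show ?case
  proof (cases "a [] = 0")
    case True
    then show ?thesis using homogD[OF hom B, of u "b []"] u by (simp add: nsq_def)
  next
    case False
    then show ?thesis using ab homogD[OF hom A, of u "a []"] u by (simp add: nsq_def)
  qed
next
  case (Suc m)
  define M where "M = (\<lambda>c d. inner_st m (\<lambda>r. a (c # r)) (\<lambda>r. b (d # r)))"
  have "M False False + M True True = 0"
    using Suc.prems(1) by (simp add: M_def inner_st_Suc UNIV_bool add.commute)
  from ex_onb_zero_diagonal[of M, OF this]
  obtain W where W: "onb W" and F: "inner_st m (bra W False a) (bra W False b) = 0"
    unfolding inner_st_bra M_def by auto
  \<comment> \<open>The overlaps of the two outcomes add up to the overlap before the measurement,
    which is zero; so the second outcome keeps orthogonality as well.\<close>
  have T: "inner_st m (bra W True a) (bra W True b) = 0"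
    using sum_inner_st_bra[OF W, of m a b] Suc.prems(1) F by (simp add: UNIV_bool)
  have eq: "bra W s u (z @ y) = bra W s a z * A y + bra W s b z * B y"
    if "z \<in> bl m" "y \<in> bl n" for s z y
    using Suc.prems(2)[of "_ # z" y] that
    by (simp add: bra_def UNIV_bool algebra_simps)
  have "strat P m (bra W s u) (\<lambda>l. nsq m (bra W s a) * f l + nsq m (bra W s b) * g l)" for s
    using F T eq by (cases s) (auto intro!: Suc.IH)
  then show ?case
    using W by (auto intro!: exI[of _ W] exI simp: sum_nsq_bra[OF W, symmetric] algebra_simps)
qed

section \<open>Measurements on encoded qubits\<close>

lemma enc_append:
  assumes "z \<in> bl m"
  shows "enc m e0 e1 (Suc N) w (z @ y) = (\<Sum>b\<in>UNIV. ebit e0 e1 b z * enc m e0 e1 N (\<lambda>r. w (b # r)) y)"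
proof -
  have "blk m (Suc k) (z @ y) = blk m k y" "blk m 0 (z @ y) = z" for k
    using length_bl[OF assms] by (simp_all add: blk_def)
  then show ?thesis
    by (simp add: enc_def sum_bl_Suc prod.lessThan_Suc_shift sum_distrib_left mult_ac del: prod.lessThan_Suc)
qed

lemma enc_sum: "enc m e0 e1 N (\<lambda>x. \<Sum>i\<in>I. c i * w i x) y = (\<Sum>i\<in>I. c i * enc m e0 e1 N (w i) y)"
  unfolding enc_def by (simp add: sum_distrib_left sum_distrib_right mult_ac sum.swap[of _ I])

lemma enc_scale:
  assumes "\<And>x. x \<in> bl N \<Longrightarrow> w' x = c * w x"
  shows "enc m e0 e1 N w' y = c * enc m e0 e1 N w y"
  unfolding enc_def by (simp add: assms sum_distrib_left mult_ac)

lemma inner_st_ebit: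
  assumes "encoding m e0 e1"
  shows "inner_st m (ebit e0 e1 a) (ebit e0 e1 b) = (if a = b then 1 else 0)"
proof -
  have "inner_st m e1 e0 = cnj (inner_st m e0 e1)"
    by (simp add: inner_st_def mult.commute)
  then show ?thesis
    using assms of_real_nsq[of m e0] of_real_nsq[of m e1] by (auto simp: encoding_def ebit_def)
qed

lemma inner_st_enc_basis:
  assumes "encoding m e0 e1" "onb W"
  shows "inner_st m (\<lambda>z. \<Sum>b\<in>UNIV. W b s * ebit e0 e1 b z) (\<lambda>z. \<Sum>b\<in>UNIV. W b t * ebit e0 e1 b z)
    = (if s = t then 1 else 0)"
  using assms(2) unfolding onb_iff_unitary1 inner_st_sum_left inner_st_sum_right inner_st_ebit[OF assms(1)]
  by (simp add: unitary1_def if_distrib[of "\<lambda>t. _ * t"] cong: if_cong)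

text \<open>Lifts a leaf on \<open>n\<close> logical qubits to the \<open>n\<close> blocks that are
  still unmeasured.\<close>

definition enc_leaf :: "nat \<Rightarrow> qstate \<Rightarrow> qstate \<Rightarrow> nat \<Rightarrow> (qstate \<Rightarrow> (bool list \<Rightarrow> real) \<Rightarrow> bool) \<Rightarrow> qstate \<Rightarrow> (bool list \<Rightarrow> real) \<Rightarrow> bool" where
  "enc_leaf m e0 e1 n P u f \<longleftrightarrow> (\<exists>w. (\<forall>y\<in>bl (m * n). u y = enc m e0 e1 n w y) \<and> P w f)"

lemma homog_enc_leaf:
  assumes "homog n P" shows "homog (m * n) (enc_leaf m e0 e1 n P)"
  unfolding homog_def
proof (intro allI impI)
  fix u u' c f
  assume "enc_leaf m e0 e1 n P u f" "\<forall>x\<in>bl (m * n). u' x = c * u x"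
  then obtain w where "\<forall>y\<in>bl (m * n). u' y = c * enc m e0 e1 n w y" "P w f"
    by (auto simp: enc_leaf_def)
  then show "enc_leaf m e0 e1 n P u' (\<lambda>b. (cmod c)\<^sup>2 * f b)"
    unfolding enc_leaf_def using homogD[OF assms \<open>P w f\<close>, of "\<lambda>x. c * w x" c]
    by (intro exI[of _ "\<lambda>x. c * w x"]) (simp add: enc_scale[of n "\<lambda>x. c * w x" c w])
qed

text \<open>A logical measurement in the basis \<open>W\<close> amounts to distinguishing the code
  states \<open>a False\<close> and \<open>a True\<close>, which are orthogonal since the encoding
  preserves inner products. They have norm one, so the weights of the two outcomes enter without a
  factor.\<close>

lemma strat_enc:
  assumes e: "encoding m e0 e1" and P: "homog n P" and s: "strat P j w f"
    and u: "\<And>y. y \<in> bl (m * (j + n)) \<Longrightarrow> u y = enc m e0 e1 (j + n) w y"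
  shows "strat (enc_leaf m e0 e1 n P) (m * j) u f"
  using s u
proof (induction j arbitrary: w u f)
  case 0
  then show ?case by (auto simp: enc_leaf_def)
next
  case (Suc j)
  let ?P = "enc_leaf m e0 e1 n P"
  from Suc.prems obtain W f0 f1 where W: "onb W" "strat P j (bra W False w) f0"
    "strat P j (bra W True w) f1" and f: "f = (\<lambda>b. f0 b + f1 b)" by auto
  define a where "a s = (\<lambda>z. \<Sum>b\<in>UNIV. W b s * ebit e0 e1 b z)" for s
  have a: "inner_st m (a s) (a t) = (if s = t then 1 else 0)" for s t
    unfolding a_def by (rule inner_st_enc_basis[OF e W(1)])
  have na: "nsq m (a s) = 1" for s
    using of_real_nsq[of m "a s"] a[of s s] by simp
  have "u (z @ y) = a False z * enc m e0 e1 (j + n) (bra W False w) y +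
      a True z * enc m e0 e1 (j + n) (bra W True w) y"
    if z: "z \<in> bl m" and y: "y \<in> bl (m * j + m * n)" for z y
  proof -
    have "z @ y \<in> bl (m * (Suc j + n))" using that by (simp add: bl_def algebra_simps)
    then have "u (z @ y) = (\<Sum>b\<in>UNIV. ebit e0 e1 b z * enc m e0 e1 (j + n) (\<lambda>r. w (b # r)) y)"
      using Suc.prems(2) enc_append[OF z] by simp
    also have "\<dots> = (\<Sum>b\<in>UNIV. ebit e0 e1 b z * (\<Sum>s\<in>UNIV. W b s * enc m e0 e1 (j + n) (bra W s w) y))"
      by (simp only: bra_resolution[OF W(1), symmetric] enc_sum)
    also have "\<dots> = a False z * enc m e0 e1 (j + n) (bra W False w) y +
      a True z * enc m e0 e1 (j + n) (bra W True w) y"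
      by (simp add: a_def UNIV_bool algebra_simps)
    finally show ?thesis .
  qed
  moreover have "strat ?P (m * j) (enc m e0 e1 (j + n) (bra W False w)) f0"
    "strat ?P (m * j) (enc m e0 e1 (j + n) (bra W True w)) f1"
    using Suc.IH W by auto
  moreover have "homog (m * j + m * n) (strat ?P (m * j))"
    by (intro homog_strat homog_enc_leaf P)
  ultimately have "strat (strat ?P (m * j)) m u (\<lambda>l. nsq m (a False) * f0 l + nsq m (a True) * f1 l)"
    by (intro strat_orthogonal) (auto simp: a)
  then show ?case by (simp add: na f strat_add)
qed


section \<open>Pauli operators\<close>

definition sg :: "bool \<Rightarrow> complex" where
  "sg b = (if b then -1 else 1)"

lemma sg_simps [simp]: "sg False = 1" "sg True = -1" "sg b * sg b = 1" "cnj (sg b) = sg b"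
  "cmod (sg b) = 1" "sg b \<noteq> 0"
  by (auto simp: sg_def)

definition dot :: "nat \<Rightarrow> (nat \<Rightarrow> bool) \<Rightarrow> (nat \<Rightarrow> bool) \<Rightarrow> complex" where
  "dot n f g = (\<Prod>k<n. sg (f k \<and> g k))"

definition xor_bits :: "nat \<Rightarrow> (nat \<Rightarrow> bool) \<Rightarrow> bool list \<Rightarrow> bool list" where
  "xor_bits n a x = map (\<lambda>k. x ! k \<noteq> a k) [0..<n]"

text \<open>The Pauli operator \<open>Z\<^sup>bX\<^sup>a\<close>.\<close>

definition pauli_op :: "nat \<Rightarrow> (nat \<Rightarrow> bool) \<Rightarrow> (nat \<Rightarrow> bool) \<Rightarrow> qstate \<Rightarrow> qstate" where
  "pauli_op n a b \<chi> x = dot n b ((!) x) * \<chi> (xor_bits n a x)"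

lemma dot_cong:
  "(\<And>k. k < n \<Longrightarrow> f k = f' k) \<Longrightarrow> (\<And>k. k < n \<Longrightarrow> g k = g' k) \<Longrightarrow> dot n f g = dot n f' g'"
  unfolding dot_def by (intro prod.cong) auto

lemma xor_bits_cong: "(\<And>k. k < n \<Longrightarrow> a k = a' k) \<Longrightarrow> xor_bits n a x = xor_bits n a' x"
  by (simp add: xor_bits_def)

lemma dot_commute: "dot n f g = dot n g f"
  by (simp add: dot_def conj_commute)

lemma dot_square [simp]: "dot n f g * dot n f g = 1"
  by (simp add: dot_def flip: prod.distrib)

lemma dot_nonzero [simp]: "dot n f g \<noteq> 0"
  by (simp add: dot_def)

lemma norm_dot [simp]: "cmod (dot n f g) = 1"
  by (simp add: dot_def flip: prod_norm)

lemma dot_cases: "dot n f g = 1 \<or> dot n f g = -1"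
  using dot_square[of n f g] by (metis square_eq_1_iff)

lemma cnj_dot [simp]: "cnj (dot n f g) = dot n f g"
  using dot_cases[of n f g] by auto

lemma dot_xor_left: "dot n (\<lambda>k. f k \<noteq> f' k) g = dot n f g * dot n f' g"
  unfolding dot_def prod.distrib[symmetric] by (intro prod.cong) (auto simp: sg_def)

lemma dot_xor_right: "dot n g (\<lambda>k. f k \<noteq> f' k) = dot n g f * dot n g f'"
  unfolding dot_def prod.distrib[symmetric] by (intro prod.cong) (auto simp: sg_def)

lemma dot_False [simp]: "dot n (\<lambda>_. False) g = 1" "dot n g (\<lambda>_. False) = 1"
  by (simp_all add: dot_def)

lemma xor_bits_in_bl [simp]: "xor_bits n a x \<in> bl n"
  by (simp add: xor_bits_def bl_def)

lemma nth_xor_bits [simp]: "k < n \<Longrightarrow> xor_bits n a x ! k = (x ! k \<noteq> a k)"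
  by (simp add: xor_bits_def)

lemma xor_bits_xor_bits [simp]: "xor_bits n a (xor_bits n a' x) = xor_bits n (\<lambda>k. a k \<noteq> a' k) x"
  by (auto simp: xor_bits_def)

lemma xor_bits_id: "x \<in> bl n \<Longrightarrow> (\<And>k. k < n \<Longrightarrow> \<not> a k) \<Longrightarrow> xor_bits n a x = x"
  by (auto simp: xor_bits_def bl_def intro: nth_equalityI)

lemma dot_xor_bits: "dot n b ((!) (xor_bits n a x)) = dot n b a * dot n b ((!) x)"
proof -
  have "dot n b ((!) (xor_bits n a x)) = dot n b (\<lambda>k. x ! k \<noteq> a k)"
    by (rule dot_cong) auto
  then show ?thesis by (simp only: dot_xor_right mult.commute)
qed

lemma sum_bl_xor_bits: "(\<Sum>x\<in>bl n. f (xor_bits n a x)) = (\<Sum>x\<in>bl n. f x)"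
proof -
  have "bij_betw (xor_bits n a) (bl n) (bl n)"
    by (rule bij_betw_byWitness[where f' = "xor_bits n a"]) (auto intro: xor_bits_id)
  then show ?thesis by (rule sum.reindex_bij_betw)
qed

lemma pauli_op_pauli_op:
  "pauli_op n a b (pauli_op n a' b' \<chi>) x = dot n b' a * pauli_op n (\<lambda>k. a k \<noteq> a' k) (\<lambda>k. b k \<noteq> b' k) \<chi> x"
proof -
  have "(\<lambda>k. a' k \<noteq> a k) = (\<lambda>k. a k \<noteq> a' k)" by auto
  then show ?thesis unfolding pauli_op_def dot_xor_bits dot_xor_left xor_bits_xor_bits by (simp only: mult_ac)
qed

lemma pauli_op_cong:
  assumes "\<And>k. k < n \<Longrightarrow> a k = a' k" "\<And>k. k < n \<Longrightarrow> b k = b' k" "\<And>x. x \<in> bl n \<Longrightarrow> \<chi> x = \<chi>' x"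
  shows "pauli_op n a b \<chi> x = pauli_op n a' b' \<chi>' x"
  using dot_cong[of n b b' "(!) x" "(!) x"] xor_bits_cong[of n a a' x] assms unfolding pauli_op_def by simp

lemma pauli_op_id: "x \<in> bl n \<Longrightarrow> (\<And>k. k < n \<Longrightarrow> \<not> a k) \<Longrightarrow> (\<And>k. k < n \<Longrightarrow> \<not> b k) \<Longrightarrow> pauli_op n a b \<chi> x = \<chi> x"
  using dot_cong[of n b "\<lambda>_. False" "(!) x" "(!) x"] by (simp add: pauli_op_def xor_bits_id)

text \<open>The weight is zero because state preparation has no classical output. The scalar
  \<open>c\<close> collects the branch amplitude and may vanish.\<close>

definition pauli_leaf :: "nat \<Rightarrow> qstate \<Rightarrow> qstate \<Rightarrow> (bool list \<Rightarrow> real) \<Rightarrow> bool" where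
  "pauli_leaf n \<phi> u f \<longleftrightarrow> f = (\<lambda>_. 0) \<and> (\<exists>c a b. \<forall>x\<in>bl n. u x = c * pauli_op n a b \<phi> x)"

lemma homog_pauli_leaf: "homog n (pauli_leaf n \<phi>)"
  unfolding homog_def pauli_leaf_def
proof (intro allI impI conjI, goal_cases)
  case (2 u u' c f)
  then obtain c' a b where "\<forall>x\<in>bl n. u' x = (c * c') * pauli_op n a b \<phi> x" by auto
  then show ?case by blast
qed auto

text \<open>The iterated \<open>bra\<close>: the conditional state of the later qubits after the
  outcomes \<open>s\<close> in the bases \<open>Ws\<close>.\<close>

definition amp :: "qop1 list \<Rightarrow> bool list \<Rightarrow> qstate \<Rightarrow> qstate" where
  "amp Ws s w y = (\<Sum>x\<in>bl (length Ws). (\<Prod>k<length Ws. cnj ((Ws ! k) (x ! k) (s ! k))) * w (x @ y))"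

lemma amp_Nil [simp]: "amp [] s w = w"
  by (rule ext) (simp add: amp_def)

lemma amp_Cons [simp]: "amp (W # Ws) (t # s) w = amp Ws s (bra W t w)"
  by (rule ext) (simp add: amp_def bra_def sum_bl_Suc prod.lessThan_Suc_shift UNIV_bool
    sum_distrib_left sum.distrib algebra_simps del: prod.lessThan_Suc)

text \<open>Bases that do not depend on each other's outcomes can be treated as one product
  measurement; a whole row of the grid is of this kind.\<close>

lemma strat_row:
  assumes "\<forall>W\<in>set Ws. onb W" "\<And>s. s \<in> bl (length Ws) \<Longrightarrow> P (amp Ws s w) (F s)"
  shows "strat P (length Ws) w (\<lambda>b. \<Sum>s\<in>bl (length Ws). F s b)"
  using assms
proof (induction Ws arbitrary: w F)
  case Nil
  then show ?case by simp
next
  case (Cons W Ws)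
  have "strat P (length Ws) (bra W t w) (\<lambda>b. \<Sum>s\<in>bl (length Ws). F (t # s) b)" for t
    using Cons.prems(1) Cons.prems(2)[of "t # _"] by (intro Cons.IH) auto
  moreover have "(\<lambda>b. \<Sum>s\<in>bl (length (W # Ws)). F s b) = 
    (\<lambda>b. (\<Sum>s\<in>bl (length Ws). F (False # s) b) + (\<Sum>s\<in>bl (length Ws). F (True # s) b))"
    by (simp add: sum_bl_Suc UNIV_bool add.commute)
  ultimately show ?case using Cons.prems(1) by auto
qed


section \<open>Measuring the cluster state row by row\<close>

definition path_sign :: "nat \<Rightarrow> (nat \<Rightarrow> bool) \<Rightarrow> complex" where
  "path_sign n f = (\<Prod>k<n - 1. sg (f k \<and> f (Suc k)))"

text \<open>Parity of the set neighbours: conjugating X^a by the controlled phases of the path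
  multiplies it by Z to this pattern, up to sign.\<close>

definition path_nbrs :: "nat \<Rightarrow> (nat \<Rightarrow> bool) \<Rightarrow> nat \<Rightarrow> bool" where
  "path_nbrs n a k \<longleftrightarrow> (0 < k \<and> a (k - 1)) \<noteq> (Suc k < n \<and> a (Suc k))"

definition had :: "nat \<Rightarrow> qstate \<Rightarrow> qstate" where
  "had n \<chi> y = (\<Sum>x\<in>bl n. dot n ((!) x) ((!) y) * \<chi> x)"

definition dphase :: "nat \<Rightarrow> (nat \<Rightarrow> real) \<Rightarrow> bool list \<Rightarrow> complex" where
  "dphase n \<alpha> x = (\<Prod>k<n. if x ! k then cis (\<alpha> k) else 1)"

definition step :: "nat \<Rightarrow> (nat \<Rightarrow> real) \<Rightarrow> qstate \<Rightarrow> qstate" where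
  "step n \<alpha> \<chi> = had n (\<lambda>x. dphase n \<alpha> x * path_sign n ((!) x) * \<chi> x)"

lemma path_sign_cong: "(\<And>k. k < n \<Longrightarrow> f k = g k) \<Longrightarrow> path_sign n f = path_sign n g"
  unfolding path_sign_def by (intro prod.cong) auto

lemma path_sign_square [simp]: "path_sign n f * path_sign n f = 1"
  by (simp add: path_sign_def flip: prod.distrib)

lemma path_sign_nonzero [simp]: "path_sign n f \<noteq> 0"
  by (simp add: path_sign_def)

text \<open>\<open>path_sign\<close> is the sign of a quadratic form over the bits, and the
  adjacency form of the path is its polarisation: each edge contributes one cross term from either
  end.\<close>

lemma path_sign_xor: "path_sign n (\<lambda>k. f k \<noteq> g k) = path_sign n f * path_sign n g * dot n (path_nbrs n g) f"
proof (cases n)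
  case 0
  then show ?thesis by (simp add: path_sign_def dot_def)
next
  case (Suc m)
  have "dot n (path_nbrs n g) f = dot n (\<lambda>k. 0 < k \<and> g (k - 1)) f * dot n (\<lambda>k. Suc k < n \<and> g (Suc k)) f"
    unfolding path_nbrs_def[abs_def] by (rule dot_xor_left)
  also have "dot n (\<lambda>k. 0 < k \<and> g (k - 1)) f = (\<Prod>k<m. sg (g k \<and> f (Suc k)))"
    by (simp add: dot_def Suc prod.lessThan_Suc_shift del: prod.lessThan_Suc)
  also have "dot n (\<lambda>k. Suc k < n \<and> g (Suc k)) f = (\<Prod>k<m. sg (g (Suc k) \<and> f k))"
    by (simp add: dot_def Suc)
  finally show ?thesis unfolding path_sign_def Suc diff_Suc_1 prod.distrib[symmetric] mult.assoc[symmetric]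
    by (simp only: prod.distrib[symmetric]) (intro prod.cong, auto simp: sg_def)
qed

lemma path_sign_xor_bits: "path_sign n ((!) (xor_bits n a x)) = path_sign n ((!) x) * path_sign n a * dot n (path_nbrs n a) ((!) x)"
proof -
  have "path_sign n ((!) (xor_bits n a x)) = path_sign n (\<lambda>k. x ! k \<noteq> a k)" by (rule path_sign_cong) simp
  then show ?thesis by (simp only: path_sign_xor)
qed

lemma path_sign_pauli_op:
  assumes "x \<in> bl n"
  shows "path_sign n ((!) x) * pauli_op n a b \<chi> x =
    path_sign n a * dot n (path_nbrs n a) a * pauli_op n a (\<lambda>k. b k \<noteq> path_nbrs n a k) (\<lambda>x. path_sign n ((!) x) * \<chi> x) x"
proof -
  have "xor_bits n a (xor_bits n a x) = x" using assms by (simp add: xor_bits_id)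
  then have "path_sign n ((!) x) = path_sign n ((!) (xor_bits n a x)) * path_sign n a * (dot n (path_nbrs n a) a * dot n (path_nbrs n a) ((!) x))"
    using path_sign_xor_bits[of n a "xor_bits n a x"] by (simp only: dot_xor_bits)
  then show ?thesis unfolding pauli_op_def dot_xor_left by (simp only: mult_ac)
qed

text \<open>A bit flip reverses a rotation about Z up to a phase. This is what makes adaptive angles
  necessary and sufficient for passing an X byproduct.\<close>

lemma dphase_xor_bits:
  "dphase n (\<lambda>k. if a k then - \<alpha> k else \<alpha> k) x = (\<Prod>k<n. if a k then cis (- \<alpha> k) else 1) * dphase n \<alpha> (xor_bits n a x)"
  unfolding dphase_def prod.distrib[symmetric] by (intro prod.cong) (auto simp: cis_mult)

lemma had_cong: "(\<And>x. x \<in> bl n \<Longrightarrow> f x = g x) \<Longrightarrow> had n f = had n g"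
  by (simp add: had_def fun_eq_iff)

lemma had_scale: "had n (\<lambda>x. c * f x) y = c * had n f y"
  by (simp add: had_def sum_distrib_left mult_ac)

text \<open>Hadamard gates exchange X and Z: shifting the summation index by \<open>a\<close> turns
  X^a into the character \<open>dot n a\<close>, while Z^b shifts the argument.\<close>

lemma had_pauli_op: "had n (pauli_op n a b \<chi>) y = dot n a b * pauli_op n b a (had n \<chi>) y"
proof -
  have "had n (pauli_op n a b \<chi>) y =
    (\<Sum>x\<in>bl n. dot n ((!) (xor_bits n a (xor_bits n a x))) ((!) y) * (dot n b ((!) (xor_bits n a (xor_bits n a x))) * \<chi> (xor_bits n a x)))"
    unfolding had_def pauli_op_def by (intro sum.cong) (auto simp: xor_bits_id)
  also have "\<dots> = (\<Sum>x\<in>bl n. dot n ((!) (xor_bits n a x)) ((!) y) * (dot n b ((!) (xor_bits n a x)) * \<chi> x))"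
    by (rule sum_bl_xor_bits)
  also have "\<dots> = (\<Sum>x\<in>bl n. dot n a b * (dot n a ((!) y) * (dot n b ((!) x) * dot n ((!) y) ((!) x) * \<chi> x)))"
    by (simp add: dot_commute[of n _ "(!) y"] dot_xor_bits dot_commute[of n b a] mult_ac dot_commute[of n a "(!) y"])
  also have "\<dots> = dot n a b * pauli_op n b a (had n \<chi>) y"
    by (simp add: pauli_op_def had_def sum_distrib_left dot_commute[of n _ "(!) (xor_bits n b y)"] dot_commute[of n "(!) (xor_bits n b y)"]
        dot_xor_bits dot_commute[of n "(!) y"] dot_commute[of n b] mult_ac)
  finally show ?thesis .
qed

section \<open>Amplitudes of the cluster state as signs, organised by rows\<close>

primrec grid_sign :: "nat \<Rightarrow> nat \<Rightarrow> bool list \<Rightarrow> complex" where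
  "grid_sign d 0 x = 1"
| "grid_sign d (Suc r) x = path_sign d ((!) x) * (if r = 0 then 1 else dot d ((!) x) (\<lambda>k. x ! (d + k))) *
     grid_sign d r (drop d x)"

text \<open>Only the links to the left and upwards, so that the product over all vertices counts
  every edge once.\<close>

definition back_sign :: "nat \<Rightarrow> (nat \<Rightarrow> bool) \<Rightarrow> nat \<Rightarrow> complex" where
  "back_sign d f a = (if a mod d = 0 then 1 else sg (f a \<and> f (a - 1))) * (if a < d then 1 else sg (f a \<and> f (a - d)))"

lemma prod_lessThan_add: "(\<Prod>k<m + n. f k) = (\<Prod>k<m. f k) * (\<Prod>k<n. f (m + k))" for f :: "nat \<Rightarrow> complex"
  by (induction n) (simp_all add: mult_ac)

lemma prod_back_sign_row: "(\<Prod>a<d. back_sign d f a) = path_sign d f"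
proof (cases d)
  case 0
  then show ?thesis by (simp add: path_sign_def)
next
  case (Suc m)
  have "(\<Prod>a<Suc m. back_sign (Suc m) f a) = back_sign (Suc m) f 0 * (\<Prod>a<m. back_sign (Suc m) f (Suc a))"
    by (rule prod.lessThan_Suc_shift)
  also have "\<dots> = (\<Prod>a<m. sg (f a \<and> f (Suc a)))"
    by (simp add: back_sign_def conj_commute)
  finally show ?thesis by (simp add: path_sign_def Suc)
qed

lemma grid_sign_eq_prod:
  assumes "d * r \<le> length x"
  shows "grid_sign d r x = (\<Prod>a<d * r. back_sign d ((!) x) a)"
  using assms
proof (induction r arbitrary: x)
  case (Suc r)
  have b: "back_sign d ((!) x) (d + a) = (if a < d then sg (x ! a \<and> x ! (d + a)) else 1) * back_sign d ((!) (drop d x)) a"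
    if "a < d * r" for a
    using that Suc.prems by (cases "a = 0") (auto simp: back_sign_def nth_drop conj_commute)
  have "(\<Prod>a<d * r. if a < d then sg (x ! a \<and> x ! (d + a)) else 1) =
    (if r = 0 then 1 else dot d ((!) x) (\<lambda>k. x ! (d + k)))"
  proof (cases r)
    case (Suc r')
    then show ?thesis by (simp add: prod_lessThan_add dot_def)
  qed simp
  moreover have "(\<Prod>a<d * r. back_sign d ((!) x) (d + a)) =
    (\<Prod>a<d * r. if a < d then sg (x ! a \<and> x ! (d + a)) else 1) * (\<Prod>a<d * r. back_sign d ((!) (drop d x)) a)"
    unfolding prod.distrib[symmetric] by (intro prod.cong) (auto simp: b)
  moreover have "grid_sign d r (drop d x) = (\<Prod>a<d * r. back_sign d ((!) (drop d x)) a)"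
    using Suc.prems by (intro Suc.IH) simp
  ultimately show ?case
    unfolding grid_sign.simps mult_Suc_right prod_lessThan_add prod_back_sign_row by (simp only: mult.assoc)
qed simp

lemma prod_backward_neighbours:
  assumes "a < d * d"
  shows "(\<Prod>b | b < a \<and> grid_adj d a b. sg (f a \<and> f b)) = back_sign d f a"
proof -
  have d: "0 < d" using assms by (cases d) auto
  have up: "b div d + 1 = a div d \<and> a mod d = b mod d \<longleftrightarrow> b + d = a" for b
  proof
    assume *: "b div d + 1 = a div d \<and> a mod d = b mod d"
    have "b + d = (b div d + 1) * d + b mod d" by (simp add: algebra_simps)
    also have "\<dots> = a" using * div_mult_mod_eq[of a d] by (simp only:)
    finally show "b + d = a" .
  qed (use d in auto)
  have left: "b div d = a div d \<and> a mod d = b mod d + 1 \<longleftrightarrow> b + 1 = a \<and> a mod d \<noteq> 0" for b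
  proof
    assume *: "b div d = a div d \<and> a mod d = b mod d + 1"
    have "b + 1 = b div d * d + (b mod d + 1)" by simp
    also have "\<dots> = a" using * by (metis div_mult_mod_eq)
    finally show "b + 1 = a \<and> a mod d \<noteq> 0" using * by simp
  next
    assume *: "b + 1 = a \<and> a mod d \<noteq> 0"
    then show "b div d = a div d \<and> a mod d = b mod d + 1"
      using mod_Suc[of b d] div_Suc[of b d] by (auto split: if_splits)
  qed
  have right: "\<not> (a div d = b div d \<and> b mod d = a mod d + 1)" if "b < a" for b
  proof
    assume *: "a div d = b div d \<and> b mod d = a mod d + 1"
    have "b = b div d * d + b mod d" "a = a div d * d + a mod d" by simp_all
    then show False using * that by simp
  qed
  have down: "\<not> (a mod d = b mod d \<and> b div d = a div d + 1)" if "b < a" for b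
    using div_le_mono[of b a d] that by auto
  have "{b. b < a \<and> grid_adj d a b} = {b. b + 1 = a \<and> a mod d \<noteq> 0} \<union> {b. b + d = a}"
  proof -
    have "grid_adj d a b \<longleftrightarrow> (b + 1 = a \<and> a mod d \<noteq> 0) \<or> b + d = a" if "b < a" for b
    proof -
      have "grid_adj d a b \<longleftrightarrow> (b div d = a div d \<and> a mod d = b mod d + 1) \<or> (b div d + 1 = a div d \<and> a mod d = b mod d)"
        unfolding grid_adj_def using right[OF that] down[OF that] that assms by fastforce
      then show ?thesis unfolding left up .
    qed
    moreover have "b + 1 = a \<Longrightarrow> b < a" "b + d = a \<Longrightarrow> b < a" for b using d by auto
    ultimately show ?thesis by blast
  qed
  also have "(\<Prod>b\<in>\<dots>. sg (f a \<and> f b)) = back_sign d f a"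
  proof -
    have "{b. b + 1 = a \<and> a mod d \<noteq> 0} = (if a mod d = 0 then {} else {a - 1})"
      by (cases a) auto
    moreover have "{b. b + d = a} = (if a < d then {} else {a - d})" by auto
    \<comment> \<open>On a grid of width one the two predecessors would coincide, but then every
      vertex is in the first column.\<close>
    moreover have "a mod d \<noteq> 0 \<Longrightarrow> \<not> a < d \<Longrightarrow> a - 1 \<noteq> a - d \<and> a - d \<noteq> a - 1"
      using d by (cases "d = 1") auto
    ultimately show ?thesis
      by (cases "a mod d = 0"; cases "a < d") (simp_all add: back_sign_def)
  qed
  finally show ?thesis .
qed

lemma apply1_sig_z: "apply1 b sig_z v x = sg (x ! b) * v x"
proof -
  have "x ! b = c \<Longrightarrow> x[b := c] = x" for c using list_update_id[of x b] by auto
  then show ?thesis by (cases "x ! b") (simp_all add: apply1_def UNIV_bool sig_z_def sg_def)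
qed

lemma foldr_apply1_sig_z:
  "distinct L \<Longrightarrow> foldr (\<lambda>b. apply1 b sig_z) L v x = (\<Prod>b\<in>set L. sg (x ! b)) * v x"
  by (induction L) (simp_all add: apply1_sig_z)

text \<open>The stabiliser equation at \<open>a\<close> relates the amplitudes with bit
  \<open>a\<close> on and off. The bits of \<open>x\<close> are switched on in increasing order
  (\<open>xs a\<close> keeps the first \<open>a\<close> of them), so that each time only the links
  to earlier vertices produce a sign.\<close>

lemma cluster_eq_grid_sign:
  assumes c: "is_cluster d \<psi>" and x: "x \<in> bl (d * d)"
  shows "\<psi> x = \<psi> (replicate (d * d) False) * grid_sign d d x"
proof -
  define xs where "xs a = map (\<lambda>i. i < a \<and> x ! i) [0..<d * d]" for a
  have len: "length x = d * d" using x by (simp add: bl_def)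
  have "\<psi> (xs a) = \<psi> (replicate (d * d) False) * (\<Prod>i<a. back_sign d ((!) x) i)" if "a \<le> d * d" for a
    using that
  proof (induction a)
    case 0
    then show ?case by (simp add: xs_def map_replicate_const)
  next
    case (Suc a)
    have nth: "xs a ! b = (b < a \<and> x ! b)" if "b < d * d" for b
      using that by (simp add: xs_def)
    have xs: "xs (Suc a) = (xs a)[a := x ! a]"
      using Suc.prems by (intro nth_equalityI) (auto simp: xs_def nth_list_update less_Suc_eq)
    have "\<psi> (xs (Suc a)) = back_sign d ((!) x) a * \<psi> (xs a)"
    proof (cases "x ! a")
      case False
      then have "xs (Suc a) = xs a" using xs nth[of a] Suc.prems by (simp add: xs_def list_update_same_conv)
      then show ?thesis using False by (simp add: back_sign_def)
    next
      case True
      let ?A = "{b. b < d * d \<and> grid_adj d a b}"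
      have a: "a < d * d" using Suc.prems by simp
      have in_bl: "xs (Suc a) \<in> bl (d * d)" by (simp add: xs_def bl_def)
      have F: "(xs (Suc a))[a := False] = xs a" "xs (Suc a) ! a"
        using xs nth[OF a] True a by (simp_all add: list_update_same_conv xs_def)
      have "\<psi> (xs (Suc a)) = apply1 a sig_x (foldr (\<lambda>b. apply1 b sig_z) (filter (grid_adj d a) [0..<d * d]) \<psi>) (xs (Suc a))"
        using c a in_bl by (simp add: is_cluster_def)
      also have "\<dots> = foldr (\<lambda>b. apply1 b sig_z) (filter (grid_adj d a) [0..<d * d]) \<psi> (xs a)"
        by (simp add: apply1_def sig_x_def UNIV_bool F)
      also have "\<dots> = (\<Prod>b\<in>set (filter (grid_adj d a) [0..<d * d]). sg (xs a ! b)) * \<psi> (xs a)"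
        by (rule foldr_apply1_sig_z) simp
      also have "set (filter (grid_adj d a) [0..<d * d]) = ?A" by auto
      also have "(\<Prod>b\<in>?A. sg (xs a ! b)) = (\<Prod>b | b < a \<and> grid_adj d a b. sg (x ! a \<and> x ! b))"
        using a True by (intro prod.mono_neutral_cong_right) (auto simp: nth sg_def split: if_splits)
      also have "\<dots> = back_sign d ((!) x) a" using a by (rule prod_backward_neighbours)
      finally show ?thesis .
    qed
    then show ?case using Suc by simp
  qed
  moreover have "xs (d * d) = x" using len by (auto simp: xs_def intro: nth_equalityI)
  ultimately show ?thesis using len by (metis grid_sign_eq_prod order_refl)
qed

section \<open>Measuring one row of the grid\<close>

lemma dot_add: "dot (m + n) f g = dot m f g * dot n (\<lambda>k. f (m + k)) (\<lambda>k. g (m + k))"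
  unfolding dot_def by (rule prod_lessThan_add)

text \<open>The edge that joins the two parts acts on the right part as Z on its first site,
  controlled by the last bit on the left. \<open>Suc e\<close> ensures that such a bit
  exists.\<close>

lemma path_sign_add: "path_sign (Suc e + n) f = path_sign (Suc e) f * dot n (\<lambda>k. k = 0 \<and> f e) (\<lambda>k. f (Suc e + k)) * path_sign n (\<lambda>k. f (Suc e + k))"
proof (cases n)
  case (Suc m)
  have "dot n (\<lambda>k. k = 0 \<and> f e) (\<lambda>k. f (Suc e + k)) = sg (f e \<and> f (Suc e))"
    unfolding Suc dot_def by (simp add: prod.lessThan_Suc_shift del: prod.lessThan_Suc)
  moreover have "(\<Prod>k<e + Suc m. sg (f k \<and> f (Suc k))) =
    (\<Prod>k<e. sg (f k \<and> f (Suc k))) * (sg (f e \<and> f (Suc e)) * (\<Prod>k<m. sg (f (Suc e + k) \<and> f (Suc e + Suc k))))"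
    unfolding prod_lessThan_add[of _ e "Suc m"] by (simp add: prod.lessThan_Suc_shift del: prod.lessThan_Suc)
  ultimately show ?thesis by (simp add: path_sign_def Suc)
qed (simp add: path_sign_def dot_def)

lemma amp_append: "length s = length Ws \<Longrightarrow> amp (Ws @ Vs) (s @ t) w = amp Vs t (amp Ws s w)"
proof (induction Ws arbitrary: s w)
  case (Cons W Ws)
  then obtain b s' where "s = b # s'" "length s' = length Ws" by (cases s) auto
  then show ?case using Cons.IH by simp
qed simp

lemma onb_sig_id: "onb sig_id"
  by (auto simp: onb_def sig_id_def UNIV_bool)

lemma amp_sig_id: "length s = e \<Longrightarrow> amp (replicate e sig_id) s w = (\<lambda>y. w (s @ y))"
proof (induction e arbitrary: s w)
  case (Suc e)
  then obtain b s' where "s = b # s'" "length s' = e" by (cases s) auto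
  moreover have "bra sig_id b w = (\<lambda>r. w (b # r))"
    by (cases b) (auto simp: bra_def sig_id_def UNIV_bool)
  ultimately show ?case using Suc.IH by simp
qed simp

lemma strat_row_0:
  assumes "\<forall>W\<in>set Ws. onb W" "\<And>s. s \<in> bl (length Ws) \<Longrightarrow> strat P j (amp Ws s w) (\<lambda>_. 0)"
  shows "strat P (length Ws + j) w (\<lambda>_. 0)"
  using strat_row[OF assms(1), of "strat P j" w "\<lambda>_ _. 0"] assms(2) by (simp add: strat_add)

text \<open>The angle is negated because the bra conjugates it: the wire then receives the phase
  \<open>cis \<alpha>\<close>, and the outcome adds a Z byproduct.\<close>

definition xy_basis :: "real \<Rightarrow> qop1" where
  "xy_basis \<alpha> x s = (if x then sg s * cis (- \<alpha>) else 1) / complex_of_real (sqrt 2)"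

lemma onb_xy_basis: "onb (xy_basis \<alpha>)"
proof -
  have "complex_of_real (sqrt 2) * complex_of_real (sqrt 2) = 2"
    by (simp flip: of_real_mult)
  then show ?thesis
    by (auto simp: onb_def xy_basis_def UNIV_bool cis_cnj cis_mult)
qed

lemma prod_xy_basis:
  "(\<Prod>k<n. cnj (xy_basis (\<alpha> k) (x ! k) (t ! k))) =
    (1 / complex_of_real (sqrt 2)) ^ n * (dot n ((!) t) ((!) x) * dphase n \<alpha> x)"
proof -
  have "(1 / complex_of_real (sqrt 2)) ^ n = (\<Prod>k<n. 1 / complex_of_real (sqrt 2))" by simp
  then show ?thesis
    unfolding dot_def dphase_def prod.distrib[symmetric]
    by (simp only: prod.distrib[symmetric]) (intro prod.cong, auto simp: xy_basis_def cis_cnj)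
qed

text \<open>The byproduct rule: a row with incoming Pauli operator, adapted angles and outcome signs
  \<open>q\<close> equals the ideal \<open>step\<close> followed by another Pauli operator.
  Controlled phases, rotations and Hadamard gates are commuted past it in turn.\<close>

lemma had_dphase_pauli_op:
  "\<exists>c a' b'. \<forall>y. had n (\<lambda>x. dot n q ((!) x) * dphase n (\<lambda>k. if a k then - \<alpha> k else \<alpha> k) x *
     (path_sign n ((!) x) * pauli_op n a b \<chi> x)) y = c * pauli_op n a' b' (step n \<alpha> \<chi>) y"
proof -
  define b1 where "b1 = (\<lambda>k. b k \<noteq> path_nbrs n a k)"
  define b2 where "b2 = (\<lambda>k. q k \<noteq> b1 k)"
  define c where "c = (\<Prod>k<n. if a k then cis (- \<alpha> k) else 1) * (path_sign n a * dot n (path_nbrs n a) a)"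
  have "dot n q ((!) x) * dphase n (\<lambda>k. if a k then - \<alpha> k else \<alpha> k) x * (path_sign n ((!) x) * pauli_op n a b \<chi> x) =
     c * pauli_op n a b2 (\<lambda>x. dphase n \<alpha> x * path_sign n ((!) x) * \<chi> x) x" if x: "x \<in> bl n" for x
    unfolding path_sign_pauli_op[OF x] dphase_xor_bits b1_def[symmetric] unfolding pauli_op_def b2_def dot_xor_left c_def
    by (simp only: mult_ac)
  then have eq: "had n (\<lambda>x. dot n q ((!) x) * dphase n (\<lambda>k. if a k then - \<alpha> k else \<alpha> k) x *
      (path_sign n ((!) x) * pauli_op n a b \<chi> x)) =
      had n (\<lambda>x. c * pauli_op n a b2 (\<lambda>x. dphase n \<alpha> x * path_sign n ((!) x) * \<chi> x) x)"
    by (rule had_cong)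
  have "had n (\<lambda>x. dot n q ((!) x) * dphase n (\<lambda>k. if a k then - \<alpha> k else \<alpha> k) x *
      (path_sign n ((!) x) * pauli_op n a b \<chi> x)) y = (c * dot n a b2) * pauli_op n b2 a (step n \<alpha> \<chi>) y" for y
    unfolding eq had_scale had_pauli_op step_def[symmetric] by (simp only: mult.assoc)
  then show ?thesis by blast
qed

lemma grid_sign_rows:
  assumes z: "z \<in> bl (Suc e)" and x: "x \<in> bl n" and z': "z' \<in> bl (Suc e)" and x': "x' \<in> bl n"
  shows "grid_sign (Suc e + n) (Suc (Suc r)) (z @ x @ z' @ x' @ y) =
    path_sign (Suc e) ((!) z) * dot n (\<lambda>k. k = 0 \<and> z ! e) ((!) x) * path_sign n ((!) x) *
    (dot (Suc e) ((!) z) ((!) z') * dot n ((!) x) ((!) x')) * grid_sign (Suc e + n) (Suc r) (z' @ x' @ y)"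
proof -
  let ?v = "z @ x @ z' @ x' @ y"
  have l: "length z = Suc e" "length x = n" "length z' = Suc e" "length x' = n"
    using assms by (simp_all add: bl_def)
  have "path_sign (Suc e + n) ((!) ?v) = path_sign (Suc e) ((!) z) * dot n (\<lambda>k. k = 0 \<and> z ! e) ((!) x) * path_sign n ((!) x)"
    unfolding path_sign_add using l
    by (intro arg_cong2[of _ _ _ _ "(*)"] path_sign_cong dot_cong) (auto simp: nth_append)
  moreover have "dot (Suc e + n) ((!) ?v) (\<lambda>k. ?v ! (Suc e + n + k)) = dot (Suc e) ((!) z) ((!) z') * dot n ((!) x) ((!) x')"
    unfolding dot_add using l
    by (intro arg_cong2[of _ _ _ _ "(*)"] dot_cong) (auto simp: nth_append)
  moreover have "drop (Suc e + n) ?v = z' @ x' @ y" using l by simp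
  ultimately show ?thesis unfolding grid_sign.simps(2)[of _ "Suc r"] by simp
qed

text \<open>Invariant when the measurement reaches a row: the wires \<open>x\<close> hold
  \<open>\<chi>\<close> up to a byproduct and are still linked by \<open>grid_sign\<close> to the
  current and the \<open>r\<close> later rows. The factor \<open>g\<close> keeps the signs that
  measured sites above impose on the columns \<open>z\<close> to be removed.\<close>

definition row_state :: "nat \<Rightarrow> nat \<Rightarrow> nat \<Rightarrow> qstate \<Rightarrow> qstate \<Rightarrow> bool" where
  "row_state e n r \<chi> w \<longleftrightarrow> (\<exists>g a b. \<forall>z\<in>bl (Suc e). \<forall>x\<in>bl n. \<forall>y\<in>bl ((Suc e + n) * r).
     w (z @ x @ y) = g z * pauli_op n a b \<chi> x * grid_sign (Suc e + n) (Suc r) (z @ x @ y))"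

lemma bl_addE:
  assumes "s \<in> bl (m + n)"
  obtains u v where "s = u @ v" "u \<in> bl m" "v \<in> bl n"
proof
  show "s = take m s @ drop m s" by simp
qed (use assms in \<open>auto simp: bl_def\<close>)

text \<open>Teleportation by one row: the vertical links supply the kernel \<open>dot n x x'\<close>
  of the Hadamard gates, the links of the row supply the controlled phases, and the measurement
  supplies the rotations.\<close>

lemma strat_step:
  assumes w: "row_state e n (Suc r) \<chi> w"
    and next_row: "\<And>w'. row_state e n r (step n \<alpha> \<chi>) w' \<Longrightarrow> strat P j w' (\<lambda>_. 0)"
  shows "strat P (Suc e + n + j) w (\<lambda>_. 0)"
proof -
  from w obtain g a b where w: "\<And>z x y. z \<in> bl (Suc e) \<Longrightarrow> x \<in> bl n \<Longrightarrow> y \<in> bl ((Suc e + n) * Suc r) \<Longrightarrow>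
     w (z @ x @ y) = g z * pauli_op n a b \<chi> x * grid_sign (Suc e + n) (Suc (Suc r)) (z @ x @ y)"
    unfolding row_state_def by blast
  \<comment> \<open>Only \<open>a\<close>, known from earlier rows, enters the angles.\<close>
  define \<beta> where "\<beta> = (\<lambda>k. if a k then - \<alpha> k else \<alpha> k)"
  define Vs where "Vs = map (\<lambda>k. xy_basis (\<beta> k)) [0..<n]"
  define Ws where "Ws = replicate (Suc e) sig_id @ Vs"
  have len: "length Ws = Suc e + n" "length Vs = n" by (simp_all add: Ws_def Vs_def)
  have "strat P (length Ws + j) w (\<lambda>_. 0)"
  proof (rule strat_row_0)
    show "\<forall>W\<in>set Ws. onb W" by (auto simp: Ws_def Vs_def onb_sig_id onb_xy_basis)
    fix s assume "s \<in> bl (length Ws)"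
    then obtain u t where s: "s = u @ t" and u: "u \<in> bl (Suc e)" and t: "t \<in> bl n"
      unfolding len by (elim bl_addE)
    have amp: "amp Ws s w v = (\<Sum>x\<in>bl n. (\<Prod>k<n. cnj (xy_basis (\<beta> k) (x ! k) (t ! k))) * w (u @ x @ v))" for v
    proof -
      have "amp Ws s w = amp Vs t (\<lambda>y. w (u @ y))"
        using u unfolding Ws_def s by (subst amp_append) (auto simp: amp_sig_id bl_def simp del: replicate_Suc)
      then show ?thesis by (simp add: amp_def len) (simp add: Vs_def)
    qed
    \<comment> \<open>All outcomes of this row reach the wires as Z operators: their own outcomes
      \<open>t\<close>, and on wire 0 also the last removed column, its left neighbour.\<close>
    define q where "q = (\<lambda>k. (t ! k) \<noteq> (k = 0 \<and> u ! e))"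
    obtain c a' b' where had: "\<And>y. had n (\<lambda>x. dot n q ((!) x) * dphase n \<beta> x *
       (path_sign n ((!) x) * pauli_op n a b \<chi> x)) y = c * pauli_op n a' b' (step n \<alpha> \<chi>) y"
      unfolding \<beta>_def using had_dphase_pauli_op by metis
    define h where "h z = (1 / complex_of_real (sqrt 2)) ^ n * g u * path_sign (Suc e) ((!) u) * c * dot (Suc e) ((!) u) ((!) z)" for z
    have "amp Ws s w (z @ x' @ y) = h z * pauli_op n a' b' (step n \<alpha> \<chi>) x' * grid_sign (Suc e + n) (Suc r) (z @ x' @ y)"
      if z: "z \<in> bl (Suc e)" and x': "x' \<in> bl n" and y: "y \<in> bl ((Suc e + n) * r)" for z x' y
    proof -
      define G where "G = grid_sign (Suc e + n) (Suc r) (z @ x' @ y)"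
      define C where "C = (1 / complex_of_real (sqrt 2)) ^ n * g u * path_sign (Suc e) ((!) u) * dot (Suc e) ((!) u) ((!) z) * G"
      have v: "z @ x' @ y \<in> bl ((Suc e + n) * Suc r)"
        using that by (simp add: bl_def)
      have "(\<Prod>k<n. cnj (xy_basis (\<beta> k) (x ! k) (t ! k))) * w (u @ x @ z @ x' @ y) =
        C * (dot n ((!) x) ((!) x') * (dot n q ((!) x) * dphase n \<beta> x * (path_sign n ((!) x) * pauli_op n a b \<chi> x)))"
        if x: "x \<in> bl n" for x
        unfolding w[OF u x v] grid_sign_rows[OF u x z x'] prod_xy_basis q_def dot_xor_left C_def G_def
        by (simp only: mult_ac)
      then have "amp Ws s w (z @ x' @ y) = C * had n (\<lambda>x. dot n q ((!) x) * dphase n \<beta> x * (path_sign n ((!) x) * pauli_op n a b \<chi> x)) x'"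
        by (simp add: amp had_def sum_distrib_left)
      then show ?thesis unfolding had C_def h_def G_def by (simp only: mult_ac)
    qed
    then have "row_state e n r (step n \<alpha> \<chi>) (amp Ws s w)"
      unfolding row_state_def by blast
    then show "strat P j (amp Ws s w) (\<lambda>_. 0)" by (rule next_row)
  qed
  then show ?thesis by (simp add: len)
qed

text \<open>Computational outcomes cut the row off. Its vertical links leave only the signs Z^t on
  the next wires, which thus carry the uniform superposition again.\<close>

lemma strat_reset:
  assumes w: "row_state e n (Suc r) \<chi> w"
    and next_row: "\<And>w'. row_state e n r (\<lambda>_. 1) w' \<Longrightarrow> strat P j w' (\<lambda>_. 0)"
  shows "strat P (Suc e + n + j) w (\<lambda>_. 0)"
proof -
  from w obtain g a b where w: "\<And>z x y. z \<in> bl (Suc e) \<Longrightarrow> x \<in> bl n \<Longrightarrow> y \<in> bl ((Suc e + n) * Suc r) \<Longrightarrow>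
     w (z @ x @ y) = g z * pauli_op n a b \<chi> x * grid_sign (Suc e + n) (Suc (Suc r)) (z @ x @ y)"
    unfolding row_state_def by blast
  define Ws where "Ws = replicate (Suc e + n) sig_id"
  have "strat P (length Ws + j) w (\<lambda>_. 0)"
  proof (rule strat_row_0)
    show "\<forall>W\<in>set Ws. onb W" by (auto simp: Ws_def onb_sig_id)
    fix s assume s': "s \<in> bl (length Ws)"
    then obtain u t where s: "s = u @ t" and u: "u \<in> bl (Suc e)" and t: "t \<in> bl n"
      unfolding Ws_def length_replicate by (elim bl_addE)
    define h where "h z = g u * pauli_op n a b \<chi> t * path_sign (Suc e) ((!) u) * dot n (\<lambda>k. k = 0 \<and> u ! e) ((!) t) *
      path_sign n ((!) t) * dot (Suc e) ((!) u) ((!) z)" for z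
    have amp: "amp Ws s w v = w (u @ t @ v)" for v
      using s' unfolding Ws_def by (subst amp_sig_id) (auto simp: bl_def s)
    have "amp Ws s w (z @ x' @ y) = h z * pauli_op n (\<lambda>_. False) ((!) t) (\<lambda>_. 1) x' * grid_sign (Suc e + n) (Suc r) (z @ x' @ y)"
      if z: "z \<in> bl (Suc e)" and x': "x' \<in> bl n" and y: "y \<in> bl ((Suc e + n) * r)" for z x' y
    proof -
      have v: "z @ x' @ y \<in> bl ((Suc e + n) * Suc r)"
        using that by (simp add: bl_def)
      show ?thesis unfolding amp w[OF u t v] grid_sign_rows[OF u t z x'] h_def
        by (simp only: pauli_op_def[of n "\<lambda>_. False"] mult_ac mult_1_right mult_1_left)
    qed
    then have "row_state e n r (\<lambda>_. 1) (amp Ws s w)"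
      unfolding row_state_def by blast
    then show "strat P j (amp Ws s w) (\<lambda>_. 0)" by (rule next_row)
  qed
  then show ?thesis by (simp add: Ws_def)
qed

text \<open>The wires of the last row stay unmeasured, so their controlled phases persist; this is
  the \<open>path_sign\<close> in the assumption.\<close>

lemma strat_last_row:
  assumes w: "row_state e n 0 \<chi> w" and out: "\<And>x. x \<in> bl n \<Longrightarrow> path_sign n ((!) x) * \<chi> x = c * \<phi> x"
  shows "strat (pauli_leaf n \<phi>) (Suc e) w (\<lambda>_. 0)"
proof -
  from w obtain g a b where w: "\<And>z x. z \<in> bl (Suc e) \<Longrightarrow> x \<in> bl n \<Longrightarrow>
     w (z @ x) = g z * pauli_op n a b \<chi> x * path_sign (Suc e + n) ((!) (z @ x))"
    unfolding row_state_def by auto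
  have "strat (pauli_leaf n \<phi>) (length (replicate (Suc e) sig_id) + 0) w (\<lambda>_. 0)"
  proof (rule strat_row_0)
    show "\<forall>W\<in>set (replicate (Suc e) sig_id). onb W" by (auto simp: onb_sig_id)
    fix s assume "s \<in> bl (length (replicate (Suc e) sig_id))"
    then have s: "s \<in> bl (Suc e)" by simp
    define q where "q = (\<lambda>k::nat. k = 0 \<and> s ! e)"
    have "w (s @ x) = (g s * path_sign (Suc e) ((!) s) * (path_sign n a * dot n (path_nbrs n a) a) * c) *
       pauli_op n a (\<lambda>k. q k \<noteq> (b k \<noteq> path_nbrs n a k)) \<phi> x" if x: "x \<in> bl n" for x
    proof -
      have "path_sign (Suc e + n) ((!) (s @ x)) = path_sign (Suc e) ((!) s) * dot n q ((!) x) * path_sign n ((!) x)"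
        unfolding path_sign_add q_def using s
        by (intro arg_cong2[of _ _ _ _ "(*)"] path_sign_cong dot_cong) (auto simp: nth_append bl_def)
      then have "w (s @ x) = g s * path_sign (Suc e) ((!) s) * dot n q ((!) x) * (path_sign n ((!) x) * pauli_op n a b \<chi> x)"
        unfolding w[OF s x] by (simp only: mult_ac)
      also have "\<dots> = (g s * path_sign (Suc e) ((!) s) * (path_sign n a * dot n (path_nbrs n a) a)) *
         pauli_op n a (\<lambda>k. q k \<noteq> (b k \<noteq> path_nbrs n a k)) (\<lambda>x. path_sign n ((!) x) * \<chi> x) x"
        unfolding path_sign_pauli_op[OF x] unfolding pauli_op_def dot_xor_left by (simp only: mult_ac)
      also have "pauli_op n a (\<lambda>k. q k \<noteq> (b k \<noteq> path_nbrs n a k)) (\<lambda>x. path_sign n ((!) x) * \<chi> x) x =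
         c * pauli_op n a (\<lambda>k. q k \<noteq> (b k \<noteq> path_nbrs n a k)) \<phi> x"
        unfolding pauli_op_def out[OF xor_bits_in_bl] by (simp only: mult_ac)
      finally show ?thesis by (simp only: mult_ac)
    qed
    then show "strat (pauli_leaf n \<phi>) 0 (amp (replicate (Suc e) sig_id) s w) (\<lambda>_. 0)"
      using s unfolding strat.simps pauli_leaf_def by (subst amp_sig_id) (auto simp: bl_def)
  qed
  then show ?thesis by simp
qed

lemma strat_rows:
  assumes "row_state e n (length \<alpha>s) \<chi> w"
    and "\<And>x. x \<in> bl n \<Longrightarrow> path_sign n ((!) x) * fold (step n) \<alpha>s \<chi> x = c * \<phi> x"
  shows "strat (pauli_leaf n \<phi>) ((Suc e + n) * length \<alpha>s + Suc e) w (\<lambda>_. 0)"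
  using assms
proof (induction \<alpha>s arbitrary: \<chi> w)
  case Nil
  then show ?case using strat_last_row[of e n \<chi> w c \<phi>] by simp
next
  case (Cons \<alpha> \<alpha>s)
  from Cons.prems have "strat (pauli_leaf n \<phi>) (Suc e + n + ((Suc e + n) * length \<alpha>s + Suc e)) w (\<lambda>_. 0)"
    by (intro strat_step[where r = "length \<alpha>s" and \<chi> = \<chi> and \<alpha> = \<alpha>] Cons.IH) auto
  moreover have "(Suc e + n) * length (\<alpha> # \<alpha>s) + Suc e = Suc e + n + ((Suc e + n) * length \<alpha>s + Suc e)"
    by (simp add: algebra_simps)
  ultimately show ?case by (simp only:)
qed

lemma strat_resets:
  assumes "row_state e n (p + r) (\<lambda>_. 1) w"
    and "\<And>w. row_state e n r (\<lambda>_. 1) w \<Longrightarrow> strat P j w (\<lambda>_. 0)"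
  shows "strat P ((Suc e + n) * p + j) w (\<lambda>_. 0)"
  using assms(1)
proof (induction p arbitrary: w)
  case (Suc p)
  then have "strat P (Suc e + n + ((Suc e + n) * p + j)) w (\<lambda>_. 0)"
    by (intro strat_reset[where r = "p + r" and \<chi> = "\<lambda>_. 1"]) auto
  then show ?case by (simp only: mult_Suc_right add.assoc)
qed (use assms(2) in simp)

theorem strat_cluster:
  assumes out: "\<And>x. x \<in> bl n \<Longrightarrow> path_sign n ((!) x) * fold (step n) \<alpha>s (\<lambda>_. 1) x = c * \<phi> x"
  shows "\<exists>d\<ge>1. n \<le> d * d \<and> (\<forall>\<psi>. is_cluster d \<psi> \<longrightarrow> strat (pauli_leaf n \<phi>) (d * d - n) \<psi> (\<lambda>_. 0))"
proof (intro exI[of _ "Suc (length \<alpha>s) + n"] conjI allI impI)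
  \<comment> \<open>The side is chosen so that the square is used up exactly: \<open>n\<close> reset
    rows, one row per angle vector and the output row, against \<open>Suc ?e\<close> removed columns
    and \<open>n\<close> wires.\<close>
  let ?e = "length \<alpha>s"
  let ?d = "Suc ?e + n"
  show "1 \<le> ?d" "n \<le> ?d * ?d" by auto
  fix \<psi> assume c: "is_cluster ?d \<psi>"
  have "\<psi> (z @ x @ y) = \<psi> (replicate (?d * ?d) False) * pauli_op n (\<lambda>_. False) (\<lambda>_. False) (\<lambda>_. 1) x * grid_sign ?d (Suc (n + ?e)) (z @ x @ y)"
    if "z \<in> bl (Suc ?e)" "x \<in> bl n" "y \<in> bl (?d * (n + ?e))" for z x y
  proof -
    have "z @ x @ y \<in> bl (?d * ?d)" using that by (simp add: bl_def algebra_simps)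
    from cluster_eq_grid_sign[OF c this] show ?thesis
      using that(2) by (simp add: pauli_op_id add.commute[of n])
  qed
  then have "row_state ?e n (n + length \<alpha>s) (\<lambda>_. 1) \<psi>"
    unfolding row_state_def by (intro exI[of _ "\<lambda>_. \<psi> (replicate (?d * ?d) False)"] exI[of _ "\<lambda>_. False"]) blast
  then have "strat (pauli_leaf n \<phi>) (?d * n + (?d * ?e + Suc ?e)) \<psi> (\<lambda>_. 0)"
    by (rule strat_resets) (rule strat_rows[OF _ out])
  moreover have "?d * n + (?d * ?e + Suc ?e) = ?d * ?d - n" by (simp add: algebra_simps)
  ultimately show "strat (pauli_leaf n \<phi>) (?d * ?d - n) \<psi> (\<lambda>_. 0)" by (simp only:)
qed


section \<open>Exact universality of the row operations\<close>

lemma sum_bl_prod: "(\<Sum>x\<in>bl n. \<Prod>k<n. f k (x ! k)) = (\<Prod>k<n. \<Sum>b\<in>UNIV. f k b)" for f :: "nat \<Rightarrow> bool \<Rightarrow> complex"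
proof (induction n arbitrary: f)
  case (Suc n)
  show ?case unfolding sum_bl_Suc prod.lessThan_Suc_shift
    by (simp add: Suc.IH[of "\<lambda>k. f (Suc k)"] sum_distrib_right flip: sum_distrib_left)
qed simp

lemma walsh_orthogonality:
  assumes "x \<in> bl n" "y \<in> bl n"
  shows "(\<Sum>s\<in>bl n. dot n ((!) s) ((!) x) * dot n ((!) s) ((!) y)) = (if x = y then 2 ^ n else 0)"
proof -
  have "(\<Sum>s\<in>bl n. dot n ((!) s) ((!) x) * dot n ((!) s) ((!) y)) =
     (\<Sum>s\<in>bl n. \<Prod>k<n. sg (s ! k \<and> (x ! k \<noteq> y ! k)))"
    unfolding dot_xor_right[symmetric] unfolding dot_def ..
  also have "\<dots> = (\<Prod>k<n. if x ! k = y ! k then 2 else 0)"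
    unfolding sum_bl_prod[where n = n and f = "\<lambda>k b. sg (b \<and> (x ! k \<noteq> y ! k))"] by (intro prod.cong) (auto simp: UNIV_bool sg_def)
  also have "\<dots> = (if x = y then 2 ^ n else 0)"
  proof (cases "x = y")
    case False
    then have "\<exists>k<n. x ! k \<noteq> y ! k" using assms by (auto simp: bl_def list_eq_iff_nth_eq)
    then show ?thesis using False by auto
  qed simp
  finally show ?thesis .
qed

lemma walsh_expansion:
  assumes "x \<in> bl n"
  shows "(\<Sum>s\<in>bl n. dot n ((!) s) ((!) x) * (\<Sum>y\<in>bl n. dot n ((!) s) ((!) y) * f y)) = 2 ^ n * f x"
proof -
  have "(\<Sum>s\<in>bl n. dot n ((!) s) ((!) x) * (\<Sum>y\<in>bl n. dot n ((!) s) ((!) y) * f y)) =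
     (\<Sum>y\<in>bl n. (\<Sum>s\<in>bl n. dot n ((!) s) ((!) x) * dot n ((!) s) ((!) y)) * f y)"
    unfolding sum_distrib_left sum_distrib_right by (subst sum.swap) (simp only: mult.assoc)
  also have "\<dots> = (\<Sum>y\<in>bl n. if x = y then 2 ^ n * f y else 0)"
    using assms by (intro sum.cong) (auto simp: walsh_orthogonality)
  finally show ?thesis using assms by simp
qed

lemma had_had: "x \<in> bl n \<Longrightarrow> had n (had n \<chi>) x = 2 ^ n * \<chi> x"
  unfolding had_def walsh_expansion[symmetric]
  by (intro sum.cong refl arg_cong2[of _ _ _ _ "(*)"] dot_commute)

section \<open>The Clifford map and its finite order up to a scalar\<close>

definition clifford :: "nat \<Rightarrow> qstate \<Rightarrow> qstate" where
  "clifford n = step n (\<lambda>_. 0)"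

lemma clifford_eq: "clifford n \<chi> = had n (\<lambda>x. path_sign n ((!) x) * \<chi> x)"
  by (simp add: clifford_def step_def dphase_def cong: if_cong)

lemma step_eq_clifford: "step n \<alpha> \<chi> = clifford n (\<lambda>x. dphase n \<alpha> x * \<chi> x)"
  unfolding clifford_eq step_def by (simp only: mult_ac)

lemma clifford_cong: "(\<And>x. x \<in> bl n \<Longrightarrow> \<chi> x = \<chi>' x) \<Longrightarrow> clifford n \<chi> = clifford n \<chi>'"
  unfolding clifford_eq by (rule had_cong) simp

lemma clifford_sum: "clifford n (\<lambda>x. \<Sum>i\<in>I. c i * f i x) = (\<lambda>x. \<Sum>i\<in>I. c i * clifford n (f i) x)"
  unfolding clifford_eq had_def
  unfolding sum_distrib_left by (rule ext, subst sum.swap) (simp only: mult_ac)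

lemma clifford_scale: "clifford n (\<lambda>x. c * f x) = (\<lambda>x. c * clifford n f x)"
  unfolding clifford_eq had_def by (simp add: fun_eq_iff sum_distrib_left mult_ac)

lemma clifford_add: "clifford n (\<lambda>x. f x + g x) = (\<lambda>x. clifford n f x + clifford n g x)"
  unfolding clifford_eq had_def by (simp add: fun_eq_iff distrib_left sum.distrib)

lemma clifford_zero_imp:
  assumes "\<And>x. x \<in> bl n \<Longrightarrow> clifford n \<chi> x = 0" "x \<in> bl n"
  shows "\<chi> x = 0"
proof -
  have "had n (clifford n \<chi>) x = 0" using assms(1) by (simp add: had_def)
  then show ?thesis using assms(2) by (simp add: clifford_eq had_had)
qed

definition clifford_sign :: "nat \<Rightarrow> (nat \<Rightarrow> bool) \<Rightarrow> (nat \<Rightarrow> bool) \<Rightarrow> complex" where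
  "clifford_sign n a b = path_sign n a * dot n a (\<lambda>k. b k \<noteq> path_nbrs n a k)"

text \<open>Each edge inside \<open>a\<close> is counted from both ends; formally, polarise the
  quadratic form at \<open>a\<close> with itself.\<close>

lemma dot_path_nbrs_self: "dot n (path_nbrs n a) a = 1"
proof -
  have "path_sign n (\<lambda>k. a k \<noteq> a k) = 1" by (simp add: path_sign_def)
  then show ?thesis unfolding path_sign_xor by simp
qed

lemma clifford_sign_square [simp]: "clifford_sign n a b * clifford_sign n a b = 1"
proof -
  have "clifford_sign n a b * clifford_sign n a b =
    (path_sign n a * path_sign n a) * (dot n a (\<lambda>k. b k \<noteq> path_nbrs n a k) * dot n a (\<lambda>k. b k \<noteq> path_nbrs n a k))"
    unfolding clifford_sign_def by (simp only: mult_ac)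
  then show ?thesis by simp
qed

lemma clifford_sign_cases: "clifford_sign n a b = 1 \<or> clifford_sign n a b = -1"
  using clifford_sign_square[of n a b] by (metis square_eq_1_iff)

lemma clifford_pauli_op: "clifford n (pauli_op n a b \<chi>) = (\<lambda>x. clifford_sign n a b * pauli_op n (\<lambda>k. b k \<noteq> path_nbrs n a k) a (clifford n \<chi>) x)"
proof
  fix x
  have "clifford n (pauli_op n a b \<chi>) = had n (\<lambda>x. path_sign n a * pauli_op n a (\<lambda>k. b k \<noteq> path_nbrs n a k) (\<lambda>x. path_sign n ((!) x) * \<chi> x) x)"
    unfolding clifford_eq by (rule had_cong) (simp only: path_sign_pauli_op dot_path_nbrs_self mult_1_right)
  then show "clifford n (pauli_op n a b \<chi>) x = clifford_sign n a b * pauli_op n (\<lambda>k. b k \<noteq> path_nbrs n a k) a (clifford n \<chi>) x"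
    unfolding clifford_sign_def clifford_eq[of n \<chi>] by (simp only: had_scale had_pauli_op mult.assoc)
qed

text \<open>Each orbit repeats by the pigeonhole principle, injectivity moves the repetition back to
  its start, and the product of all periods serves every element.\<close>

lemma finite_injective_order:
  assumes Q: "finite Q" and inj: "inj_on F Q" and F: "F ` Q \<subseteq> Q"
  shows "\<exists>p>0. \<forall>q\<in>Q. (F ^^ p) q = q"
proof -
  have in_Q: "(F ^^ k) q \<in> Q" if "q \<in> Q" for k q
    using that F by (induction k) auto
  have cancel: "q = (F ^^ k) q" if "(F ^^ i) q = (F ^^ (i + k)) q" "q \<in> Q" for i k q
    using that(1)
  proof (induction i)
    case (Suc i)
    then have "F ((F ^^ i) q) = F ((F ^^ (i + k)) q)" by simp
    then show ?case using inj_onD[OF inj] in_Q[OF that(2)] Suc.IH by blast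
  qed simp
  have "\<exists>k>0. (F ^^ k) q = q" if q: "q \<in> Q" for q
  proof -
    have "\<not> inj_on (\<lambda>k. (F ^^ k) q) UNIV"
    proof
      assume "inj_on (\<lambda>k. (F ^^ k) q) UNIV"
      moreover have "finite (range (\<lambda>k. (F ^^ k) q))"
        using Q in_Q[OF q] by (auto intro: finite_subset)
      ultimately show False using finite_imageD by fastforce
    qed
    then obtain i j where "i < j" "(F ^^ i) q = (F ^^ j) q"
      by (auto simp: inj_on_def) (metis linorder_neqE_nat)
    then show ?thesis using cancel[of i q "j - i"] q by (intro exI[of _ "j - i"]) auto
  qed
  then obtain t where t: "\<And>q. q \<in> Q \<Longrightarrow> 0 < t q \<and> (F ^^ t q) q = q" by metis
  have "(F ^^ prod t Q) q = q" if q: "q \<in> Q" for q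
  proof -
    have "prod t Q = t q * prod t (Q - {q})" using Q q by (rule prod.remove)
    moreover have "(F ^^ (t q * k)) q = q" for k
    proof (induction k)
      case (Suc k)
      then show ?case using t[OF q] by (simp add: funpow_add)
    qed simp
    ultimately show ?thesis by simp
  qed
  moreover have "0 < prod t Q" using t by (simp add: prod_pos)
  ultimately show ?thesis by blast
qed

text \<open>The label \<open>(s, a, b)\<close> stands for the Pauli operator \<open>s Z\<^sup>bX\<^sup>a\<close>.\<close>

definition labels :: "nat \<Rightarrow> (complex \<times> (nat \<Rightarrow> bool) \<times> (nat \<Rightarrow> bool)) set" where
  "labels n = {1, -1} \<times> {f. \<forall>k\<ge>n. \<not> f k} \<times> {f. \<forall>k\<ge>n. \<not> f k}"

definition label_op :: "nat \<Rightarrow> complex \<times> (nat \<Rightarrow> bool) \<times> (nat \<Rightarrow> bool) \<Rightarrow> qstate \<Rightarrow> qstate" where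
  "label_op n q \<chi> x = fst q * pauli_op n (fst (snd q)) (snd (snd q)) \<chi> x"

text \<open>Conjugation by \<open>C\<close> on labels. Cutting off at \<open>n\<close> keeps the
  labels canonical, so that they form a finite set on which the map is injective.\<close>

definition clifford_label :: "nat \<Rightarrow> complex \<times> (nat \<Rightarrow> bool) \<times> (nat \<Rightarrow> bool) \<Rightarrow> complex \<times> (nat \<Rightarrow> bool) \<times> (nat \<Rightarrow> bool)" where
  "clifford_label n q = (case q of (s, a, b) \<Rightarrow> (s * clifford_sign n a b, (\<lambda>k. k < n \<and> (b k \<noteq> path_nbrs n a k)), a))"

lemma finite_labels: "finite (labels n)"
proof -
  have "{f :: nat \<Rightarrow> bool. \<forall>k\<ge>n. \<not> f k} \<subseteq> (\<lambda>S k. k \<in> S) ` Pow {..<n}"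
  proof
    fix f :: "nat \<Rightarrow> bool" assume "f \<in> {f. \<forall>k\<ge>n. \<not> f k}"
    then have "f = (\<lambda>k. k \<in> Collect f)" "Collect f \<in> Pow {..<n}"
      by (auto simp: not_le[symmetric])
    then show "f \<in> (\<lambda>S k. k \<in> S) ` Pow {..<n}" by blast
  qed
  then have "finite {f :: nat \<Rightarrow> bool. \<forall>k\<ge>n. \<not> f k}"
    by (rule finite_subset) simp
  then show ?thesis by (simp add: labels_def)
qed

lemma clifford_label_in: "clifford_label n ` labels n \<subseteq> labels n"
  using clifford_sign_cases by (force simp: labels_def clifford_label_def)

lemma inj_clifford_label: "inj_on (clifford_label n) (labels n)"
proof (rule inj_onI)
  fix q q' assume q: "q \<in> labels n" "q' \<in> labels n" and eq: "clifford_label n q = clifford_label n q'"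
  obtain s a b s' a' b' where Q: "q = (s, a, b)" "q' = (s', a', b')" by (cases q, cases q') auto
  from eq have a: "a' = a" by (simp add: Q clifford_label_def)
  have "b k = b' k" for k
  proof (cases "k < n")
    case True
    then show ?thesis using eq fun_cong[of "\<lambda>k. k < n \<and> (b k \<noteq> path_nbrs n a k)" "\<lambda>k. k < n \<and> (b' k \<noteq> path_nbrs n a k)" k]
      by (auto simp: Q clifford_label_def a)
  next
    case False
    then show ?thesis using q by (auto simp: Q labels_def)
  qed
  then have b: "b' = b" by auto
  have "s * clifford_sign n a b = s' * clifford_sign n a b" using eq by (simp add: Q clifford_label_def a b)
  then show "q = q'" using clifford_sign_cases[of n a b] by (auto simp: Q a b)
qed

lemma clifford_label_op: "clifford n (label_op n q \<chi>) = label_op n (clifford_label n q) (clifford n \<chi>)"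
proof -
  obtain s a b where q: "q = (s, a, b)" by (cases q) auto
  have "pauli_op n (\<lambda>k. k < n \<and> (b k \<noteq> path_nbrs n a k)) a (clifford n \<chi>) x = pauli_op n (\<lambda>k. b k \<noteq> path_nbrs n a k) a (clifford n \<chi>) x" for x
    by (rule pauli_op_cong) auto
  then show ?thesis
    unfolding q clifford_label_def label_op_def[abs_def] fst_conv snd_conv prod.case clifford_scale clifford_pauli_op
    by (simp only: mult.assoc)
qed

lemma clifford_pow_label_op: "(clifford n ^^ p) (label_op n q \<chi>) = label_op n ((clifford_label n ^^ p) q) ((clifford n ^^ p) \<chi>)"
  by (induction p) (simp_all add: clifford_label_op)

lemma clifford_pow_sum: "(clifford n ^^ p) (\<lambda>x. \<Sum>i\<in>I. c i * f i x) = (\<lambda>x. \<Sum>i\<in>I. c i * (clifford n ^^ p) (f i) x)"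
  by (induction p) (simp_all add: clifford_sum)

lemma clifford_pow_cong: 
  assumes "0 < p" "\<And>x. x \<in> bl n \<Longrightarrow> \<chi> x = \<chi>' x" 
  shows "(clifford n ^^ p) \<chi> = (clifford n ^^ p) \<chi>'"
proof -
  obtain k where "p = Suc k" using assms(1) by (cases p) auto
  then show ?thesis using clifford_cong[of n \<chi> \<chi>'] assms(2) by (simp only: funpow_Suc_right o_apply)
qed

lemma clifford_pow_zero_imp:
  "(\<And>x. x \<in> bl n \<Longrightarrow> (clifford n ^^ p) \<chi> x = 0) \<Longrightarrow> x \<in> bl n \<Longrightarrow> \<chi> x = 0"
proof (induction p arbitrary: \<chi> x)
  case (Suc p)
  have "clifford n \<chi> y = 0" if "y \<in> bl n" for y
    using Suc.IH[of "clifford n \<chi>"] Suc.prems(1) that by (simp only: funpow_Suc_right o_apply)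
  then show ?case using clifford_zero_imp Suc.prems(2) by blast
qed simp

text \<open>The power \<open>D\<close> fixes every label including its sign, so it commutes with all
  Pauli operators. These act irreducibly, hence \<open>D\<close> is a scalar; it is not zero because
  \<open>C\<close> is injective. \<open>Suc p\<close> makes \<open>p\<close> further applications of
  \<open>C\<close> an inverse up to a factor.\<close>

lemma clifford_order: "\<exists>p c. c \<noteq> 0 \<and> (\<forall>\<chi>. \<forall>x\<in>bl n. (clifford n ^^ Suc p) \<chi> x = c * \<chi> x)"
proof -
  obtain p where p: "0 < p" and fix_label: "\<And>q. q \<in> labels n \<Longrightarrow> (clifford_label n ^^ p) q = q"
    using finite_injective_order[OF finite_labels inj_clifford_label clifford_label_in] by blast
  define D where "D = clifford n ^^ p"
  define \<delta> where "\<delta> y x = (if x = y then 1 else 0 :: complex)" for y x :: "bool list"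
  define o0 where "o0 = replicate n False"
  have o0: "o0 \<in> bl n" by (simp add: o0_def bl_def)
  have comm: "D (pauli_op n a b \<chi>) x = pauli_op n a b (D \<chi>) x" for a b \<chi> x
  proof -
    let ?a = "\<lambda>k. k < n \<and> a k" and ?b = "\<lambda>k. k < n \<and> b k"
    have q: "(1, ?a, ?b) \<in> labels n" by (simp add: labels_def)
    have "pauli_op n a b \<chi> = label_op n (1, ?a, ?b) \<chi>" for \<chi>
      unfolding label_op_def fst_conv snd_conv mult_1_left
      by (rule ext, rule pauli_op_cong) auto
    then show ?thesis unfolding D_def by (simp add: clifford_pow_label_op fix_label[OF q])
  qed
  have D_cong: "D \<chi> = D \<chi>'" if "\<And>x. x \<in> bl n \<Longrightarrow> \<chi> x = \<chi>' x" for \<chi> \<chi>'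
    unfolding D_def using p that by (rule clifford_pow_cong)
  define c where "c = D (\<delta> o0) o0"
  have D0: "D (\<delta> o0) x = c * \<delta> o0 x" if x: "x \<in> bl n" for x
  proof (cases "x = o0")
    case False
    \<comment> \<open>Z on a wire where \<open>x\<close> is set fixes \<open>\<delta> o0\<close> but
      negates the amplitude at \<open>x\<close>; commuting with it, \<open>D\<close> must give zero
      there.\<close>
    then obtain j where j: "j < n" "x ! j"
      using length_bl[OF x] by (auto simp: o0_def list_eq_iff_nth_eq)
    have "D (\<delta> o0) = D (pauli_op n (\<lambda>_. False) (\<lambda>k. k = j \<and> True) (\<delta> o0))"
    proof (rule D_cong)
      fix y assume y: "y \<in> bl n"
      have "dot n (\<lambda>k. k = j \<and> True) ((!) o0) = dot n (\<lambda>k. k = j \<and> True) (\<lambda>_. False)"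
        by (rule dot_cong) (auto simp: o0_def)
      then show "\<delta> o0 y = pauli_op n (\<lambda>_. False) (\<lambda>k. k = j \<and> True) (\<delta> o0) y"
        using y by (auto simp: pauli_op_def \<delta>_def xor_bits_id)
    qed
    then have "D (\<delta> o0) x = dot n (\<lambda>k. k = j \<and> True) ((!) x) * D (\<delta> o0) x"
      using comm[of "\<lambda>_. False" "\<lambda>k. k = j \<and> True" "\<delta> o0" x] x by (simp add: pauli_op_def xor_bits_id)
    moreover have "dot n (\<lambda>k. k = j \<and> True) ((!) x) = -1"
    proof -
      have "dot n (\<lambda>k. k = j \<and> True) ((!) x) = (\<Prod>k<n. if k = j then -1 else 1)"
        unfolding dot_def using j by (intro prod.cong) auto
      then show ?thesis using j by simp
    qed
    ultimately show ?thesis using False by (simp add: \<delta>_def)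
  qed (simp add: c_def \<delta>_def)
  have Dy: "D (\<delta> y) x = c * \<delta> y x" if x: "x \<in> bl n" and y: "y \<in> bl n" for x y
  proof -
    have xor_bits: "xor_bits n ((!) y) z = o0 \<longleftrightarrow> z = y" if "z \<in> bl n" for z
      using that y by (auto simp: xor_bits_def o0_def bl_def list_eq_iff_nth_eq)
    \<comment> \<open>X^y carries \<open>o0\<close> to \<open>y\<close>, so the factor
      \<open>c\<close> is the same for all basis states.\<close>
    have "D (\<delta> y) = D (pauli_op n ((!) y) (\<lambda>_. False) (\<delta> o0))"
      by (rule D_cong) (simp add: pauli_op_def \<delta>_def xor_bits)
    then show ?thesis using x by (simp add: comm pauli_op_def D0) (simp add: \<delta>_def xor_bits)
  qed
  have D: "D \<chi> x = c * \<chi> x" if x: "x \<in> bl n" for \<chi> x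
  proof -
    have "D \<chi> x = D (\<lambda>x. \<Sum>y\<in>bl n. \<chi> y * \<delta> y x) x"
      by (rule fun_cong[OF D_cong]) (simp add: \<delta>_def if_distrib cong: if_cong)
    also have "\<dots> = (\<Sum>y\<in>bl n. \<chi> y * (c * \<delta> y x))"
      unfolding D_def clifford_pow_sum using Dy[OF x] by (simp add: D_def)
    also have "\<dots> = c * \<chi> x" using x by (simp add: \<delta>_def if_distrib cong: if_cong)
    finally show ?thesis .
  qed
  have "c \<noteq> 0"
  proof
    assume "c = 0"
    then have "\<delta> o0 o0 = 0" using D o0 by (intro clifford_pow_zero_imp[of n p "\<delta> o0" o0]) (auto simp: D_def)
    then show False by (simp add: \<delta>_def)
  qed
  moreover obtain p' where "p = Suc p'" using p by (cases p) auto
  ultimately show ?thesis using D unfolding D_def by blast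
qed

text \<open>The scalar absorbs global phases, unnormalised Hadamard gates and the powers of
  \<open>C\<close>. That it is not zero is settled at the end, for normalised targets.\<close>

definition reach :: "nat \<Rightarrow> qstate \<Rightarrow> bool" where
  "reach n \<chi> \<longleftrightarrow> (\<exists>\<alpha>s c. \<forall>x\<in>bl n. \<chi> x = c * fold (step n) \<alpha>s (\<lambda>_. 1) x)"

lemma reach_scale:
  assumes "reach n \<chi>" "\<And>x. x \<in> bl n \<Longrightarrow> \<chi>' x = c * \<chi> x" shows "reach n \<chi>'"
proof -
  obtain \<alpha>s c' where "\<forall>x\<in>bl n. \<chi> x = c' * fold (step n) \<alpha>s (\<lambda>_. 1) x"
    using assms(1) by (auto simp: reach_def)
  then have "\<forall>x\<in>bl n. \<chi>' x = (c * c') * fold (step n) \<alpha>s (\<lambda>_. 1) x"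
    using assms(2) by simp
  then show ?thesis unfolding reach_def by blast
qed

lemma reach_cong: "reach n \<chi> \<Longrightarrow> (\<And>x. x \<in> bl n \<Longrightarrow> \<chi>' x = \<chi> x) \<Longrightarrow> reach n \<chi>'"
  using reach_scale[of n \<chi> \<chi>' 1] by simp

lemma reach_one: "reach n (\<lambda>_. 1)"
  unfolding reach_def by (intro exI[of _ "[]"] exI[of _ 1]) simp

lemma reach_step:
  assumes "reach n \<chi>" shows "reach n (step n \<alpha> \<chi>)"
proof -
  obtain \<alpha>s c where \<chi>: "\<forall>x\<in>bl n. \<chi> x = c * fold (step n) \<alpha>s (\<lambda>_. 1) x"
    using assms by (auto simp: reach_def)
  define F where "F = fold (step n) \<alpha>s (\<lambda>_. 1)"
  have "step n \<alpha> \<chi> = clifford n (\<lambda>x. c * (dphase n \<alpha> x * F x))"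
    unfolding step_eq_clifford[of n \<alpha> \<chi>] using \<chi> by (intro clifford_cong) (simp add: F_def)
  also have "\<dots> = (\<lambda>x. c * fold (step n) (\<alpha>s @ [\<alpha>]) (\<lambda>_. 1) x)"
    unfolding clifford_scale by (simp add: F_def step_eq_clifford[of n \<alpha> "fold _ _ _"])
  finally show ?thesis unfolding reach_def by (intro exI[of _ "\<alpha>s @ [\<alpha>]"] exI[of _ c]) simp
qed

lemma reach_clifford: "reach n \<chi> \<Longrightarrow> reach n (clifford n \<chi>)"
  unfolding clifford_def by (rule reach_step)

lemma reach_clifford_inverse:
  assumes "reach n (clifford n \<chi>)" shows "reach n \<chi>"
proof -
  obtain p c where c: "c \<noteq> 0" and p: "\<And>\<chi> x. x \<in> bl n \<Longrightarrow> (clifford n ^^ Suc p) \<chi> x = c * \<chi> x"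
    using clifford_order[of n] by blast
  have "reach n ((clifford n ^^ k) (clifford n \<chi>))" for k
    using assms by (induction k) (auto intro: reach_clifford)
  then have "reach n ((clifford n ^^ Suc p) \<chi>)" by (simp only: funpow_Suc_right o_apply)
  then show ?thesis by (rule reach_scale[where c = "inverse c"]) (simp add: p c del: funpow.simps)
qed

lemma ex_clifford_preimage: "\<exists>\<chi>' c. c \<noteq> 0 \<and> (\<forall>x\<in>bl n. clifford n \<chi>' x = c * \<chi> x)"
  using clifford_order[of n] by (metis funpow.simps(2) o_apply)

text \<open>A step is these phases followed by \<open>C\<close>, and \<open>C\<close> can be
  undone.\<close>

lemma reach_dphase: "reach n \<chi> \<Longrightarrow> reach n (\<lambda>x. dphase n \<alpha> x * \<chi> x)"
  using reach_step[of n \<chi> \<alpha>] unfolding step_eq_clifford by (rule reach_clifford_inverse)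

section \<open>Rotations generated by Pauli operators\<close>

definition rot :: "nat \<Rightarrow> complex \<Rightarrow> (nat \<Rightarrow> bool) \<Rightarrow> (nat \<Rightarrow> bool) \<Rightarrow> real \<Rightarrow> qstate \<Rightarrow> qstate" where
  "rot n \<mu> a b \<theta> \<chi> x = of_real (cos \<theta>) * \<chi> x + of_real (sin \<theta>) * \<mu> * pauli_op n a b \<chi> x"

text \<open>The side condition says that the operator \<open>\<mu> Z\<^sup>bX\<^sup>a\<close> squares to \<open>-1\<close>, so that \<open>rot\<close> is
its exponential.\<close>

definition gen :: "nat \<Rightarrow> (nat \<Rightarrow> bool) \<Rightarrow> (nat \<Rightarrow> bool) \<Rightarrow> bool" where
  "gen n a b \<longleftrightarrow> (\<forall>\<mu> \<theta> \<chi>. \<mu> * \<mu> * dot n a b = -1 \<longrightarrow> reach n \<chi> \<longrightarrow> reach n (rot n \<mu> a b \<theta> \<chi>))"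

lemma gen_cong:
  assumes "gen n a b" "\<And>k. k < n \<Longrightarrow> a' k = a k" "\<And>k. k < n \<Longrightarrow> b' k = b k" shows "gen n a' b'"
proof -
  have "dot n a' b' = dot n a b" using assms by (intro dot_cong) auto
  moreover have "pauli_op n a' b' \<chi> = pauli_op n a b \<chi>" for \<chi>
    using assms by (intro ext pauli_op_cong) auto
  then have "rot n \<mu> a' b' \<theta> \<chi> = rot n \<mu> a b \<theta> \<chi>" for \<mu> \<theta> \<chi>
    by (simp add: rot_def[abs_def])
  ultimately show ?thesis using assms(1) by (simp add: gen_def)
qed

lemma gen_Z:
  assumes "j < n" shows "gen n (\<lambda>_. False) (\<lambda>k. k = j)"
  unfolding gen_def
proof (intro allI impI)
  fix \<mu> \<theta> \<chi> assume "\<mu> * \<mu> * dot n (\<lambda>_. False) (\<lambda>k. k = j) = -1" and r: "reach n \<chi>"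
  then have "(\<mu> - \<i>) * (\<mu> + \<i>) = 0" by (simp add: algebra_simps)
  then have "\<mu> = \<i> \<or> \<mu> = - \<i>" by (metis eq_iff_diff_eq_0 eq_neg_iff_add_eq_0 mult_eq_0_iff)
  then have "\<mu> = \<i> * of_real 1 \<or> \<mu> = \<i> * of_real (- 1)" by simp
  \<comment> \<open>The rotation multiplies the two basis states by
    \<open>cis (\<epsilon> * \<theta>)\<close> and its conjugate. Their ratio is the angle
    \<open>- 2 * \<epsilon> * \<theta>\<close> below; the common factor is a scalar.\<close>
  then obtain \<epsilon> :: real where \<mu>: "\<mu> = \<i> * of_real \<epsilon>" and \<epsilon>: "\<epsilon> = 1 \<or> \<epsilon> = -1"
    by blast
  have "reach n (\<lambda>x. dphase n (\<lambda>k. if k = j then - 2 * \<epsilon> * \<theta> else 0) x * \<chi> x)"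
    using r by (rule reach_dphase)
  then show "reach n (rot n \<mu> (\<lambda>_. False) (\<lambda>k. k = j) \<theta> \<chi>)"
  proof (rule reach_scale)
    fix x assume x: "x \<in> bl n"
    have d: "dphase n (\<lambda>k. if k = j then - 2 * \<epsilon> * \<theta> else 0) x = (if x ! j then cis (- 2 * \<epsilon> * \<theta>) else 1)"
    proof -
      have "dphase n (\<lambda>k. if k = j then - 2 * \<epsilon> * \<theta> else 0) x =
        (\<Prod>k<n. if k = j then (if x ! j then cis (- 2 * \<epsilon> * \<theta>) else 1) else 1)"
        unfolding dphase_def by (intro prod.cong) auto
      then show ?thesis using assms by simp
    qed
    have e: "dot n (\<lambda>k. k = j) ((!) x) = sg (x ! j)"
    proof -
      have "dot n (\<lambda>k. k = j) ((!) x) = (\<Prod>k<n. if k = j then sg (x ! j) else 1)"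
        unfolding dot_def by (intro prod.cong) auto
      then show ?thesis using assms by simp
    qed
    have c: "complex_of_real (cos \<theta>) + of_real (sin \<theta>) * \<mu> = cis (\<epsilon> * \<theta>)"
      "complex_of_real (cos \<theta>) - of_real (sin \<theta>) * \<mu> = cis (- (\<epsilon> * \<theta>))"
      using \<epsilon> by (auto simp: \<mu> complex_eq_iff)
    have "rot n \<mu> (\<lambda>_. False) (\<lambda>k. k = j) \<theta> \<chi> x =
      (if x ! j then complex_of_real (cos \<theta>) - of_real (sin \<theta>) * \<mu> else complex_of_real (cos \<theta>) + of_real (sin \<theta>) * \<mu>) * \<chi> x"
      using x by (simp add: rot_def pauli_op_def e xor_bits_id algebra_simps)
    also have "\<dots> = cis (\<epsilon> * \<theta>) * ((if x ! j then cis (- 2 * \<epsilon> * \<theta>) else 1) * \<chi> x)"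
      unfolding c by (simp add: cis_mult flip: mult.assoc)
    finally show "rot n \<mu> (\<lambda>_. False) (\<lambda>k. k = j) \<theta> \<chi> x =
      cis (\<epsilon> * \<theta>) * (dphase n (\<lambda>k. if k = j then - 2 * \<epsilon> * \<theta> else 0) x * \<chi> x)"
      unfolding d .
  qed
qed

lemma clifford_rot: "clifford n (rot n \<mu> a b \<theta> \<chi>) = rot n (\<mu> * clifford_sign n a b) (\<lambda>k. b k \<noteq> path_nbrs n a k) a \<theta> (clifford n \<chi>)"
  unfolding rot_def[abs_def] clifford_add clifford_scale clifford_pauli_op by (simp only: mult.assoc)

text \<open>Pull the state back through \<open>C\<close>, rotate, and apply \<open>C\<close> again;
  both directions preserve reachability.\<close>

lemma gen_clifford:
  assumes g: "gen n a b" shows "gen n (\<lambda>k. b k \<noteq> path_nbrs n a k) a"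
  unfolding gen_def
proof (intro allI impI)
  fix \<mu> \<theta> \<chi>
  assume \<mu>: "\<mu> * \<mu> * dot n (\<lambda>k. b k \<noteq> path_nbrs n a k) a = -1" and r: "reach n \<chi>"
  obtain \<chi>' c where c: "c \<noteq> 0" and \<chi>': "\<And>x. x \<in> bl n \<Longrightarrow> clifford n \<chi>' x = c * \<chi> x"
    using ex_clifford_preimage by blast
  define \<nu> where "\<nu> = \<mu> * clifford_sign n a b"
  have "reach n \<chi>'"
    using r \<chi>' by (blast intro: reach_clifford_inverse reach_scale)
  moreover have "\<nu> * \<nu> = \<mu> * \<mu> * (clifford_sign n a b * clifford_sign n a b)"
    unfolding \<nu>_def by (simp only: mult_ac)
  then have "\<nu> * \<nu> * dot n a b = -1"
    using \<mu> unfolding dot_xor_left dot_path_nbrs_self by (simp add: dot_commute)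
  ultimately have "reach n (rot n \<nu> a b \<theta> \<chi>')" using g by (simp add: gen_def)
  then have "reach n (clifford n (rot n \<nu> a b \<theta> \<chi>'))" by (rule reach_clifford)
  moreover have "\<nu> * clifford_sign n a b = \<mu>"
    unfolding \<nu>_def mult.assoc by simp
  ultimately have "reach n (rot n \<mu> (\<lambda>k. b k \<noteq> path_nbrs n a k) a \<theta> (clifford n \<chi>'))"
    unfolding clifford_rot by simp
  then show "reach n (rot n \<mu> (\<lambda>k. b k \<noteq> path_nbrs n a k) a \<theta> \<chi>)"
    by (rule reach_scale[where c = "inverse c"]) (simp add: rot_def pauli_op_def \<chi>' c field_simps)
qed

lemma pauli_op_pauli_op_self: "x \<in> bl n \<Longrightarrow> pauli_op n a b (pauli_op n a b \<chi>) x = dot n a b * \<chi> x"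
  unfolding pauli_op_pauli_op by (simp add: pauli_op_id dot_commute)

lemma pauli_op_uminus: "pauli_op n a b (\<lambda>x. - \<chi> x) x = - pauli_op n a b \<chi> x"
  by (simp add: pauli_op_def)

lemma pauli_op_anticommute:
  assumes "dot n a b' * dot n a' b = -1"
  shows "pauli_op n a b (pauli_op n a' b' \<chi>) = (\<lambda>x. - pauli_op n a' b' (pauli_op n a b \<chi>) x)"
proof
  fix x
  have "(\<lambda>k. a' k \<noteq> a k) = (\<lambda>k. a k \<noteq> a' k)" "(\<lambda>k. b' k \<noteq> b k) = (\<lambda>k. b k \<noteq> b' k)" by auto
  moreover have "dot n b' a = - dot n b a'"
    using assms dot_cases[of n b a'] dot_cases[of n b' a] by (auto simp: dot_commute[of n b'] dot_commute[of n b])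
  ultimately show "pauli_op n a b (pauli_op n a' b' \<chi>) x = - pauli_op n a' b' (pauli_op n a b \<chi>) x"
    unfolding pauli_op_pauli_op by simp
qed

lemma pauli_op_linear: "pauli_op n a b (\<lambda>x. c * f x + d * g x) x = c * pauli_op n a b f x + d * pauli_op n a b g x"
  by (simp add: pauli_op_def algebra_simps)

lemma pauli_op_rot: "pauli_op n a' b' (rot n \<mu> a b \<theta> \<chi>) x =
    of_real (cos \<theta>) * pauli_op n a' b' \<chi> x + of_real (sin \<theta>) * \<mu> * pauli_op n a' b' (pauli_op n a b \<chi>) x"
  by (simp add: pauli_op_def rot_def algebra_simps)

text \<open>If P and Q anticommute and Q squares to -1, then conjugating P by
  \<open>exp (pi/4 Q)\<close> gives \<open>exp (pi/2 Q) P\<close>, which is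
  \<open>Q P\<close>.\<close>

lemma rot_conjugate:
  assumes anti: "dot n a b' * dot n a' b = -1" and \<kappa>: "\<kappa> * \<kappa> * dot n a' b' = -1" and x: "x \<in> bl n"
  shows "rot n \<kappa> a' b' (pi / 4) (rot n \<mu> a b \<theta> (rot n \<kappa> a' b' (- pi / 4) \<chi>)) x =
    rot n (\<kappa> * \<mu> * dot n b a') (\<lambda>k. a k \<noteq> a' k) (\<lambda>k. b k \<noteq> b' k) \<theta> \<chi> x"
proof -
  define u where "u = complex_of_real (cos (pi / 4))"
  have u: "complex_of_real (sin (pi / 4)) = u" "u * u = 1 / 2"
    by (simp_all add: u_def cos_45 sin_45 flip: of_real_mult)
  define p1 where "p1 = pauli_op n a b \<chi> x"
  define p2 where "p2 = pauli_op n a' b' \<chi> x"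
  define p21 where "p21 = pauli_op n a' b' (pauli_op n a b \<chi>) x"
  define d where "d = dot n a' b'"
  have p12: "pauli_op n a b (pauli_op n a' b' \<chi>) x = - p21"
    unfolding pauli_op_anticommute[OF anti] p21_def ..
  have p22: "pauli_op n a' b' (pauli_op n a' b' \<chi>) x = d * \<chi> x"
    unfolding d_def using x by (rule pauli_op_pauli_op_self)
  have p212: "pauli_op n a' b' (pauli_op n a b (pauli_op n a' b' \<chi>)) x = - (d * p1)"
    unfolding pauli_op_anticommute[OF anti] pauli_op_uminus d_def p1_def using x by (simp only: pauli_op_pauli_op_self)
  have pa: "(\<lambda>k. a' k \<noteq> a k) = (\<lambda>k. a k \<noteq> a' k)" "(\<lambda>k. b' k \<noteq> b k) = (\<lambda>k. b k \<noteq> b' k)" by auto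
  have target: "rot n (\<kappa> * \<mu> * dot n b a') (\<lambda>k. a k \<noteq> a' k) (\<lambda>k. b k \<noteq> b' k) \<theta> \<chi> x =
    of_real (cos \<theta>) * \<chi> x + of_real (sin \<theta>) * \<kappa> * \<mu> * p21"
    unfolding rot_def p21_def pauli_op_pauli_op[of n a' b'] pa by (simp only: mult_ac)
  have s: "complex_of_real (sin (- pi / 4)) = - u" "complex_of_real (cos (- pi / 4)) = u"
    using u(1) by (simp_all add: u_def)
  define C S where "C = complex_of_real (cos \<theta>)" and "S = complex_of_real (sin \<theta>)"
  have inner: "pauli_op n a' b' (pauli_op n a b (rot n \<kappa> a' b' (- pi / 4) \<chi>)) x = u * p21 + u * \<kappa> * d * p1"
  proof -
    have "pauli_op n a b (rot n \<kappa> a' b' (- pi / 4) \<chi>) = (\<lambda>x. u * pauli_op n a b \<chi> x + (- u * \<kappa>) * pauli_op n a b (pauli_op n a' b' \<chi>) x)"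
      by (rule ext) (simp only: pauli_op_rot s)
    then show ?thesis by (simp only: pauli_op_linear p212 p21_def[symmetric]) simp
  qed
  have "rot n \<kappa> a' b' (pi / 4) (rot n \<mu> a b \<theta> (rot n \<kappa> a' b' (- pi / 4) \<chi>)) x =
     u * (C * (u * \<chi> x - u * \<kappa> * p2) + S * \<mu> * (u * p1 + u * \<kappa> * p21)) +
     u * \<kappa> * (C * (u * p2 - u * \<kappa> * (d * \<chi> x)) + S * \<mu> * (u * p21 + u * \<kappa> * d * p1))"
    unfolding rot_def[of n \<kappa> a' b' "pi / 4"] pauli_op_rot[of n a' b' \<mu>] inner
    unfolding rot_def[of n \<mu>] pauli_op_rot[of n a b \<kappa>] pauli_op_rot[of n a' b' \<kappa>] rot_def[of n \<kappa>] p12 p22 s u(1)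
    unfolding u_def[symmetric] C_def[symmetric] S_def[symmetric] p1_def[symmetric] p2_def[symmetric]
    by (simp add: algebra_simps)
  also have "\<dots> = (u * u) * (C * \<chi> x * (1 - \<kappa> * \<kappa> * d) + S * \<mu> * p1 * (1 + \<kappa> * \<kappa> * d) + 2 * S * \<mu> * \<kappa> * p21)"
    by (simp add: algebra_simps)
  also have "\<dots> = C * \<chi> x + S * \<kappa> * \<mu> * p21"
    using \<kappa> unfolding d_def[symmetric] u(2) by (simp add: algebra_simps)
  finally show ?thesis unfolding target C_def S_def .
qed

lemma gen_mult:
  assumes g: "gen n a b" and g': "gen n a' b'" and anti: "dot n a b' * dot n a' b = -1"
  shows "gen n (\<lambda>k. a k \<noteq> a' k) (\<lambda>k. b k \<noteq> b' k)"
  unfolding gen_def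
proof (intro allI impI)
  fix \<nu> \<theta> \<chi>
  assume \<nu>: "\<nu> * \<nu> * dot n (\<lambda>k. a k \<noteq> a' k) (\<lambda>k. b k \<noteq> b' k) = -1" and r: "reach n \<chi>"
  \<comment> \<open>Normalises the second operator so that it squares to -1.\<close>
  define \<kappa> where "\<kappa> = (if dot n a' b' = 1 then \<i> else 1)"
  have \<kappa>: "\<kappa> * \<kappa> * dot n a' b' = -1" "\<kappa> \<noteq> 0"
    using dot_cases[of n a' b'] by (auto simp: \<kappa>_def)
  define e where "e = dot n b a'"
  have e: "e * e = 1" by (simp add: e_def)
  \<comment> \<open>Solution of \<open>\<kappa> * \<mu> * e = \<nu>\<close>: the inverse of
    \<open>\<kappa>\<close> is \<open>- \<kappa> * dot n a' b'\<close>, and \<open>e\<close> is its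
    own inverse.\<close>
  define \<mu> where "\<mu> = - (\<nu> * \<kappa> * dot n a' b' * e)"
  have \<mu>: "\<kappa> * \<mu> * e = \<nu>"
  proof -
    have "\<kappa> * \<mu> * e = - (\<nu> * (\<kappa> * \<kappa> * dot n a' b') * (e * e))" by (simp add: \<mu>_def)
    then show ?thesis using \<kappa> e by simp
  qed
  have "\<mu> * \<mu> * dot n a b = -1"
  proof -
    have "dot n (\<lambda>k. a k \<noteq> a' k) (\<lambda>k. b k \<noteq> b' k) =
        dot n a b * dot n a' b' * (dot n a b' * dot n a' b)"
      unfolding dot_xor_left dot_xor_right by (simp only: mult_ac)
    then have "\<nu> * \<nu> * (dot n a b * dot n a' b') = 1" using \<nu> anti by simp
    moreover have "\<mu> * \<mu> * dot n a b = (\<nu> * \<nu> * (dot n a b * dot n a' b')) * (\<kappa> * \<kappa> * dot n a' b') * (e * e)"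
      by (simp add: \<mu>_def)
    ultimately show ?thesis using \<kappa>(1) e by simp
  qed
  then have "reach n (rot n \<kappa> a' b' (pi / 4) (rot n \<mu> a b \<theta> (rot n \<kappa> a' b' (- pi / 4) \<chi>)))"
    using g g' \<kappa>(1) r unfolding gen_def by blast
  then show "reach n (rot n \<nu> (\<lambda>k. a k \<noteq> a' k) (\<lambda>k. b k \<noteq> b' k) \<theta> \<chi>)"
    by (rule reach_cong) (simp only: rot_conjugate[OF anti \<kappa>(1)] \<mu>[unfolded e_def])
qed

text \<open>P is, up to a factor, the product of PQ and Q, and these two anticommute whenever P and
  Q do.\<close>

lemma gen_split:
  assumes "gen n (\<lambda>k. a k \<noteq> a' k) (\<lambda>k. b k \<noteq> b' k)" "gen n a' b'" "dot n a b' * dot n a' b = -1"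
  shows "gen n a b"
proof -
  have "dot n (\<lambda>k. a k \<noteq> a' k) b' * dot n a' (\<lambda>k. b k \<noteq> b' k) =
      (dot n a' b' * dot n a' b') * (dot n a b' * dot n a' b)"
    unfolding dot_xor_left dot_xor_right by (simp only: mult_ac)
  then have "dot n (\<lambda>k. a k \<noteq> a' k) b' * dot n a' (\<lambda>k. b k \<noteq> b' k) = -1"
    using assms(3) by simp
  from gen_mult[OF assms(1,2) this] show ?thesis
    by (rule gen_cong) auto
qed

lemma anticommute_at:
  assumes "j < n" "\<And>k. k < n \<Longrightarrow> k \<noteq> j \<Longrightarrow> (a k \<and> b' k) = (a' k \<and> b k)" "(a j \<and> b' j) \<noteq> (a' j \<and> b j)"
  shows "dot n a b' * dot n a' b = -1"
proof -
  have "dot n a b' * dot n a' b = (\<Prod>k<n. if k = j then -1 else 1)"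
    unfolding dot_def prod.distrib[symmetric] using assms(2,3) by (intro prod.cong) (auto simp: sg_def)
  then show ?thesis using assms(1) by simp
qed

lemma gen_single:
  assumes j: "j < n" and supp: "\<And>k. k < n \<Longrightarrow> (a k \<or> b k) \<longleftrightarrow> k = j"
  shows "gen n a b"
proof -
  have Z: "gen n (\<lambda>_. False) (\<lambda>k. k = j)" using j by (rule gen_Z)
  have "gen n (\<lambda>k. (k = j) \<noteq> path_nbrs n (\<lambda>_. False) k) (\<lambda>_. False)" using Z by (rule gen_clifford)
  then have X: "gen n (\<lambda>k. k = j) (\<lambda>_. False)" by (rule gen_cong) (auto simp: path_nbrs_def)
  have "gen n (\<lambda>k. (k = j) \<noteq> False) (\<lambda>k. False \<noteq> (k = j))"
    using X Z j by (intro gen_mult anticommute_at[of j]) auto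
  then have Y: "gen n (\<lambda>k. k = j) (\<lambda>k. k = j)" by (rule gen_cong) auto
  consider "a j" "b j" | "a j" "\<not> b j" | "\<not> a j" "b j" using supp[OF j] by blast
  then show ?thesis
  proof cases
    case 1
    then show ?thesis by (intro gen_cong[OF Y]) (use supp in auto)
  next
    case 2
    then show ?thesis by (intro gen_cong[OF X]) (use supp in auto)
  next
    case 3
    then show ?thesis by (intro gen_cong[OF Z]) (use supp in auto)
  qed
qed

text \<open>Two different letters among X, Y, Z anticommute and their product is the third one. So a
  one-site generator can replace the letter at \<open>j\<close>.\<close>

lemma gen_change_site:
  assumes g: "gen n a b" and j: "j < n" "a j \<or> b j" "a' j \<or> b' j"
    and eq: "\<And>k. k < n \<Longrightarrow> k \<noteq> j \<Longrightarrow> a' k = a k \<and> b' k = b k"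
  shows "gen n a' b'"
proof (cases "a' j = a j \<and> b' j = b j")
  case True
  then show ?thesis using eq by (intro gen_cong[OF g]) blast+
next
  case False
  let ?a = "\<lambda>k. k = j \<and> a j \<noteq> a' j" and ?b = "\<lambda>k. k = j \<and> b j \<noteq> b' j"
  show ?thesis
  proof (rule gen_split)
    show "gen n ?a ?b" using j(1) False by (intro gen_single[of j]) auto
    show "gen n (\<lambda>k. a' k \<noteq> ?a k) (\<lambda>k. b' k \<noteq> ?b k)"
      using eq by (intro gen_cong[OF g]) (metis (full_types))+
    show "dot n a' ?b * dot n ?a b' = -1"
      using j False by (intro anticommute_at[of j]) auto
  qed
qed

section \<open>From neighbourhoods to arbitrary supports\<close>

definition gen_supp :: "nat \<Rightarrow> nat set \<Rightarrow> bool" where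
  "gen_supp n A \<longleftrightarrow> (\<forall>a b. (\<forall>k<n. (a k \<or> b k) \<longleftrightarrow> k \<in> A) \<longrightarrow> gen n a b)"

text \<open>One generator with a given support suffices, since its letters can be exchanged site by
  site.\<close>

lemma gen_suppI:
  assumes g: "gen n a b" and ab: "\<And>k. k < n \<Longrightarrow> (a k \<or> b k) \<longleftrightarrow> k \<in> A"
  shows "gen_supp n A"
  unfolding gen_supp_def
proof (intro allI impI)
  fix a' b' assume ab': "\<forall>k<n. (a' k \<or> b' k) \<longleftrightarrow> k \<in> A"
  have "gen n (\<lambda>k. if k < m then a' k else a k) (\<lambda>k. if k < m then b' k else b k)" if "m \<le> n" for m
    using that
  proof (induction m)
    case 0
    then show ?case using g by simp
  next
    case (Suc m)
    show ?case
    proof (cases "m \<in> A")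
      case True
      show ?thesis
        by (rule gen_change_site[OF Suc.IH, of m]) (use Suc.prems True ab ab' in \<open>auto simp: less_Suc_eq\<close>)
    next
      case False
      show ?thesis
        by (rule gen_cong[OF Suc.IH]) (use Suc.prems False ab ab' in \<open>auto simp: less_Suc_eq\<close>)
    qed
  qed
  from gen_cong[OF this[of n], of a' b'] show "gen n a' b'" by simp
qed

text \<open>Multiplying by an operator on \<open>{k, l}\<close> whose only anticommuting letter is
  at \<open>k\<close> keeps \<open>k\<close> in the support and switches \<open>l\<close>.\<close>

lemma gen_supp_toggle:
  assumes A: "gen_supp n A" and kl: "gen_supp n {k, l}" and k: "k \<in> A" "k < n" and l: "l < n" "k \<noteq> l"
    and A': "\<And>i. i \<in> A' \<longleftrightarrow> (i \<in> A) \<noteq> (i = l)"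
  shows "gen_supp n A'"
  unfolding gen_supp_def
proof (intro allI impI)
  fix a b assume ab: "\<forall>i<n. (a i \<or> b i) \<longleftrightarrow> i \<in> A'"
  define s where "s = (a k \<and> b k)"
  \<comment> \<open>At \<open>k\<close> the letters X, Y, Z are met by Z, X, X, hence anticommute.
    At \<open>l\<close> the factor copies the target letter to cancel it, or is Y when the target is
    trivial there.\<close>
  define a' where "a' i = (if i = k then s \<or> \<not> a k else i = l \<and> (a l \<or> l \<in> A))" for i
  define b' where "b' i = (if i = k then \<not> s \<and> a k else i = l \<and> (b l \<or> l \<in> A))" for i
  have kA': "a k \<or> b k" using ab k l A' by auto
  have lA': "(a l \<or> b l) \<longleftrightarrow> l \<notin> A" using ab l A' by auto
  show "gen n a b"
  proof (rule gen_split)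
    have "(a' i \<or> b' i) \<longleftrightarrow> i \<in> {k, l}" for i
      using kA' lA' l(2) by (auto simp: a'_def b'_def s_def)
    then show "gen n a' b'" using kl by (simp add: gen_supp_def)
    have "((a i \<noteq> a' i) \<or> (b i \<noteq> b' i)) \<longleftrightarrow> i \<in> A" if "i < n" for i
    proof -
      consider "i = k" | "i = l" | "i \<noteq> k" "i \<noteq> l" by blast
      then show ?thesis
      proof cases
        case 1
        then show ?thesis using kA' k(1) by (auto simp: a'_def b'_def s_def)
      next
        case 2
        then show ?thesis using lA' l(2) by (auto simp: a'_def b'_def)
      next
        case 3
        then show ?thesis using ab that A' by (auto simp: a'_def b'_def)
      qed
    qed
    then show "gen n (\<lambda>i. a i \<noteq> a' i) (\<lambda>i. b i \<noteq> b' i)"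
      by (rule A[unfolded gen_supp_def, rule_format])
    show "dot n a b' * dot n a' b = -1"
      using k(2) kA' lA' l by (intro anticommute_at[of k]) (auto simp: a'_def b'_def s_def)
  qed
qed

lemma gen_supp_neighbourhood:
  assumes "j < n" shows "gen_supp n {k. k < n \<and> (k = j \<or> k = Suc j \<or> Suc k = j)}"
proof -
  have "gen n (\<lambda>k. False \<noteq> path_nbrs n (\<lambda>k. k = j) k) (\<lambda>k. k = j)"
    by (rule gen_clifford) (rule gen_single[OF assms], simp)
  then show ?thesis using assms by (elim gen_suppI) (auto simp: path_nbrs_def)
qed

text \<open>At the end of the path the neighbourhood of a site is already an edge. From there, the
  edge to the left trims the next three-site neighbourhood to the following edge.\<close>

lemma gen_supp_edge: "Suc j < n \<Longrightarrow> gen_supp n {j, Suc j}"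
proof (induction j)
  case 0
  have "{k. k < n \<and> (k = 0 \<or> k = Suc 0 \<or> Suc k = 0)} = {0, Suc 0}" using 0 by auto
  then show ?case using gen_supp_neighbourhood[of 0 n] 0 by simp
next
  case (Suc j)
  have "gen_supp n {Suc j, j}" using Suc by (simp add: insert_commute)
  with gen_supp_neighbourhood[OF Suc.prems[THEN Suc_lessD]] show ?case
    by (rule gen_supp_toggle) (use Suc.prems in auto)
qed

lemma gen_supp_interval: "a \<le> k \<Longrightarrow> k < n \<Longrightarrow> gen_supp n {a..k}"
proof (induction k rule: dec_induct)
  case base
  then show ?case using gen_single[of a n] by (simp add: gen_supp_def)
next
  case (step k)
  then show ?case
    by (intro gen_supp_toggle[of n "{a..k}" k "Suc k" "{a..Suc k}"] gen_supp_edge) auto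
qed

lemma gen_supp_nonempty:
  assumes "A \<subseteq> {..<n}" "A \<noteq> {}"
  shows "gen_supp n A"
proof -
  have fin: "finite A" using assms(1) finite_subset by blast
  define a where "a = Min A"
  have a: "a \<in> A" "\<And>k. k \<in> A \<Longrightarrow> a \<le> k"
    using fin assms by (auto simp: a_def)
  have a3: "a < n" using a(1) assms(1) by auto
  have "gen_supp n ({a..<k} \<union> (A \<inter> {k..}))" if "k \<le> n" "a < k" for k
    using that
  proof (induction k rule: inc_induct)
    case base
    then have "{a..<n} \<union> (A \<inter> {n..}) = {a..n - 1}" using assms(1) a3 by auto
    then show ?case using gen_supp_interval[of a "n - 1" n] a3 by simp
  next
    case (step k)
    show ?case
    proof (cases "k \<in> A")
      case True
      then have "{a..<k} \<union> (A \<inter> {k..}) = {a..<Suc k} \<union> (A \<inter> {Suc k..})"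
        using step.prems by (auto simp: less_Suc_eq Suc_le_eq order.order_iff_strict)
      then show ?thesis using step by simp
    next
      case False
      have edge: "gen_supp n {k - 1, k}" using gen_supp_edge[of "k - 1" n] step by simp
      have IH: "gen_supp n ({a..<Suc k} \<union> (A \<inter> {Suc k..}))" using step by simp
      show ?thesis
        by (rule gen_supp_toggle[OF IH edge])
           (use step False in \<open>auto simp: less_Suc_eq Suc_le_eq order.order_iff_strict\<close>)
    qed
  qed
  from this[of "Suc a"] have "gen_supp n ({a..<Suc a} \<union> (A \<inter> {Suc a..}))" using a3 by simp
  moreover have "{a..<Suc a} \<union> (A \<inter> {Suc a..}) = A"
  proof -
    have "x = a \<or> Suc a \<le> x" if "x \<in> A" for x using a(2)[OF that] by linarith
    then show ?thesis using a(1) by auto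
  qed
  ultimately show ?thesis by simp
qed

lemma gen_all: "gen n a b"
proof (cases "\<exists>k<n. a k \<or> b k")
  case True
  then have "gen_supp n {k. k < n \<and> (a k \<or> b k)}" by (intro gen_supp_nonempty) auto
  then show ?thesis by (simp add: gen_supp_def)
next
  case False
  show ?thesis unfolding gen_def
  proof (intro allI impI)
    fix \<mu> \<theta> \<chi> assume "reach n \<chi>"
    then show "reach n (rot n \<mu> a b \<theta> \<chi>)"
      by (rule reach_scale[where c = "of_real (cos \<theta>) + of_real (sin \<theta>) * \<mu>"])
         (use False in \<open>auto simp: rot_def pauli_op_id algebra_simps\<close>)
  qed
qed

section \<open>Diagonal phases, multiplexed rotations and preparation of all states\<close>

definition rdot :: "nat \<Rightarrow> (nat \<Rightarrow> bool) \<Rightarrow> bool list \<Rightarrow> real" where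
  "rdot n b x = Re (dot n b ((!) x))"

lemma rdot: "complex_of_real (rdot n b x) = dot n b ((!) x)" "rdot n b x = 1 \<or> rdot n b x = -1"
  using dot_cases[of n b "(!) x"] by (auto simp: rdot_def)

lemma real_walsh_expansion: "\<exists>\<theta>. \<forall>x\<in>bl n. f x = (\<Sum>s\<in>bl n. \<theta> s * rdot n ((!) s) x)"
proof (intro exI ballI)
  fix x assume x: "x \<in> bl n"
  define \<theta> where "\<theta> s = (\<Sum>y\<in>bl n. rdot n ((!) s) y * f y) / 2 ^ n" for s
  have "complex_of_real (\<Sum>s\<in>bl n. rdot n ((!) s) x * (\<Sum>y\<in>bl n. rdot n ((!) s) y * f y)) = of_real (2 ^ n * f x)"
    using walsh_expansion[OF x, of "\<lambda>y. of_real (f y)"] by (simp add: rdot(1))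
  then have "(\<Sum>s\<in>bl n. rdot n ((!) s) x * (\<Sum>y\<in>bl n. rdot n ((!) s) y * f y)) = 2 ^ n * f x"
    by (simp only: of_real_eq_iff)
  moreover have "(\<Sum>s\<in>bl n. \<theta> s * rdot n ((!) s) x) =
    (\<Sum>s\<in>bl n. rdot n ((!) s) x * (\<Sum>y\<in>bl n. rdot n ((!) s) y * f y)) / 2 ^ n"
    by (simp only: \<theta>_def divide_inverse sum_distrib_left sum_distrib_right mult_ac)
  ultimately have "f x = (\<Sum>s\<in>bl n. \<theta> s * rdot n ((!) s) x)" by simp
  then show "f x = (\<Sum>s\<in>bl n. (\<Sum>y\<in>bl n. rdot n ((!) s) y * f y) / 2 ^ n * rdot n ((!) s) x)"
    by (simp add: \<theta>_def)
qed

text \<open>Walsh expansion writes \<open>f\<close> as a real combination of parity signs, so the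
  phase is a product of rotations generated by products of Z operators.\<close>

lemma reach_diag:
  assumes "reach n \<chi>"
  shows "reach n (\<lambda>x. cis (f x) * \<chi> x)"
proof -
  obtain \<theta> where \<theta>: "\<And>x. x \<in> bl n \<Longrightarrow> f x = (\<Sum>s\<in>bl n. \<theta> s * rdot n ((!) s) x)"
    using real_walsh_expansion[of n f] by blast
  have "reach n (\<lambda>x. cis (\<Sum>s\<in>S. \<theta> s * rdot n ((!) s) x) * \<chi> x)" if "finite S" for S
    using that
  proof (induction S)
    case empty
    then show ?case using assms by simp
  next
    case (insert s S)
    have "reach n (rot n \<i> (\<lambda>_. False) ((!) s) (\<theta> s) (\<lambda>x. cis (\<Sum>s\<in>S. \<theta> s * rdot n ((!) s) x) * \<chi> x))"
      using gen_all[of n "\<lambda>_. False" "(!) s"] insert.IH unfolding gen_def by simp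
    then show ?case
    proof (rule reach_cong)
      fix x assume x: "x \<in> bl n"
      have e: "of_real (cos (\<theta> s)) + of_real (sin (\<theta> s)) * \<i> * dot n ((!) s) ((!) x) = cis (\<theta> s * rdot n ((!) s) x)"
        using rdot(2)[of n "(!) s" x] unfolding rdot(1)[symmetric] by (auto simp: complex_eq_iff)
      have "rot n \<i> (\<lambda>_. False) ((!) s) (\<theta> s) \<xi> x = cis (\<theta> s * rdot n ((!) s) x) * \<xi> x" for \<xi>
        unfolding e[symmetric] using x by (simp add: rot_def pauli_op_def xor_bits_id algebra_simps)
      then show "cis (\<Sum>s\<in>insert s S. \<theta> s * rdot n ((!) s) x) * \<chi> x =
        rot n \<i> (\<lambda>_. False) ((!) s) (\<theta> s) (\<lambda>x. cis (\<Sum>s\<in>S. \<theta> s * rdot n ((!) s) x) * \<chi> x) x"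
        using insert.hyps by (simp add: cis_mult flip: mult.assoc)
    qed
  qed
  from this[of "bl n"] show ?thesis by (rule reach_cong) (simp_all add: \<theta>)
qed

text \<open>A real rotation of wire \<open>j\<close>, generated by ZX on that wire, whose angle may
  depend on the other wires.\<close>

definition mux :: "nat \<Rightarrow> nat \<Rightarrow> (bool list \<Rightarrow> real) \<Rightarrow> qstate \<Rightarrow> qstate" where
  "mux n j f \<chi> x = of_real (cos (f x)) * \<chi> x + of_real (sin (f x)) * sg (x ! j) * \<chi> (xor_bits n (\<lambda>k. k = j) x)"

lemma mux_mux:
  assumes x: "x \<in> bl n" and j: "j < n" and g: "g (xor_bits n (\<lambda>k. k = j) x) = g x"
  shows "mux n j f (mux n j g \<chi>) x = mux n j (\<lambda>x. f x + g x) \<chi> x"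
proof -
  have "sg (x ! j) * sg (\<not> x ! j) = -1" by (cases "x ! j") auto
  moreover have "mux n j f (mux n j g \<chi>) x =
    (of_real (cos (f x)) * of_real (cos (g x)) + of_real (sin (f x)) * of_real (sin (g x)) * (sg (x ! j) * sg (\<not> x ! j))) * \<chi> x +
    (of_real (cos (f x)) * of_real (sin (g x)) + of_real (sin (f x)) * of_real (cos (g x))) * sg (x ! j) * \<chi> (xor_bits n (\<lambda>k. k = j) x)"
    using x j by (simp add: mux_def g xor_bits_id algebra_simps)
  ultimately show ?thesis by (simp add: mux_def cos_add sin_add algebra_simps)
qed

text \<open>As the angle ignores bit \<open>j\<close>, its Walsh expansion can be written with
  parities of the other wires. Each term is a rotation generated by ZX on wire \<open>j\<close>
  times Z operators elsewhere, and the rotations compose by adding angles.\<close>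

lemma reach_mux:
  assumes r: "reach n \<chi>" and j: "j < n" and f: "\<And>x. x \<in> bl n \<Longrightarrow> f (x[j := False]) = f x"
  shows "reach n (mux n j f \<chi>)"
proof -
  obtain \<theta> where \<theta>: "\<And>x. x \<in> bl n \<Longrightarrow> f x = (\<Sum>s\<in>bl n. \<theta> s * rdot n ((!) s) x)"
    using real_walsh_expansion[of n f] by blast
  define b where "b s k = (k \<noteq> j \<and> s ! k)" for s :: "bool list" and k
  have b: "rdot n ((!) s) (x[j := False]) = rdot n (b s) x" if "x \<in> bl n" for s x
    using that j unfolding rdot_def dot_def
    by (intro arg_cong[of _ _ Re] prod.cong) (auto simp: b_def nth_list_update bl_def)
  define F where "F S x = (\<Sum>s\<in>S. \<theta> s * rdot n (b s) x)" for S x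
  have f_eq: "f x = F (bl n) x" if "x \<in> bl n" for x
    using f[OF that] \<theta>[of "x[j := False]"] b[OF that] that by (simp add: F_def)
  have "reach n (mux n j (F S) \<chi>)" if "finite S" for S
    using that
  proof (induction S)
    case empty
    then show ?case using r by (simp add: mux_def[abs_def] F_def)
  next
    case (insert s S)
    let ?a = "\<lambda>k. k = j" and ?b = "\<lambda>k. (k = j) \<noteq> b s k"
    have d: "dot n ?a f = sg (f j)" for f
    proof -
      have "dot n ?a f = (\<Prod>k<n. if k = j then sg (f j) else 1)"
        unfolding dot_def by (intro prod.cong) auto
      then show ?thesis using j by simp
    qed
    \<comment> \<open>The operator squares to -1, so the factor 1 is admissible in
      \<open>gen\<close>.\<close>
    have "dot n ?a ?b = -1" unfolding d by (simp add: b_def)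
    then have "reach n (rot n 1 ?a ?b (\<theta> s) (mux n j (F S) \<chi>))"
      using gen_all[of n ?a ?b] insert.IH unfolding gen_def by simp
    then show ?case
    proof (rule reach_cong)
      fix x assume x: "x \<in> bl n"
      have inv: "rdot n (b s) (xor_bits n ?a x) = rdot n (b s) x" for s
        using x j unfolding rdot_def dot_def
        by (intro arg_cong[of _ _ Re] prod.cong) (auto simp: b_def sg_def)
      have cs: "cos (\<theta> s * rdot n (b s) x) = cos (\<theta> s)" "sin (\<theta> s * rdot n (b s) x) = rdot n (b s) x * sin (\<theta> s)"
        using rdot(2)[of n "b s" x] by auto
      have "mux n j (F (insert s S)) \<chi> x = mux n j (\<lambda>x. \<theta> s * rdot n (b s) x + F S x) \<chi> x"
        using insert.hyps by (simp add: F_def mux_def)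
      also have "\<dots> = mux n j (\<lambda>x. \<theta> s * rdot n (b s) x) (mux n j (F S) \<chi>) x"
        using x j by (intro mux_mux[symmetric]) (auto simp: F_def inv)
      also have "\<dots> = rot n 1 ?a ?b (\<theta> s) (mux n j (F S) \<chi>) x"
        unfolding mux_def[of n j "\<lambda>x. \<theta> s * rdot n (b s) x"] rot_def pauli_op_def dot_xor_left d cs of_real_mult rdot(1)
        by (simp only: mult_ac mult_1_left)
      finally show "mux n j (F (insert s S)) \<chi> x = rot n 1 ?a ?b (\<theta> s) (mux n j (F S) \<chi>) x" .
    qed
  qed
  from this[of "bl n"] show ?thesis by (rule reach_cong) (simp_all add: mux_def f_eq)
qed

lemma reach_zero_prefix:
  assumes "k \<le> n" shows "reach n (\<lambda>x. if \<exists>j<k. x ! j then 0 else 1)"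
  using assms
proof (induction k)
  case 0
  then show ?case by (simp add: reach_one)
next
  case (Suc k)
  then have "reach n (mux n k (\<lambda>_. pi / 4) (\<lambda>x. if \<exists>j<k. x ! j then 0 else 1))"
    by (intro reach_mux) auto
  then show ?case
  proof (rule reach_scale[where c = "1 / complex_of_real (sqrt 2)"])
    fix x
    have "(\<exists>j<k. xor_bits n (\<lambda>i. i = k) x ! j) \<longleftrightarrow> (\<exists>j<k. x ! j)" using Suc.prems by auto
    then show "(if \<exists>j<Suc k. x ! j then 0 else 1) =
      (1 / complex_of_real (sqrt 2)) * mux n k (\<lambda>_. pi / 4) (\<lambda>x. if \<exists>j<k. x ! j then 0 else 1) x"
      by (auto simp: mux_def cos_45 sin_45 less_Suc_eq sg_def)
  qed
qed

theorem reach_all: "reach n \<phi>"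
proof -
  have "reach n \<phi>" if "k \<le> n" "\<And>x. x \<in> bl n \<Longrightarrow> \<exists>j<k. x ! j \<Longrightarrow> \<phi> x = 0" for k \<phi>
    using that
  proof (induction k arbitrary: \<phi> rule: inc_induct)
    case base
    have "reach n (\<lambda>x. if \<exists>j<n. x ! j then 0 else 1)" by (rule reach_zero_prefix) simp
    then show ?case
    proof (rule reach_scale)
      fix x assume x: "x \<in> bl n"
      show "\<phi> x = \<phi> (replicate n False) * (if \<exists>j<n. x ! j then 0 else 1)"
      proof (cases "\<exists>j<n. x ! j")
        case True
        then show ?thesis using base[OF x] by simp
      next
        case False
        then have "x = replicate n False" using length_bl[OF x] by (auto simp: list_eq_iff_nth_eq)
        then show ?thesis by auto
      qed
    qed
  next
    case (step k)
    \<comment> \<open>The phases are stripped first, since the available rotations are real.\<close>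
    define \<phi>' where "\<phi>' x = complex_of_real (cmod (\<phi> x))" for x
    \<comment> \<open>This angle rotates wire \<open>k\<close> to \<open>0\<close> for each setting
      of the others, which reduces to the induction hypothesis. Updating bit \<open>k\<close> inside
      the choice makes it independent of that bit, so the opposite rotation undoes it.\<close>
    define t where "t x = (SOME t. cmod (\<phi> (x[k := True])) * cos t + - cmod (\<phi> (x[k := False])) * sin t = 0)" for x
    have t: "cmod (\<phi> (x[k := True])) * cos (t x) + - cmod (\<phi> (x[k := False])) * sin (t x) = 0" for x
      unfolding t_def by (rule someI_ex, rule ex_cos_sin_zero)
    have t_inv: "t (x[k := c]) = t x" for x c by (simp add: t_def)
    have xor_bits: "xor_bits n (\<lambda>i. i = k) x = x[k := \<not> x ! k]" if "x \<in> bl n" for x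
      using that by (intro nth_equalityI) (auto simp: xor_bits_def bl_def nth_list_update)
    have "reach n (mux n k t \<phi>')"
    proof (rule step.IH)
      fix x assume x: "x \<in> bl n" and ex: "\<exists>j<Suc k. x ! j"
      show "mux n k t \<phi>' x = 0"
      proof (cases "\<exists>j<k. x ! j")
        case True
        then have "\<exists>j<k. xor_bits n (\<lambda>i. i = k) x ! j" using step.hyps by auto
        then show ?thesis using True step.prems[OF x] step.prems[of "xor_bits n (\<lambda>i. i = k) x"]
          by (simp add: mux_def \<phi>'_def)
      next
        case False
        then have k: "x ! k" using ex by (auto simp: less_Suc_eq)
        then have "x[k := True] = x" by (metis list_update_id)
        then have "cmod (\<phi> x) * cos (t x) - cmod (\<phi> (x[k := False])) * sin (t x) = 0"
          using t[of x] by simp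
        moreover have "mux n k t \<phi>' x = of_real (cmod (\<phi> x) * cos (t x) - cmod (\<phi> (x[k := False])) * sin (t x))"
          using k by (simp add: mux_def \<phi>'_def xor_bits[OF x] mult_ac)
        ultimately show ?thesis by simp
      qed
    qed
    then have "reach n (mux n k (\<lambda>x. - t x) (mux n k t \<phi>'))"
      using step.hyps by (elim reach_mux) (simp_all add: t_inv)
    then have "reach n \<phi>'"
      by (rule reach_cong) (use step.hyps in \<open>subst mux_mux, auto simp: xor_bits t_inv mux_def\<close>)
    then have "reach n (\<lambda>x. cis (Arg (\<phi> x)) * \<phi>' x)" by (rule reach_diag)
    then show ?case
      by (rule reach_cong) (metis \<phi>'_def mult.commute rcis_cmod_Arg rcis_def)
  qed
  from this[of 0 \<phi>] show ?thesis by simp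
qed


section \<open>Protocols on the physical qubits\<close>

text \<open>Measured qubits are reset to \<open>0\<close>, so after \<open>q\<close> measurements the state of the remaining qubits
is padded by \<open>q\<close> zeros.\<close>

definition zero_padded :: "nat \<Rightarrow> qstate \<Rightarrow> qstate" where
  "zero_padded q u x = (if True \<in> set (take q x) then 0 else u (drop q x))"

text \<open>The Kraus operator that maps basis vector \<open>s\<close> of \<open>W\<close> to the
  zero state.\<close>

definition proj :: "qop1 \<Rightarrow> bool \<Rightarrow> qop1" where
  "proj W s a b = (if a then 0 else cnj (W b s))"

lemma kraus_proj: "onb W \<Longrightarrow> kraus [proj W False, proj W True]"
  unfolding kraus_def onb_def proj_def
  by (simp add: UNIV_bool lessThan_Suc add.commute mult.commute)

lemma apply1_proj_zero_padded:
  assumes x: "x \<in> bl M" and q: "q < M"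
  shows "apply1 q (proj W s) (zero_padded q u) x = zero_padded (Suc q) (bra W s u) x"
proof -
  have len: "q < length x" using x q by (simp add: bl_def)
  have t: "take (Suc q) x = take q x @ [x ! q]"
    using len by (simp add: take_Suc_conv_app_nth)
  have d: "drop q (x[q := b]) = b # drop (Suc q) x" for b
    using len by (simp add: drop_update_swap Cons_nth_drop_Suc[symmetric])
  show ?thesis
    by (auto simp: apply1_def proj_def zero_padded_def bra_def t d)
qed

lemma apply1_cong:
  "(\<And>x. x \<in> bl M \<Longrightarrow> v x = v' x) \<Longrightarrow> x \<in> bl M \<Longrightarrow> apply1 k K v x = apply1 k K v' x"
  by (simp add: apply1_def)

text \<open>\<open>R\<close> abstracts what is to be known about the protocol tree, so that output
  distributions and final states share one translation. The next qubit to be measured is qubit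
  \<open>q\<close>.\<close>

lemma strat_proto:
  assumes "strat P j u f" "q + j \<le> M" "\<And>x. x \<in> bl M \<Longrightarrow> v x = zero_padded q u x"
    and leaf: "\<And>u f v. P u f \<Longrightarrow> (\<And>x. x \<in> bl M \<Longrightarrow> v x = zero_padded (q + j) u x) \<Longrightarrow> \<exists>p. wf_proto M p \<and> R p v f"
    and node: "\<And>k K0 K1 p0 p1 v f0 f1. R p0 (apply1 k K0 v) f0 \<Longrightarrow> R p1 (apply1 k K1 v) f1 \<Longrightarrow>
      R (Meas k [K0, K1] (\<lambda>i. if i = 0 then p0 else p1)) v (\<lambda>b. f0 b + f1 b)"
  shows "\<exists>p. wf_proto M p \<and> R p v f"
  using assms(1-4)
proof (induction j arbitrary: q u f v)
  case 0
  then show ?case by simp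
next
  case (Suc j)
  from Suc.prems(1) obtain W f0 f1 where W: "onb W" "strat P j (bra W False u) f0"
    "strat P j (bra W True u) f1" and f: "f = (\<lambda>b. f0 b + f1 b)" by auto
  have q: "q < M" using Suc.prems(2) by simp
  have v: "apply1 q (proj W s) v x = zero_padded (Suc q) (bra W s u) x" if "x \<in> bl M" for s x
    using apply1_cong[of M v "zero_padded q u" x] apply1_proj_zero_padded[OF that q] that Suc.prems(3) by simp
  have leaf': "\<And>u f v. P u f \<Longrightarrow> (\<And>x. x \<in> bl M \<Longrightarrow> v x = zero_padded (Suc q + j) u x) \<Longrightarrow> \<exists>p. wf_proto M p \<and> R p v f"
    using Suc.prems(4) by simp
  obtain p0 where p0: "wf_proto M p0" "R p0 (apply1 q (proj W False) v) f0"
    using Suc.IH[OF W(2), of "Suc q" "apply1 q (proj W False) v"] Suc.prems(2) v leaf' by auto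
  obtain p1 where p1: "wf_proto M p1" "R p1 (apply1 q (proj W True) v) f1"
    using Suc.IH[OF W(3), of "Suc q" "apply1 q (proj W True) v"] Suc.prems(2) v leaf' by auto
  have "wf_proto M (Meas q [proj W False, proj W True] (\<lambda>i. if i = 0 then p0 else p1))"
    using q p0 p1 kraus_proj[OF W(1)] by simp
  moreover have "R (Meas q [proj W False, proj W True] (\<lambda>i. if i = 0 then p0 else p1)) v f"
    unfolding f by (rule node[OF p0(2) p1(2)])
  ultimately show ?case by blast
qed

lemma run_Meas_pair:
  "run (Meas k [K0, K1] (\<lambda>i. if i = 0 then p0 else p1)) v = run p0 (apply1 k K0 v) @ run p1 (apply1 k K1 v)"
  by simp

definition out_leaf :: "nat \<Rightarrow> qstate \<Rightarrow> (bool list \<Rightarrow> real) \<Rightarrow> bool" where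
  "out_leaf n u f \<longleftrightarrow> (\<exists>l\<in>bl n. f = (\<lambda>b. if b = l then (cmod (u []))\<^sup>2 else 0))"

lemma homog_out_leaf: "homog 0 (out_leaf n)"
  unfolding homog_def out_leaf_def
  by (auto simp: norm_mult power_mult_distrib if_distrib cong: if_cong)

lemma nsq_zero_padded: 
  assumes "\<And>x. x \<in> bl M \<Longrightarrow> v x = zero_padded M u x"
  shows "nsq M v = (cmod (u []))\<^sup>2"
proof -
  have "(cmod (v x))\<^sup>2 = (if x = replicate M False then (cmod (u []))\<^sup>2 else 0)" if x: "x \<in> bl M" for x
  proof -
    have "True \<notin> set x \<longleftrightarrow> x = replicate M False"
      using length_bl[OF x] by (auto simp: list_eq_iff_nth_eq in_set_conv_nth)
    then show ?thesis using assms[OF x] length_bl[OF x] by (simp add: zero_padded_def)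
  qed
  moreover have "replicate M False \<in> bl M" by (simp add: bl_def)
  ultimately show ?thesis by (simp add: nsq_def)
qed

lemma strat_output:
  assumes "strat (out_leaf n) M v f"
  shows "\<exists>p. wf_proto M p \<and> (\<forall>b. output_prob p v M b = f b)"
proof (rule strat_proto[where q = 0, OF assms])
  fix u f v
  assume "out_leaf n u f" and v: "\<And>x. x \<in> bl M \<Longrightarrow> v x = zero_padded (0 + M) u x"
  then obtain l where "f = (\<lambda>b. if b = l then (cmod (u []))\<^sup>2 else 0)"
    by (auto simp: out_leaf_def)
  moreover have "nsq M v = (cmod (u []))\<^sup>2" using nsq_zero_padded[of M v u] v by simp
  ultimately show "\<exists>p. wf_proto M p \<and> (\<forall>b. output_prob p v M b = f b)"
    by (intro exI[of _ "Done l"]) (auto simp: output_prob_def)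
qed (auto simp: zero_padded_def output_prob_def)

lemma strat_leaves:
  assumes "strat P j v f" "j \<le> M"
    and Q: "\<And>u f v. P u f \<Longrightarrow> (\<And>x. x \<in> bl M \<Longrightarrow> v x = zero_padded j u x) \<Longrightarrow> Q v"
  shows "\<exists>p. wf_proto M p \<and> (\<forall>(v', l)\<in>set (run p v). Q v')"
proof (rule strat_proto[where q = 0 and R = "\<lambda>p v f. \<forall>(v', l)\<in>set (run p v). Q v'", OF assms(1)])
  fix u f v
  assume "P u f" and v: "\<And>x. x \<in> bl M \<Longrightarrow> v x = zero_padded (0 + j) u x"
  then have "Q v" using Q[of u f v] by simp
  then show "\<exists>p. wf_proto M p \<and> (\<forall>(v', l)\<in>set (run p v). Q v')"
    by (intro exI[of _ "Done []"]) auto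
next
  fix k K0 K1 p0 p1 v
  assume "\<forall>(v', l)\<in>set (run p0 (apply1 k K0 v)). Q v'" "\<forall>(v', l)\<in>set (run p1 (apply1 k K1 v)). Q v'"
  then show "\<forall>(v', l)\<in>set (run (Meas k [K0, K1] (\<lambda>i. if i = 0 then p0 else p1)) v). Q v'"
    unfolding run_Meas_pair set_append by blast
qed (use assms(2) in \<open>auto simp: zero_padded_def\<close>)

text \<open>Conservation of probability; it later fixes the unknown normalisation factor.\<close>

lemma strat_total:
  assumes "strat P j u f" "\<And>u f. P u f \<Longrightarrow> (\<Sum>b\<in>B. f b) = nsq n u"
  shows "(\<Sum>b\<in>B. f b) = nsq (j + n) u"
  using assms(1)
proof (induction j arbitrary: u f)
  case (Suc j)
  then obtain W f0 f1 where W: "onb W" "strat P j (bra W False u) f0"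
    "strat P j (bra W True u) f1" and f: "f = (\<lambda>b. f0 b + f1 b)" by auto
  show ?case using Suc.IH[OF W(2)] Suc.IH[OF W(3)] sum_nsq_bra[OF W(1), of "j + n" u]
    by (simp add: f sum.distrib)
qed (simp add: assms(2))

text \<open>Lets further measurements be appended at the leaves when only the shape of the resulting
  weights is controlled.\<close>

lemma strat_sum_closed:
  assumes "strat P j u f" "\<And>u f. P u f \<Longrightarrow> \<exists>g\<in>S. Q u g" "\<And>g h. g \<in> S \<Longrightarrow> h \<in> S \<Longrightarrow> (\<lambda>b. g b + h b) \<in> S"
  shows "\<exists>g\<in>S. strat Q j u g"
  using assms(1)
proof (induction j arbitrary: u f)
  case (Suc j)
  then obtain W f0 f1 where W: "onb W" "strat P j (bra W False u) f0"
    "strat P j (bra W True u) f1" by auto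
  obtain g h where "g \<in> S" "strat Q j (bra W False u) g" "h \<in> S" "strat Q j (bra W True u) h"
    using Suc.IH W by meson
  with W(1) show ?case by (intro bexI[OF _ assms(3)[of g h]]) auto
qed (simp add: assms(2))

section \<open>Logical Pauli operators and byproducts\<close>

lemma blk_set_blk:
  assumes x: "x \<in> bl (m * n)" and j: "j < n" and k: "k < n" and z: "z \<in> bl m"
  shows "blk m k (set_blk m j x z) = (if k = j then z else blk m k x)"
proof -
  have lx: "length x = m * n" and lz: "length z = m" using x z by (auto simp: bl_def)
  have jn: "j * m + m \<le> m * n" using j by (metis Suc_leI add.commute mult.commute mult_Suc mult_le_mono2)
  have ltk: "length (take (j * m) x) = j * m" using lx jn by simp
  consider "k = j" | "k < j" | "j < k" by linarith
  then show ?thesis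
  proof cases
    case 1
    then show ?thesis using lz ltk by (simp add: blk_def set_blk_def)
  next
    case 2
    then have "k * m + m \<le> j * m" by (metis Suc_leI add.commute mult_Suc mult_le_mono1)
    then obtain t where t: "j * m = k * m + m + t" using le_Suc_ex by blast
    have "take m (drop (k * m) (take (j * m) x @ y)) = take m (drop (k * m) (take (j * m) x))" for y
      using ltk by (simp add: t)
    then have "blk m k (set_blk m j x z) = take m (drop (k * m) (take (j * m) x))"
      by (simp only: blk_def set_blk_def)
    also have "\<dots> = blk m k x" by (simp add: blk_def t drop_take)
    finally show ?thesis using 2 by simp
  next
    case 3
    then have "j * m + m \<le> k * m" by (metis Suc_leI add.commute mult_Suc mult_le_mono1)
    then obtain t where t: "k * m = j * m + m + t" using le_Suc_ex by blast
    have "drop (k * m) (take (j * m) x @ z @ y) = drop t y" for y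
      using ltk lz by (simp add: t)
    then have "blk m k (set_blk m j x z) = take m (drop t (drop (j * m + m) x))"
      by (simp only: blk_def set_blk_def)
    also have "\<dots> = blk m k x" by (simp add: blk_def t add_ac)
    finally show ?thesis using 3 by simp
  qed
qed

lemma sum_bl_update_swap:
  assumes "j < n"
  shows "(\<Sum>i\<in>bl n. \<Sum>b\<in>UNIV. h i b) = (\<Sum>i\<in>bl n. \<Sum>b\<in>UNIV. h (i[j := b]) (i ! j))"
proof -
  have "bij_betw (\<lambda>(i, b). (i[j := b], i ! j)) (bl n \<times> UNIV) (bl n \<times> UNIV)"
    by (rule bij_betw_byWitness[where f' = "\<lambda>(i, b). (i[j := b], i ! j)"])
       (use assms in \<open>auto simp: bl_def\<close>)
  from sum.reindex_bij_betw[OF this, of "\<lambda>(i, b). h i b"] show ?thesis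
    by (simp add: sum.cartesian_product case_prod_unfold)
qed

text \<open>Orthonormality of the code states collapses the sum over the block to the logical index,
  so a logical operator acts as \<open>P\<close> before encoding. The final exchange of bit
  \<open>j\<close> with the summation bit turns the column index into the row index.\<close>

lemma apply_block_enc:
  assumes e: "encoding m e0 e1" and j: "j < n" and x: "x \<in> bl (m * n)"
  shows "apply_block m j (lop e0 e1 P) (enc m e0 e1 n w) x = enc m e0 e1 n (apply1 j P w) x"
proof -
  let ?e = "ebit e0 e1"
  let ?r = "\<lambda>i. \<Prod>k\<in>{..<n} - {j}. ?e (i ! k) (blk m k x)"
  have split: "(\<Prod>k<n. ?e (i ! k) (g k)) = ?e (i ! j) (g j) * (\<Prod>k\<in>{..<n} - {j}. ?e (i ! k) (g k))" for i g
    using j by (simp add: prod.remove)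
  have "enc m e0 e1 n w (set_blk m j x z) = (\<Sum>i\<in>bl n. w i * (?e (i ! j) z * ?r i))" if z: "z \<in> bl m" for z
    unfolding enc_def split using blk_set_blk[OF x j _ z] j by (intro sum.cong refl) simp
  then have "apply_block m j (lop e0 e1 P) (enc m e0 e1 n w) x =
    (\<Sum>z\<in>bl m. (\<Sum>a\<in>UNIV. \<Sum>b\<in>UNIV. P a b * ?e a (blk m j x) * cnj (?e b z)) * (\<Sum>i\<in>bl n. w i * (?e (i ! j) z * ?r i)))"
    by (simp add: apply_block_def lop_def)
  also have "\<dots> = (\<Sum>i\<in>bl n. \<Sum>a\<in>UNIV. \<Sum>b\<in>UNIV. P a b * ?e a (blk m j x) * w i * ?r i * (\<Sum>z\<in>bl m. cnj (?e b z) * ?e (i ! j) z))"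
    by (simp add: UNIV_bool sum_distrib_left sum_distrib_right sum.distrib algebra_simps sum.swap[of _ "bl m" "bl n"])
  also have "\<dots> = (\<Sum>i\<in>bl n. \<Sum>a\<in>UNIV. P a (i ! j) * ?e a (blk m j x) * w i * ?r i)"
    unfolding inner_st_def[symmetric] inner_st_ebit[OF e] by (simp add: if_distrib[of "\<lambda>t. _ * t"] cong: if_cong)
  also have "\<dots> = (\<Sum>i\<in>bl n. \<Sum>b\<in>UNIV. P (i ! j) b * ?e (i ! j) (blk m j x) * w (i[j := b]) * ?r (i[j := b]))"
    using j by (subst sum_bl_update_swap[OF j]) (intro sum.cong refl, simp add: bl_def)
  also have "\<dots> = (\<Sum>i\<in>bl n. \<Sum>b\<in>UNIV. P (i ! j) b * ?e (i ! j) (blk m j x) * w (i[j := b]) * ?r i)"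
    by (intro sum.cong refl arg_cong2[of _ _ _ _ "(*)"] prod.cong) auto
  also have "\<dots> = enc m e0 e1 n (apply1 j P w) x"
    unfolding enc_def split apply1_def by (simp add: sum_distrib_left sum_distrib_right mult_ac)
  finally show ?thesis .
qed

definition pauli_index :: "bool \<Rightarrow> bool \<Rightarrow> nat" where
  "pauli_index a b = (if a then if b then 2 else 1 else if b then 3 else 0)"

lemma dot_single: "j < n \<Longrightarrow> dot n (\<lambda>k. k = j \<and> b) f = sg (b \<and> f j)"
proof -
  assume j: "j < n"
  have "dot n (\<lambda>k. k = j \<and> b) f = (\<Prod>k<n. if k = j then sg (b \<and> f j) else 1)"
    unfolding dot_def by (intro prod.cong) auto
  then show ?thesis using j by simp
qed

lemma update_eq_xor_bits: "x \<in> bl n \<Longrightarrow> x[j := (x ! j \<noteq> a)] = xor_bits n (\<lambda>k. k = j \<and> a) x"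
  by (rule nth_equalityI) (auto simp: bl_def xor_bits_def nth_list_update)

text \<open>\<open>sig_y\<close> equals \<open>- \<i>\<close> times the product ZX.\<close>

lemma apply1_pauli:
  assumes "x \<in> bl n"
  shows "apply1 j (pauli (pauli_index a b)) \<psi> x =
    (if a \<and> b then - \<i> else 1) * sg (b \<and> x ! j) * \<psi> (xor_bits n (\<lambda>k. k = j \<and> a) x)"
  unfolding update_eq_xor_bits[OF assms, symmetric]
  by (auto simp: apply1_def pauli_def pauli_index_def UNIV_bool sig_x_def sig_y_def sig_z_def sig_id_def sg_def)
     (metis (full_types) list_update_id)+

lemma foldr_apply1_pauli:
  assumes "j \<le> n"
  shows "\<exists>c. c \<noteq> 0 \<and> (\<forall>\<psi>. \<forall>x\<in>bl n. foldr (\<lambda>i. apply1 i (pauli (pauli_index (a i) (b i)))) [0..<j] \<psi> x =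
    c * pauli_op n (\<lambda>k. k < j \<and> a k) (\<lambda>k. k < j \<and> b k) \<psi> x)"
  using assms
proof (induction j)
  case 0
  then show ?case by (intro exI[of _ 1]) (simp add: pauli_op_id)
next
  case (Suc j)
  then obtain c where c: "c \<noteq> 0"
    and *: "\<And>\<psi> x. x \<in> bl n \<Longrightarrow> foldr (\<lambda>i. apply1 i (pauli (pauli_index (a i) (b i)))) [0..<j] \<psi> x =
      c * pauli_op n (\<lambda>k. k < j \<and> a k) (\<lambda>k. k < j \<and> b k) \<psi> x" by auto
  define g where "g = (if a j \<and> b j then - \<i> else 1)"
  have xor: "(\<lambda>k. k < Suc j \<and> f k) = (\<lambda>k. (k = j \<and> f j) \<noteq> (k < j \<and> f k))" for f
    by (auto simp: less_Suc_eq fun_eq_iff)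
  have "foldr (\<lambda>i. apply1 i (pauli (pauli_index (a i) (b i)))) [0..<Suc j] \<psi> x =
     (c * g) * pauli_op n (\<lambda>k. k < Suc j \<and> a k) (\<lambda>k. k < Suc j \<and> b k) \<psi> x" if x: "x \<in> bl n" for \<psi> x
  proof -
    have "dot n (\<lambda>k. k < Suc j \<and> b k) ((!) x) = sg (b j \<and> x ! j) * dot n (\<lambda>k. k < j \<and> b k) ((!) x)"
      unfolding xor[of b] dot_xor_left using Suc.prems by (simp add: dot_single)
    moreover have "xor_bits n (\<lambda>k. k < j \<and> a k) x ! j = x ! j"
      using Suc.prems by (simp add: nth_xor_bits)
    moreover have "xor_bits n (\<lambda>k. k = j \<and> a j) (xor_bits n (\<lambda>k. k < j \<and> a k) x) = xor_bits n (\<lambda>k. k < Suc j \<and> a k) x"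
      unfolding xor[of a] by (rule xor_bits_xor_bits)
    ultimately show ?thesis
      by (simp add: * x pauli_op_def apply1_pauli[of _ n] g_def del: xor_bits_xor_bits)
  qed
  moreover have "c * g \<noteq> 0" using c by (simp add: g_def)
  ultimately show ?case by blast
qed

lemma set_blk_in_bl:
  assumes "x \<in> bl (m * n)" "j < n" "z \<in> bl m"
  shows "set_blk m j x z \<in> bl (m * n)"
proof -
  have "j * m + m \<le> m * n" using assms(2) by (metis Suc_leI add.commute mult.commute mult_Suc mult_le_mono2)
  then show ?thesis using assms by (simp add: set_blk_def bl_def min_absorb2)
qed

lemma apply_block_cong:
  assumes "\<And>x. x \<in> bl (m * n) \<Longrightarrow> v x = v' x" "x \<in> bl (m * n)" "j < n"
  shows "apply_block m j L v x = apply_block m j L v' x"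
  unfolding apply_block_def using assms by (intro sum.cong) (auto simp: set_blk_in_bl)

lemma foldr_apply_block_enc:
  assumes e: "encoding m e0 e1" and "set L \<subseteq> {..<n}" "x \<in> bl (m * n)"
  shows "foldr (\<lambda>j. apply_block m j (lop e0 e1 (P j))) L (enc m e0 e1 n w) x =
    enc m e0 e1 n (foldr (\<lambda>j. apply1 j (P j)) L w) x"
  using assms(2,3)
proof (induction L arbitrary: x)
  case (Cons j L)
  have "foldr (\<lambda>j. apply_block m j (lop e0 e1 (P j))) (j # L) (enc m e0 e1 n w) x =
    apply_block m j (lop e0 e1 (P j)) (enc m e0 e1 n (foldr (\<lambda>j. apply1 j (P j)) L w)) x"
    unfolding foldr_Cons o_apply using Cons by (intro apply_block_cong) auto
  then show ?case using Cons.prems by (simp add: apply_block_enc[OF e])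
qed simp

lemma pauli_enc_pauli_op:
  assumes e: "encoding m e0 e1"
  shows "\<exists>ps c. length ps = n \<and> set ps \<subseteq> {0, 1, 2, 3} \<and>
    (\<forall>y\<in>bl (m * n). enc m e0 e1 n (pauli_op n a b \<phi>) y = c * pauli_enc m e0 e1 n ps \<phi> y)"
proof -
  define ps where "ps = map (\<lambda>k. pauli_index (a k) (b k)) [0..<n]"
  obtain c where c: "c \<noteq> 0"
    and *: "\<And>x. x \<in> bl n \<Longrightarrow> foldr (\<lambda>i. apply1 i (pauli (pauli_index (a i) (b i)))) [0..<n] \<phi> x =
      c * pauli_op n (\<lambda>k. k < n \<and> a k) (\<lambda>k. k < n \<and> b k) \<phi> x"
    using foldr_apply1_pauli[of n n a b] by auto
  have **: "foldr (\<lambda>i. apply1 i (pauli (ps ! i))) [0..<n] \<phi> x = c * pauli_op n a b \<phi> x" if x: "x \<in> bl n" for x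
  proof -
    have "foldr (\<lambda>i. apply1 i (pauli (ps ! i))) [0..<n] \<phi> = 
      foldr (\<lambda>i. apply1 i (pauli (pauli_index (a i) (b i)))) [0..<n] \<phi>"
      by (rule foldr_cong) (auto simp: ps_def)
    then show ?thesis using *[OF x] pauli_op_cong[of n "\<lambda>k. k < n \<and> a k" a "\<lambda>k. k < n \<and> b k" b] by simp
  qed
  have "enc m e0 e1 n (pauli_op n a b \<phi>) y = inverse c * pauli_enc m e0 e1 n ps \<phi> y" if y: "y \<in> bl (m * n)" for y
  proof -
    have "pauli_enc m e0 e1 n ps \<phi> y = enc m e0 e1 n (foldr (\<lambda>i. apply1 i (pauli (ps ! i))) [0..<n] \<phi>) y"
      unfolding pauli_enc_def using y by (intro foldr_apply_block_enc[OF e]) auto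
    also have "\<dots> = c * enc m e0 e1 n (pauli_op n a b \<phi>) y"
      using ** by (rule enc_scale)
    finally show ?thesis using c by simp
  qed
  moreover have "length ps = n" "set ps \<subseteq> {0, 1, 2, 3}"
    by (auto simp: ps_def pauli_index_def)
  ultimately show ?thesis by blast
qed

section \<open>The output blocks and the two universality claims\<close>

lemma concat_blk:
  assumes "a \<le> N" "length x = m * N"
  shows "concat (map (\<lambda>k. blk m k x) [a..<N]) = drop (m * a) x"
  using assms(1)
proof (induction rule: inc_induct)
  case (step k)
  have "concat (map (\<lambda>k. blk m k x) [k..<N]) = take m (drop (m * k) x) @ drop m (drop (m * k) x)"
    using step by (simp add: upt_conv_Cons blk_def mult.commute)
  then show ?case by (simp only: append_take_drop_id)
qed (use assms(2) in simp)

lemma filter_upt_less: "K \<le> M \<Longrightarrow> filter (\<lambda>p. p < K) [0..<M] = [0..<K]"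
  by (induction M) (auto simp: le_Suc_eq filter_id_conv)

lemma rest_bits_upt:
  assumes "a \<le> N" "length x = m * N"
  shows "rest_bits m (m * N) [a..<N] x = take (m * a) x"
proof -
  have le: "m * a \<le> m * N" using assms(1) by simp
  have "p div m \<notin> set [a..<N] \<longleftrightarrow> p < m * a" if "p < m * N" for p
  proof -
    have "0 < m" using that by (cases m) auto
    then show ?thesis using that less_mult_imp_div_less[of p N m] div_less_iff_less_mult[of m p a]
      by (auto simp: mult.commute)
  qed
  then have "filter (\<lambda>p. p div m \<notin> set [a..<N]) [0..<m * N] = filter (\<lambda>p. p < m * a) [0..<m * N]"
    by (intro filter_cong) auto
  also have "\<dots> = [0..<m * a]"
    using filter_upt_less[OF le] .
  finally show ?thesis unfolding rest_bits_def using assms le by (intro nth_equalityI) auto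
qed

text \<open>The output blocks form the tail of the register and all measured qubits are reset to
  zero. So the factor for the rest is a scalar times the indicator of the zero string.\<close>

lemma leaves_blocks_pauli_leaf:
  assumes e: "encoding m e0 e1" and w: "pauli_leaf n \<phi> w f" and "n \<le> N"
    and v: "\<And>x. x \<in> bl (m * N) \<Longrightarrow> v x = zero_padded (m * (N - n)) u x"
    and u: "\<And>y. y \<in> bl (m * n) \<Longrightarrow> u y = enc m e0 e1 n w y"
  shows "\<exists>ps. length ps = n \<and> set ps \<subseteq> {0, 1, 2, 3} \<and>
    leaves_blocks m (m * N) [N - n..<N] (pauli_enc m e0 e1 n ps \<phi>) v"
proof -
  from w obtain c a b where w: "\<And>x. x \<in> bl n \<Longrightarrow> w x = c * pauli_op n a b \<phi> x"
    by (auto simp: pauli_leaf_def)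
  obtain ps c' where ps: "length ps = n" "set ps \<subseteq> {0, 1, 2, 3}"
    and c': "\<And>y. y \<in> bl (m * n) \<Longrightarrow> enc m e0 e1 n (pauli_op n a b \<phi>) y = c' * pauli_enc m e0 e1 n ps \<phi> y"
    using pauli_enc_pauli_op[OF e] by blast
  have "v x = pauli_enc m e0 e1 n ps \<phi> (concat (map (\<lambda>k. blk m k x) [N - n..<N])) *
      (if True \<in> set (rest_bits m (m * N) [N - n..<N] x) then 0 else c * c')" if x: "x \<in> bl (m * N)" for x
  proof -
    have "m * (N - n) + m * n = m * N" using \<open>n \<le> N\<close> by (simp flip: add_mult_distrib2)
    then have "drop (m * (N - n)) x \<in> bl (m * n)" using x by (simp add: bl_def)
    then show ?thesis using \<open>n \<le> N\<close> length_bl[OF x] enc_scale[of n w c "pauli_op n a b \<phi>" m e0 e1] w c'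
      by (simp add: v[OF x] zero_padded_def concat_blk rest_bits_upt u)
  qed
  then show ?thesis using ps unfolding leaves_blocks_def by (intro exI[of _ ps] conjI) (assumption | rule exI ballI | blast)+
qed

theorem encoded_universal_if_cluster_strat:
  assumes e: "encoding m e0 e1"
    and L: "\<And>n \<phi>. nsq n \<phi> = 1 \<Longrightarrow> \<exists>d\<ge>1. n \<le> d * d \<and>
      (\<forall>\<psi>. is_cluster d \<psi> \<longrightarrow> strat (pauli_leaf n \<phi>) (d * d - n) \<psi> (\<lambda>_. 0))"
  shows "encoded_universal m e0 e1"
  unfolding encoded_universal_def
proof (intro allI impI)
  fix n \<phi> assume "nsq n \<phi> = 1"
  from L[OF this] obtain d where d: "d \<ge> 1" "n \<le> d * d"
    and S: "\<And>\<psi>. is_cluster d \<psi> \<Longrightarrow> strat (pauli_leaf n \<phi>) (d * d - n) \<psi> (\<lambda>_. 0)" by blast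
  show "\<exists>d\<ge>1. \<exists>ks. length ks = n \<and> distinct ks \<and> set ks \<subseteq> {..<d * d} \<and>
        (\<forall>\<psi>. is_cluster d \<psi> \<longrightarrow>
          (\<exists>p. wf_proto (m * (d * d)) p \<and>
             (\<forall>(v, l) \<in> set (run p (enc m e0 e1 (d * d) \<psi>)).
                \<exists>ps. length ps = n \<and> set ps \<subseteq> {0, 1, 2, 3} \<and>
                  leaves_blocks m (m * (d * d)) ks (pauli_enc m e0 e1 n ps \<phi>) v)))"
  proof (intro exI[of _ d] conjI exI[of _ "[d * d - n..<d * d]"] allI impI)
    fix \<psi> assume "is_cluster d \<psi>"
    have "strat (enc_leaf m e0 e1 n (pauli_leaf n \<phi>)) (m * (d * d - n)) (enc m e0 e1 (d * d) \<psi>) (\<lambda>_. 0)"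
      using d by (intro strat_enc[OF e homog_pauli_leaf S]) (auto intro: \<open>is_cluster d \<psi>\<close>)
    then show "\<exists>p. wf_proto (m * (d * d)) p \<and>
             (\<forall>(v, l) \<in> set (run p (enc m e0 e1 (d * d) \<psi>)).
                \<exists>ps. length ps = n \<and> set ps \<subseteq> {0, 1, 2, 3} \<and>
                  leaves_blocks m (m * (d * d)) [d * d - n..<d * d] (pauli_enc m e0 e1 n ps \<phi>) v)"
    proof (rule strat_leaves)
      fix u f v
      assume "enc_leaf m e0 e1 n (pauli_leaf n \<phi>) u f"
        and v: "\<And>x. x \<in> bl (m * (d * d)) \<Longrightarrow> v x = zero_padded (m * (d * d - n)) u x"
      then obtain w where "pauli_leaf n \<phi> w f" "\<And>y. y \<in> bl (m * n) \<Longrightarrow> u y = enc m e0 e1 n w y"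
        by (auto simp: enc_leaf_def)
      then show "\<exists>ps. length ps = n \<and> set ps \<subseteq> {0, 1, 2, 3} \<and>
                  leaves_blocks m (m * (d * d)) [d * d - n..<d * d] (pauli_enc m e0 e1 n ps \<phi>) v"
        using leaves_blocks_pauli_leaf[OF e _ d(2) v] by blast
    qed simp
  qed (use d in auto)
qed

text \<open>The byproduct is moved from the state into the bases: flipping rows by \<open>a\<close>
  and signing them by \<open>b\<close> gives bases in which the amplitudes are \<open>c\<close>
  times the ideal ones.\<close>

lemma strat_measure_all:
  assumes Ws: "length Ws = n" "\<forall>W\<in>set Ws. unitary1 W"
    and w: "\<And>x. x \<in> bl n \<Longrightarrow> w x = c * pauli_op n a b \<phi> x"
  shows "strat (out_leaf n) n w (\<lambda>l. if l \<in> bl n then (cmod c)\<^sup>2 * (cmod (amp Ws l \<phi> []))\<^sup>2 else 0)"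
proof -
  define Vs where "Vs = map (\<lambda>k. \<lambda>x s. sg (b k \<and> x) * (Ws ! k) (x \<noteq> a k) s) [0..<n]"
  have Vn: "length Vs = n" by (simp add: Vs_def)
  have onb: "\<forall>V\<in>set Vs. onb V"
  proof
    fix V assume "V \<in> set Vs"
    then obtain k where k: "k < n" and V: "V = (\<lambda>x s. sg (b k \<and> x) * (Ws ! k) (x \<noteq> a k) s)"
      by (auto simp: Vs_def)
    have "onb (Ws ! k)" using k Ws by (simp add: onb_iff_unitary1)
    then have "(\<Sum>s\<in>UNIV. (Ws ! k) x s * cnj ((Ws ! k) y s)) = (if x = y then 1 else 0)" for x y
      by (simp add: onb_def)
    moreover have "(\<Sum>s\<in>UNIV. V x s * cnj (V y s)) = sg (b k \<and> x) * sg (b k \<and> y) *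
      (\<Sum>s\<in>UNIV. (Ws ! k) (x \<noteq> a k) s * cnj ((Ws ! k) (y \<noteq> a k) s))" for x y
      by (simp add: V sum_distrib_left mult_ac)
    ultimately show "onb V" unfolding onb_def by auto
  qed
  have amp: "amp Vs s w [] = c * amp Ws s \<phi> []" for s
  proof -
    define f where "f y = (\<Prod>k<n. cnj ((Ws ! k) (y ! k) (s ! k))) * \<phi> y" for y
    have "(\<Prod>k<n. cnj ((Vs ! k) (x ! k) (s ! k))) * w x = c * f (xor_bits n a x)" if x: "x \<in> bl n" for x
    proof -
      have "(\<Prod>k<n. cnj ((Vs ! k) (x ! k) (s ! k))) =
        dot n b ((!) x) * (\<Prod>k<n. cnj ((Ws ! k) (xor_bits n a x ! k) (s ! k)))"
        unfolding dot_def prod.distrib[symmetric] by (intro prod.cong) (auto simp: Vs_def)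
      then have "(\<Prod>k<n. cnj ((Vs ! k) (x ! k) (s ! k))) * w x =
        (dot n b ((!) x) * dot n b ((!) x)) * (c * f (xor_bits n a x))"
        by (simp add: w[OF x] pauli_op_def f_def del: dot_square)
      then show ?thesis by simp
    qed
    then show ?thesis
      using sum_bl_xor_bits[of f n a] by (simp add: amp_def Vn Ws f_def flip: sum_distrib_left)
  qed
  have "strat (out_leaf n) n w (\<lambda>l. \<Sum>s\<in>bl n. if l = s then (cmod c)\<^sup>2 * (cmod (amp Ws s \<phi> []))\<^sup>2 else 0)"
    using strat_row[OF onb, of "out_leaf n" w "\<lambda>s l. if l = s then (cmod c)\<^sup>2 * (cmod (amp Ws s \<phi> []))\<^sup>2 else 0"]
    unfolding Vn out_leaf_def amp norm_mult power_mult_distrib by auto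
  then show ?thesis by simp
qed

text \<open>Each preparation branch followed by the corrected measurement yields a multiple of the
  target distribution \<open>t\<close>, hence so does the sum over branches.\<close>

theorem cc_universal_if_cluster_strat:
  assumes e: "encoding m e0 e1"
    and L: "\<And>n \<phi>. nsq n \<phi> = 1 \<Longrightarrow> \<exists>d\<ge>1. n \<le> d * d \<and>
      (\<forall>\<psi>. is_cluster d \<psi> \<longrightarrow> strat (pauli_leaf n \<phi>) (d * d - n) \<psi> (\<lambda>_. 0))"
  shows "cc_universal m e0 e1"
  unfolding cc_universal_def
proof (intro allI impI)
  fix n U Ws
  assume *: "unitary_n n U \<and> length Ws = n \<and> (\<forall>W\<in>set Ws. unitary1 W)"
  define \<phi> where "\<phi> x = U x (replicate n False)" for x
  define t where "t l = (if l \<in> bl n then (cmod (amp Ws l \<phi> []))\<^sup>2 else 0)" for l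
  have r: "replicate n False \<in> bl n" by (simp add: bl_def)
  have "complex_of_real (nsq n \<phi>) = 1"
    using * r unfolding of_real_nsq inner_st_def unitary_n_def \<phi>_def by auto
  then have \<phi>: "nsq n \<phi> = 1" by simp
  have t: "t l = target_prob n U Ws l" if "l \<in> bl n" for l
    using that * by (simp add: t_def target_prob_def amp_def \<phi>_def)
  have total: "(\<Sum>l\<in>bl n. f l) = nsq (j + 0) w" if "strat (out_leaf n) j w f" for j w f
    using that by (rule strat_total) (auto simp: out_leaf_def nsq_def)
  have "strat (out_leaf n) n \<phi> t"
    using strat_measure_all[of Ws n \<phi> 1 "\<lambda>_. False" "\<lambda>_. False" \<phi>] * by (simp add: pauli_op_id t_def[abs_def] cong: if_cong)
  from total[OF this] have sum_t: "(\<Sum>l\<in>bl n. t l) = 1" using \<phi> by simp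
  from L[OF \<phi>] obtain d where d: "d \<ge> 1" "n \<le> d * d"
    and S: "\<And>\<psi>. is_cluster d \<psi> \<Longrightarrow> strat (pauli_leaf n \<phi>) (d * d - n) \<psi> (\<lambda>_. 0)" by blast
  show "\<exists>d \<ge> 1. \<forall>\<psi>. is_cluster d \<psi> \<longrightarrow>
         (\<exists>p. wf_proto (m * (d * d)) p \<and>
            (\<forall>b\<in>bl n. output_prob p (enc m e0 e1 (d * d) \<psi>) (m * (d * d)) b
                        = target_prob n U Ws b))"
  proof (intro exI[of _ d] conjI allI impI)
    fix \<psi> assume c: "is_cluster d \<psi>"
    have "\<exists>g\<in>{g. \<exists>K. g = (\<lambda>l. K * t l)}. strat (strat (out_leaf n) n) (d * d - n) \<psi> g"
    proof (rule strat_sum_closed[OF S[OF c]])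
      fix u f assume "pauli_leaf n \<phi> u f"
      then obtain c a b where "\<And>x. x \<in> bl n \<Longrightarrow> u x = c * pauli_op n a b \<phi> x"
        by (auto simp: pauli_leaf_def)
      from strat_measure_all[OF _ _ this, of Ws] *
      have "strat (out_leaf n) n u (\<lambda>l. (cmod c)\<^sup>2 * t l)" by (simp add: t_def if_distrib cong: if_cong)
      then show "\<exists>g\<in>{g. \<exists>K. g = (\<lambda>l. K * t l)}. strat (out_leaf n) n u g" by blast
    next
      fix g h assume "g \<in> {g. \<exists>K. g = (\<lambda>l. K * t l)}" "h \<in> {g. \<exists>K. g = (\<lambda>l. K * t l)}"
      then obtain K K' where "g = (\<lambda>l. K * t l)" "h = (\<lambda>l. K' * t l)" by auto
      then have "(\<lambda>b. g b + h b) = (\<lambda>l. (K + K') * t l)" by (simp add: distrib_right)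
      then show "(\<lambda>b. g b + h b) \<in> {g. \<exists>K. g = (\<lambda>l. K * t l)}" by blast
    qed
    then obtain K where K: "strat (out_leaf n) (d * d) \<psi> (\<lambda>l. K * t l)"
      using d(2) strat_add[of "out_leaf n" "d * d - n" n] by auto
    \<comment> \<open>The weights add up to the squared norm of the cluster state, which is one, and
      \<open>t\<close> sums to one.\<close>
    have "K = 1" using total[OF K] c sum_t by (simp add: is_cluster_def flip: sum_distrib_left)
    have "strat (enc_leaf m e0 e1 0 (out_leaf n)) (m * (d * d)) (enc m e0 e1 (d * d) \<psi>) t"
      using K \<open>K = 1\<close> by (intro strat_enc[OF e homog_out_leaf]) auto
    then have "strat (out_leaf n) (m * (d * d)) (enc m e0 e1 (d * d) \<psi>) t"
      by (rule strat_mono) (auto simp: enc_leaf_def enc_def out_leaf_def cong: if_cong)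
    from strat_output[OF this] t
    show "\<exists>p. wf_proto (m * (d * d)) p \<and>
            (\<forall>b\<in>bl n. output_prob p (enc m e0 e1 (d * d) \<psi>) (m * (d * d)) b
                        = target_prob n U Ws b)" by auto
  qed (rule d)
qed

text \<open>The reachable state is taken to be \<open>\<phi>\<close> with the controlled phases of
  the output row applied; these phases are their own inverse.\<close>

lemma strat_cluster_pauli_leaf:
  assumes "nsq n \<phi> = 1"
  shows "\<exists>d\<ge>1. n \<le> d * d \<and> (\<forall>\<psi>. is_cluster d \<psi> \<longrightarrow> strat (pauli_leaf n \<phi>) (d * d - n) \<psi> (\<lambda>_. 0))"
proof -
  obtain \<alpha>s c where r: "\<And>x. x \<in> bl n \<Longrightarrow> path_sign n ((!) x) * \<phi> x = c * fold (step n) \<alpha>s (\<lambda>_. 1) x"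
    using reach_all[of n "\<lambda>x. path_sign n ((!) x) * \<phi> x"] by (auto simp: reach_def)
  have "c \<noteq> 0"
  proof
    assume "c = 0"
    then have "nsq n \<phi> = 0" using r by (simp add: nsq_def)
    then show False using assms by simp
  qed
  have "path_sign n ((!) x) * fold (step n) \<alpha>s (\<lambda>_. 1) x = inverse c * \<phi> x" if "x \<in> bl n" for x
  proof -
    have "c * (path_sign n ((!) x) * fold (step n) \<alpha>s (\<lambda>_. 1) x) = (path_sign n ((!) x) * path_sign n ((!) x)) * \<phi> x"
      unfolding mult.assoc r[OF that] by (simp only: mult.left_commute)
    then show ?thesis using \<open>c \<noteq> 0\<close> by (simp add: field_simps)
  qed
  then show ?thesis by (rule strat_cluster)
qed

theorem theorem17:
  fixes m :: nat and e0 e1 :: "bool list \<Rightarrow> complex"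
  assumes "encoding m e0 e1"
  shows "encoded_universal m e0 e1 \<and> cc_universal m e0 e1"
  using encoded_universal_if_cluster_strat[OF assms strat_cluster_pauli_leaf]
    cc_universal_if_cluster_strat[OF assms strat_cluster_pauli_leaf] by blast

end
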